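(* Every connected $6$-regular graph of odd order has a rooted $3$-odd decomposition, i.e.\ a decomposition into three closed trails, each of odd length, all sharing a common vertex.
   Context: Graphs are finite and may have multiple edges and loops (a loop contributes $2$ to the degree of its vertex). A graph is eulerian if it is connected and every vertex has even degree. A decomposition of a graph $G$ is a set $\{G_1,\dots,G_k\}$ of subgraphs of $G$ whose edge sets partition $E(G)$. A decomposition is $k$-odd if it has $k$ constituents, each of which is an eulerian subgraph (equivalently, a closed trail) with an odd number of edges. It is rooted if there is a vertex $v$ of $G$ contained in every constituent. *)

theory Defs
  imports Main "HOL-Library.Disjoint_Sets"
begin

text \<open>An edge has a set of one or two ends; an edge with exactly one end is a loop.
  Distinct edges may have the same ends.\<close>

record ('v, 'e) multigraph =
  mverts :: "'v set"
  medges :: "'e set"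
  mends :: "'e \<Rightarrow> 'v set"

locale finite_multigraph =
  fixes G :: "('v, 'e) multigraph"
  assumes finite_mverts: "finite (mverts G)"
    and finite_medges: "finite (medges G)"
    and mends_subset: "e \<in> medges G \<Longrightarrow> mends G e \<subseteq> mverts G"
    and card_mends: "e \<in> medges G \<Longrightarrow> card (mends G e) \<in> {1, 2}"

text \<open>The second summand makes a loop contribute \<open>2\<close> in total.\<close>

definition mdegree :: "('v, 'e) multigraph \<Rightarrow> 'v \<Rightarrow> nat" where
  "mdegree G v =
     card {e \<in> medges G. v \<in> mends G e} + card {e \<in> medges G. mends G e = {v}}"

definition mregular :: "nat \<Rightarrow> ('v, 'e) multigraph \<Rightarrow> bool" where
  "mregular r G \<longleftrightarrow> (\<forall>v \<in> mverts G. mdegree G v = r)"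

definition madjacency :: "('v, 'e) multigraph \<Rightarrow> ('v \<times> 'v) set" where
  "madjacency G = {(u, v). \<exists>e \<in> medges G. mends G e = {u, v}}"

definition mconnected :: "('v, 'e) multigraph \<Rightarrow> bool" where
  "mconnected G \<longleftrightarrow>
     mverts G \<noteq> {} \<and> (\<forall>u \<in> mverts G. \<forall>v \<in> mverts G. (u, v) \<in> (madjacency G)\<^sup>*)"

definition eulerian :: "('v, 'e) multigraph \<Rightarrow> bool" where
  "eulerian G \<longleftrightarrow> mconnected G \<and> (\<forall>v \<in> mverts G. even (mdegree G v))"

text \<open>A subgraph carries the same end map, so it is determined by its vertex and edge sets.\<close>

definition msubgraph :: "('v, 'e) multigraph \<Rightarrow> ('v, 'e) multigraph \<Rightarrow> bool" where
  "msubgraph H G \<longleftrightarrow> finite_multigraph H \<and>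
     mverts H \<subseteq> mverts G \<and> medges H \<subseteq> medges G \<and> mends H = mends G"

definition decomposition :: "('v, 'e) multigraph \<Rightarrow> ('v, 'e) multigraph set \<Rightarrow> bool" where
  "decomposition G D \<longleftrightarrow> finite D \<and> (\<forall>H \<in> D. msubgraph H G \<and> medges H \<noteq> {}) \<and>
     disjoint_family_on medges D \<and> (\<Union>H \<in> D. medges H) = medges G"

definition odd_decomposition ::
    "nat \<Rightarrow> ('v, 'e) multigraph \<Rightarrow> ('v, 'e) multigraph set \<Rightarrow> bool" where
  "odd_decomposition k G D \<longleftrightarrow> decomposition G D \<and> card D = k \<and>
     (\<forall>H \<in> D. eulerian H \<and> odd (card (medges H)))"

definition rooted :: "('v, 'e) multigraph \<Rightarrow> ('v, 'e) multigraph set \<Rightarrow> bool" where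
  "rooted G D \<longleftrightarrow> (\<exists>v \<in> mverts G. \<forall>H \<in> D. v \<in> mverts H)"

end

theory Submission
  imports Defs
begin

text \<open>
  Give every edge the sign \<open>-1\<close>. At a vertex \<open>v\<close> of degree 6 the three closed trails correspond to
  three edge-disjoint walks from one copy of \<open>v\<close> to the other in the bipartite double cover. If every
  cut of the graph has at least 4 edges, this is possible as soon as every disjoint pair of vertex sets
  \<open>(X\<^sub>1, X\<^sub>2)\<close> with \<open>v \<in> X\<^sub>1\<close> satisfies the obvious condition that at least 6 edge ends at \<open>X\<^sub>1 \<union> X\<^sub>2\<close>
  do not belong to edges between \<open>X\<^sub>1\<close> and \<open>X\<^sub>2\<close>. For arbitrary signs this is proved by splitting off
  pairs of edges, multiplying their signs: the bisubmodularity of the counting function, together with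
  its value modulo 4 on pairs that cover all vertices, shows that some splitting keeps all conditions.

  A pair violating the condition satisfies \<open>|X\<^sub>1| = |X\<^sub>2|\<close> by regularity, and the maximal unions
  \<open>X\<^sub>1 \<union> X\<^sub>2\<close> of violating pairs are disjoint; since the order is odd, they miss some vertex \<open>v\<close>.
  Cuts with only two edges are removed beforehand by replacing the side of even order by one edge.
\<close>

section \<open>Signed graphs and costs of ternary maps\<close>

text \<open>A closed trail through \<open>v\<close> with an odd number of negative edges lifts to a
  walk between the two copies of \<open>v\<close>, and so does its mirror image: three trails give
  six walks, whence the bound 6 on \<open>cost\<close>. The signs are there because splitting off
  replaces a path by one edge, whose sign must remember the parity of the path.

  All costs are even, and one splitting lowers a cost by 0, 2 or 4. A map of cost 6 with support
  beyond \<open>v\<close> leaves no room for this; its support is contracted to \<open>v\<close>,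
  and the walks inside it are recovered by Menger's theorem. Once there is no such map, all maps
  with support beyond \<open>v\<close> cost at least 8, and those of cost 8 are the main
  obstruction. If two of them conflict on an edge, uncrossing saves 4 and leaves 12 for meet and
  join, so one of these is trivial off \<open>v\<close>.

  The obstacle is a pair of maps that are opposite off \<open>v\<close>: their meet and join are
  both trivial, and uncrossing proves nothing. Here the residue modulo 4, or the cut condition if
  some vertex has value 0, forces the two costs to exceed 16 in total.\<close>

definition deg :: "'e set \<Rightarrow> ('e \<Rightarrow> 'v) \<Rightarrow> ('e \<Rightarrow> 'v) \<Rightarrow> 'v \<Rightarrow> int" where
  "deg E l r w = (\<Sum>e\<in>E. of_bool (l e = w) + of_bool (r e = w))"

definition ecost :: "('e \<Rightarrow> 'v) \<Rightarrow> ('e \<Rightarrow> 'v) \<Rightarrow> ('e \<Rightarrow> int) \<Rightarrow> ('v \<Rightarrow> int) \<Rightarrow> 'e \<Rightarrow> int" where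
  "ecost l r \<sigma> s e = \<bar>s (l e) - \<sigma> e * s (r e)\<bar>"

text \<open>A map \<open>s\<close> from vertices to \<open>{-1, 0, 1}\<close> encodes a set in the signed double cover that contains at
  most one copy of each vertex; \<open>cost\<close> is the number of edges of the double cover that leave it.\<close>

definition cost :: "'e set \<Rightarrow> ('e \<Rightarrow> 'v) \<Rightarrow> ('e \<Rightarrow> 'v) \<Rightarrow> ('e \<Rightarrow> int) \<Rightarrow> ('v \<Rightarrow> int) \<Rightarrow> int" where
  "cost E l r \<sigma> s = (\<Sum>e\<in>E. ecost l r \<sigma> s e)"

definition crosses :: "('e \<Rightarrow> 'v) \<Rightarrow> ('e \<Rightarrow> 'v) \<Rightarrow> 'v set \<Rightarrow> 'e \<Rightarrow> int" where
  "crosses l r K e = of_bool ((l e \<in> K) \<noteq> (r e \<in> K))"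

definition dcut :: "'e set \<Rightarrow> ('e \<Rightarrow> 'v) \<Rightarrow> ('e \<Rightarrow> 'v) \<Rightarrow> 'v set \<Rightarrow> int" where
  "dcut E l r K = (\<Sum>e\<in>E. crosses l r K e)"

definition joins :: "('e \<Rightarrow> 'v) \<Rightarrow> ('e \<Rightarrow> 'v) \<Rightarrow> 'e \<Rightarrow> 'v \<Rightarrow> 'v \<Rightarrow> bool" where
  "joins l r e x y \<longleftrightarrow> l e = x \<and> r e = y \<or> l e = y \<and> r e = x"

definition adj :: "'e set \<Rightarrow> ('e \<Rightarrow> 'v) \<Rightarrow> ('e \<Rightarrow> 'v) \<Rightarrow> ('v \<times> 'v) set" where
  "adj E l r = {(x, y). \<exists>e\<in>E. joins l r e x y}"

text \<open>Left ends suffice, because the right end of an edge is one step further. Vertices that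
  meet no edge of the set are ignored.\<close>

definition conn :: "'e set \<Rightarrow> ('e \<Rightarrow> 'v) \<Rightarrow> ('e \<Rightarrow> 'v) \<Rightarrow> 'v \<Rightarrow> bool" where
  "conn E l r v \<longleftrightarrow> (\<forall>e\<in>E. (v, l e) \<in> (adj E l r)\<^sup>*)"

text \<open>The edge set of a closed trail through \<open>v\<close> with an odd number of negative
  edges. The sign product also excludes the empty set, so that some edge of the part meets
  \<open>v\<close>.\<close>

definition odd_part ::
    "'e set \<Rightarrow> ('e \<Rightarrow> 'v) \<Rightarrow> ('e \<Rightarrow> 'v) \<Rightarrow> ('e \<Rightarrow> int) \<Rightarrow> 'v \<Rightarrow> bool" where
  "odd_part F l r \<sigma> v \<longleftrightarrow>
     (\<forall>w. even (deg F l r w)) \<and> conn F l r v \<and> prod \<sigma> F = - 1"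

definition rooted3 ::
    "'e set \<Rightarrow> ('e \<Rightarrow> 'v) \<Rightarrow> ('e \<Rightarrow> 'v) \<Rightarrow> ('e \<Rightarrow> int) \<Rightarrow> 'v \<Rightarrow> bool" where
  "rooted3 E l r \<sigma> v \<longleftrightarrow>
     (\<exists>F. (\<Union>i<(3::nat). F i) = E \<and> disjoint_family_on F {..<3} \<and>
          (\<forall>i<3. odd_part (F i) l r \<sigma> v))"

definition tern :: "('v \<Rightarrow> int) \<Rightarrow> bool" where
  "tern s \<longleftrightarrow> (\<forall>w. s w = - 1 \<or> s w = 0 \<or> s w = 1)"

text \<open>Together with \<open>join\<close> these are the bisubmodular operations on pairs of
  disjoint sets, read as the sets of value 1 and of value -1: the intersection, and the union from
  which vertices with conflicting values are dropped.\<close>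

definition meet :: "('v \<Rightarrow> int) \<Rightarrow> ('v \<Rightarrow> int) \<Rightarrow> 'v \<Rightarrow> int" where
  "meet s t w = (if s w = t w then s w else 0)"

definition join :: "('v \<Rightarrow> int) \<Rightarrow> ('v \<Rightarrow> int) \<Rightarrow> 'v \<Rightarrow> int" where
  "join s t w = sgn (s w + t w)"

section \<open>Adjacency, degrees and double counting\<close>

lemma joins_sym: "joins l r e x y \<Longrightarrow> joins l r e y x"
  by (auto simp: joins_def)

lemma joins_lr: "joins l r e (l e) (r e)"
  by (auto simp: joins_def)

lemma adj_sym: "(x, y) \<in> adj E l r \<Longrightarrow> (y, x) \<in> adj E l r"
  by (auto simp: adj_def joins_def)

lemma adj_rtrancl_sym: "(x, y) \<in> (adj E l r)\<^sup>* \<Longrightarrow> (y, x) \<in> (adj E l r)\<^sup>*"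
proof -
  have "sym (adj E l r)" by (auto simp: sym_def intro: adj_sym)
  then have "sym ((adj E l r)\<^sup>*)" by (rule sym_rtrancl)
  then show "(x, y) \<in> (adj E l r)\<^sup>* \<Longrightarrow> (y, x) \<in> (adj E l r)\<^sup>*" by (auto dest: symD)
qed

lemma adj_mono: "A \<subseteq> B \<Longrightarrow> adj A l r \<subseteq> adj B l r"
  by (auto simp: adj_def)

lemma adj_rtrancl_mono: "(x, y) \<in> (adj A l r)\<^sup>* \<Longrightarrow> A \<subseteq> B \<Longrightarrow> (x, y) \<in> (adj B l r)\<^sup>*"
  using rtrancl_mono[OF adj_mono] by blast

lemma adj_edge: "e \<in> E \<Longrightarrow> joins l r e x y \<Longrightarrow> (x, y) \<in> adj E l r"
  by (auto simp: adj_def)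

lemma conn_ends:
  assumes "conn E l r v" "e \<in> E" "joins l r e x y"
  shows "(v, x) \<in> (adj E l r)\<^sup>*"
proof -
  have a: "(v, l e) \<in> (adj E l r)\<^sup>*" using assms by (auto simp: conn_def)
  have "(l e, r e) \<in> adj E l r" using assms(2) joins_lr by (rule adj_edge)
  then have "(v, r e) \<in> (adj E l r)\<^sup>*" using a by simp
  then show ?thesis using a assms(3) by (auto simp: joins_def)
qed

lemma deg_Un: "finite A \<Longrightarrow> finite B \<Longrightarrow> A \<inter> B = {} \<Longrightarrow> deg (A \<union> B) l r w = deg A l r w + deg B l r w"
  unfolding deg_def by (rule sum.union_disjoint)

lemma deg_diff: "finite A \<Longrightarrow> B \<subseteq> A \<Longrightarrow> deg (A - B) l r w = deg A l r w - deg B l r w"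
  unfolding deg_def by (rule sum_diff)

lemma deg_remove: "finite A \<Longrightarrow> e \<in> A \<Longrightarrow>
    deg A l r w = of_bool (l e = w) + of_bool (r e = w) + deg (A - {e}) l r w"
  unfolding deg_def by (rule sum.remove)

lemma deg_empty [simp]: "deg {} l r w = 0"
  by (simp add: deg_def)

lemma deg_nonneg: "0 \<le> deg A l r w"
  by (auto simp: deg_def intro: sum_nonneg)

lemma deg_pos: "finite A \<Longrightarrow> e \<in> A \<Longrightarrow> joins l r e w x \<Longrightarrow> 0 < deg A l r w"
  using deg_remove[of A e l r w] deg_nonneg[of "A - {e}" l r w] by (auto simp: joins_def)

lemma sum_deg:
  fixes s :: "'v \<Rightarrow> int"
  assumes "finite E" "finite V" "\<And>e. e \<in> E \<Longrightarrow> l e \<in> V \<and> r e \<in> V"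
  shows "(\<Sum>w\<in>V. deg E l r w * s w) = (\<Sum>e\<in>E. s (l e) + s (r e))"
proof -
  have "(\<Sum>w\<in>V. deg E l r w * s w) = (\<Sum>w\<in>V. \<Sum>e\<in>E. (of_bool (l e = w) + of_bool (r e = w)) * s w)"
    by (simp add: deg_def sum_distrib_right)
  also have "\<dots> = (\<Sum>e\<in>E. \<Sum>w\<in>V. (of_bool (l e = w) + of_bool (r e = w)) * s w)"
    by (rule sum.swap)
  also have "\<dots> = (\<Sum>e\<in>E. s (l e) + s (r e))"
  proof (rule sum.cong[OF refl])
    fix e assume e: "e \<in> E"
    have "(\<Sum>w\<in>V. (of_bool (l e = w) + of_bool (r e = w)) * s w) =
       (\<Sum>w\<in>V. (if l e = w then s w else 0)) + (\<Sum>w\<in>V. (if r e = w then s w else 0))"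
      by (simp add: sum.distrib[symmetric] distrib_right of_bool_def if_distrib cong: if_cong)
        (auto intro!: sum.cong)
    also have "\<dots> = s (l e) + s (r e)" using assms(2) assms(3)[OF e] by simp
    finally show "(\<Sum>w\<in>V. (of_bool (l e = w) + of_bool (r e = w)) * s w) = s (l e) + s (r e)" .
  qed
  finally show ?thesis .
qed

text \<open>Each vertex enters the product once per edge end, hence an even number of times. So
  switching signs by a potential \<open>s\<close> preserves the sign product of every edge set with
  even degrees.\<close>

lemma prod_deg:
  fixes s :: "'v \<Rightarrow> int"
  assumes "finite E" "\<And>w. even (deg E l r w)" "\<And>w. s w = 1 \<or> s w = - 1"
  shows "(\<Prod>e\<in>E. s (l e) * s (r e)) = 1"
proof -
  define V where "V = l ` E \<union> r ` E"
  have fV: "finite V" using assms(1) by (simp add: V_def)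
  have inV: "\<And>e. e \<in> E \<Longrightarrow> l e \<in> V \<and> r e \<in> V" by (auto simp: V_def)
  define m where "m w = (if s w = 1 then 0 else 1 :: int)" for w
  have "(\<Sum>e\<in>E. m (l e) + m (r e)) = (\<Sum>w\<in>V. deg E l r w * m w)"
    using sum_deg[OF assms(1) fV inV, where s=m] by simp
  also have "even \<dots>" using assms(2) by (auto intro: dvd_sum)
  finally have ev: "even (\<Sum>e\<in>E. m (l e) + m (r e))" .
  have "(\<Prod>e\<in>A. s (l e) * s (r e)) = (if even (\<Sum>e\<in>A. m (l e) + m (r e)) then 1 else - 1)"
    if "finite A" for A
    using that
  proof induction
    case (insert x F)
    have "s (l x) * s (r x) = (if even (m (l x) + m (r x)) then 1 else - 1)"
      using assms(3)[of "l x"] assms(3)[of "r x"] by (auto simp: m_def)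
    then show ?case using insert by auto
  qed simp
  with assms(1) ev show ?thesis by simp
qed

text \<open>Modulo 2 an edge costs \<open>s (l e) + s (r e)\<close>, and summed over all edges this
  is a combination of the even degrees.\<close>

lemma cost_even:
  assumes "finite E" "\<And>w. even (deg E l r w)" "\<And>e. e \<in> E \<Longrightarrow> \<sigma> e = 1 \<or> \<sigma> e = - 1"
  shows "even (cost E l r \<sigma> s)"
proof -
  define V where "V = l ` E \<union> r ` E"
  have fV: "finite V" using assms(1) by (simp add: V_def)
  have inV: "\<And>e. e \<in> E \<Longrightarrow> l e \<in> V \<and> r e \<in> V" by (auto simp: V_def)
  have "(\<Sum>e\<in>E. s (l e) + s (r e)) = (\<Sum>w\<in>V. deg E l r w * s w)"
    using sum_deg[OF assms(1) fV inV, where s=s] by simp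
  also have "even \<dots>" using assms(2) by (auto intro: dvd_sum)
  finally have ev: "even (\<Sum>e\<in>E. s (l e) + s (r e))" .
  have "even (cost E l r \<sigma> s - (\<Sum>e\<in>E. s (l e) + s (r e)))"
    unfolding cost_def sum_subtractf[symmetric]
  proof (rule dvd_sum)
    fix e assume "e \<in> E"
    from assms(3)[OF this] show "even (ecost l r \<sigma> s e - (s (l e) + s (r e)))"
      by (auto simp: ecost_def abs_if)
  qed
  with ev show ?thesis by simp
qed

text \<open>Through this form cuts inherit parity and the effect of splitting from costs with all
  signs 1.\<close>

lemma dcut_cost: "dcut E l r K = cost E l r (\<lambda>_. 1) (\<lambda>w. of_bool (w \<in> K))"
  by (auto simp: dcut_def cost_def crosses_def ecost_def intro!: sum.cong)

lemma dcut_even: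
  assumes "finite E" "\<And>w. even (deg E l r w)"
  shows "even (dcut E l r K)"
  unfolding dcut_cost by (rule cost_even) (use assms in auto)

text \<open>After switching by \<open>s\<close>, an edge costs 2 if its sign is -1 and 0 otherwise.
  Switching keeps the product -1, so the number of edges that cost 2 is odd.\<close>

lemma cost_full_mod4:
  assumes "finite E" "\<And>w. even (deg E l r w)" "\<And>e. e \<in> E \<Longrightarrow> \<sigma> e = 1 \<or> \<sigma> e = - 1"
    and "prod \<sigma> E = - 1" and s: "\<And>e. e \<in> E \<Longrightarrow> (s (l e) = 1 \<or> s (l e) = - 1) \<and> (s (r e) = 1 \<or> s (r e) = - 1)"
  shows "cost E l r \<sigma> s mod 4 = 2"
proof -
  define q where "q e = \<sigma> e * (s (l e) * s (r e))" for e
  have q: "q e = 1 \<or> q e = - 1" "ecost l r \<sigma> s e = 1 - q e" if "e \<in> E" for e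
    using assms(3)[OF that] s[OF that] by (auto simp: q_def ecost_def)
  \<comment> \<open>\<open>s\<close> is known to be 1 or -1 only at ends of edges, whereas
    \<open>prod_deg\<close> asks for this everywhere.\<close>
  define s' where "s' w = (if s w = 1 then 1 else - 1 :: int)" for w
  have "(\<Prod>e\<in>E. s (l e) * s (r e)) = (\<Prod>e\<in>E. s' (l e) * s' (r e))"
    by (rule prod.cong) (auto simp: s'_def dest!: s)
  also have "\<dots> = 1" by (rule prod_deg) (use assms(1,2) in \<open>auto simp: s'_def\<close>)
  finally have pq: "prod q E = - 1" using assms(4) by (simp add: q_def prod.distrib)
  have "(\<Sum>e\<in>A. 1 - q e) mod 4 = (if prod q A = 1 then 0 else 2) \<and> (prod q A = 1 \<or> prod q A = - 1)"
    if "finite A" "A \<subseteq> E" for A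
    using that
  proof induction
    case (insert x F)
    then have "q x = 1 \<or> q x = - 1" using q by auto
    moreover define S where "S = (\<Sum>e\<in>F. 1 - q e)"
    moreover have "S mod 4 = (if prod q F = 1 then 0 else 2)"
      "prod q F = 1 \<or> prod q F = - 1" using insert by (auto simp: S_def)
    moreover have "(\<Sum>e\<in>insert x F. 1 - q e) = 1 - q x + S" "prod q (insert x F) = q x * prod q F"
      using insert.hyps by (simp_all add: S_def)
    ultimately show ?case
      by (elim disjE; simp; presburger?)
  qed simp
  from this[OF assms(1) order_refl] pq have "(\<Sum>e\<in>E. 1 - q e) mod 4 = 2" by simp
  moreover have "cost E l r \<sigma> s = (\<Sum>e\<in>E. 1 - q e)" unfolding cost_def by (rule sum.cong) (use q in auto)
  ultimately show ?thesis by simp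
qed

section \<open>Bisubmodularity\<close>

lemma tern_meet: "tern s \<Longrightarrow> tern t \<Longrightarrow> tern (meet s t)"
  by (auto simp: tern_def meet_def)

lemma tern_join: "tern s \<Longrightarrow> tern t \<Longrightarrow> tern (join s t)"
  by (auto simp: tern_def join_def sgn_if)

text \<open>Bisubmodularity already holds for each edge, where it is a finite check over four values
  and a sign.\<close>

lemma ecost_meet_join:
  assumes "tern s" "tern t" "\<sigma> e = 1 \<or> \<sigma> e = - 1"
  shows "ecost l r \<sigma> (meet s t) e + ecost l r \<sigma> (join s t) e \<le> ecost l r \<sigma> s e + ecost l r \<sigma> t e"
proof -
  have "s (l e) = - 1 \<or> s (l e) = 0 \<or> s (l e) = 1" "s (r e) = - 1 \<or> s (r e) = 0 \<or> s (r e) = 1"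
    "t (l e) = - 1 \<or> t (l e) = 0 \<or> t (l e) = 1" "t (r e) = - 1 \<or> t (r e) = 0 \<or> t (r e) = 1"
    using assms by (auto simp: tern_def)
  then show ?thesis using assms(3) unfolding ecost_def meet_def join_def
    by (elim disjE) simp_all
qed

lemma cost_meet_join:
  assumes "tern s" "tern t" "\<And>e. e \<in> E \<Longrightarrow> \<sigma> e = 1 \<or> \<sigma> e = - 1"
  shows "cost E l r \<sigma> (meet s t) + cost E l r \<sigma> (join s t) \<le> cost E l r \<sigma> s + cost E l r \<sigma> t"
  unfolding cost_def sum.distrib[symmetric] by (intro sum_mono ecost_meet_join assms)

text \<open>It is applied with \<open>k = 4\<close>, to an edge that costs 2 under both maps and 0
  under their meet and join.\<close>

lemma cost_meet_join_drop:
  assumes "finite E" "e0 \<in> E" "tern s" "tern t" "\<And>e. e \<in> E \<Longrightarrow> \<sigma> e = 1 \<or> \<sigma> e = - 1"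
    and "ecost l r \<sigma> (meet s t) e0 + ecost l r \<sigma> (join s t) e0 + k \<le> ecost l r \<sigma> s e0 + ecost l r \<sigma> t e0"
  shows "cost E l r \<sigma> (meet s t) + cost E l r \<sigma> (join s t) + k \<le> cost E l r \<sigma> s + cost E l r \<sigma> t"
proof -
  have "cost (E - {e0}) l r \<sigma> (meet s t) + cost (E - {e0}) l r \<sigma> (join s t) \<le> cost (E - {e0}) l r \<sigma> s + cost (E - {e0}) l r \<sigma> t"
    by (rule cost_meet_join) (use assms in auto)
  then show ?thesis using assms(6) unfolding cost_def
    by (simp add: sum.remove[OF assms(1,2)])
qed

lemma dcut_Int_Un: "dcut E l r (A \<inter> B) + dcut E l r (A \<union> B) \<le> dcut E l r A + dcut E l r B"
  unfolding dcut_def sum.distrib[symmetric] by (rule sum_mono) (auto simp: crosses_def)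

lemma dcut_nonneg: "0 \<le> dcut E l r K"
  by (auto simp: dcut_def crosses_def intro: sum_nonneg)

lemma ecost_joins:
  assumes "joins l r e x y" "\<sigma> e = 1 \<or> \<sigma> e = - 1"
  shows "ecost l r \<sigma> s e = \<bar>\<sigma> e * s x - s y\<bar>"
  using assms by (auto simp: joins_def ecost_def)

lemma crosses_joins:
  assumes "joins l r e x y"
  shows "crosses l r K e = of_bool ((x \<in> K) \<noteq> (y \<in> K))"
  using assms by (auto simp: joins_def crosses_def)

section \<open>Attaching even parts and linking tokens\<close>

definition comp_edges :: "'e set \<Rightarrow> ('e \<Rightarrow> 'v) \<Rightarrow> ('e \<Rightarrow> 'v) \<Rightarrow> 'v \<Rightarrow> 'e set" where
  "comp_edges L l r w = {e \<in> L. (w, l e) \<in> (adj L l r)\<^sup>*}"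

lemma comp_edges_r: "e \<in> comp_edges L l r w \<longleftrightarrow> e \<in> L \<and> (w, r e) \<in> (adj L l r)\<^sup>*"
proof -
  have "(l e, r e) \<in> adj L l r" "(r e, l e) \<in> adj L l r" if "e \<in> L"
    using that unfolding adj_def joins_def by auto
  then show ?thesis by (auto simp: comp_edges_def)
qed

lemma deg_comp_edges:
  assumes "finite L"
  shows "deg (comp_edges L l r w) l r x = (if (w, x) \<in> (adj L l r)\<^sup>* then deg L l r x else 0)"
proof (cases "(w, x) \<in> (adj L l r)\<^sup>*")
  case True
  have "deg (comp_edges L l r w) l r x = deg L l r x"
    unfolding deg_def
  proof (rule sum.mono_neutral_left[OF assms])
    show "comp_edges L l r w \<subseteq> L" by (auto simp: comp_edges_def)
    show "\<forall>i\<in>L - comp_edges L l r w. of_bool (l i = x) + of_bool (r i = x) = (0::int)"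
    proof
      fix i assume "i \<in> L - comp_edges L l r w"
      then have "(w, l i) \<notin> (adj L l r)\<^sup>*" "(w, r i) \<notin> (adj L l r)\<^sup>*"
        using comp_edges_r[of i L l r w] by (auto simp: comp_edges_def)
      with True show "of_bool (l i = x) + of_bool (r i = x) = (0::int)" by auto
    qed
  qed
  with True show ?thesis by simp
next
  case False
  have "deg (comp_edges L l r w) l r x = 0"
    unfolding deg_def
  proof (rule sum.neutral, rule ballI)
    fix e assume e: "e \<in> comp_edges L l r w"
    then have "(w, l e) \<in> (adj L l r)\<^sup>*" by (simp add: comp_edges_def)
    moreover from e have "(w, r e) \<in> (adj L l r)\<^sup>*" by (simp add: comp_edges_r)
    ultimately show "of_bool (l e = x) + of_bool (r e = x) = (0::int)" using False by auto
  qed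
  with False show ?thesis by simp
qed

lemma comp_edges_reach:
  "(w, x) \<in> (adj L l r)\<^sup>* \<Longrightarrow> (w, x) \<in> (adj (comp_edges L l r w) l r)\<^sup>*"
proof (induction rule: rtrancl_induct)
  case (step y z)
  from step.hyps(2) obtain e where e: "e \<in> L" "joins l r e y z" by (auto simp: adj_def)
  then have "e \<in> comp_edges L l r w"
    using step.hyps(1) comp_edges_r[of e L l r w] by (auto simp: joins_def comp_edges_def)
  then have "(y, z) \<in> adj (comp_edges L l r w) l r" using e(2) by (rule adj_edge)
  with step.IH show ?case by simp
qed simp

lemma conn_Un:
  assumes "conn A l r v" "(v, w) \<in> (adj A l r)\<^sup>*" "conn B l r w"
  shows "conn (A \<union> B) l r v"
  unfolding conn_def
proof
  fix e assume "e \<in> A \<union> B"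
  then show "(v, l e) \<in> (adj (A \<union> B) l r)\<^sup>*"
  proof
    assume "e \<in> A"
    with assms(1) have "(v, l e) \<in> (adj A l r)\<^sup>*" by (simp add: conn_def)
    then show ?thesis by (rule adj_rtrancl_mono) auto
  next
    assume "e \<in> B"
    with assms(3) have "(w, l e) \<in> (adj B l r)\<^sup>*" by (simp add: conn_def)
    then have "(w, l e) \<in> (adj (A \<union> B) l r)\<^sup>*" by (rule adj_rtrancl_mono) auto
    moreover have "(v, w) \<in> (adj (A \<union> B) l r)\<^sup>*" using assms(2) by (rule adj_rtrancl_mono) auto
    ultimately show ?thesis by simp
  qed
qed

lemma conn_comp_edges: "conn (comp_edges L l r w) l r w"
  by (auto simp: conn_def comp_edges_def[of L l r w] intro: comp_edges_reach[unfolded comp_edges_def])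

text \<open>As \<open>E\<close> is connected, some edge of \<open>L\<close> touches a vertex that
  one of the parts reaches. The whole component of \<open>L\<close> there has even degrees and sign
  product 1, so that part can absorb it and remains an odd part. The hypothesis speaks of all even
  subsets of \<open>L\<close> because it has to pass to these components and to what is
  left.\<close>

lemma attach:
  fixes F :: "nat \<Rightarrow> 'e set"
  assumes "finite E" "conn E l r v" "\<And>w. even (deg L l r w)"
    and "\<And>C. C \<subseteq> L \<Longrightarrow> (\<And>w. even (deg C l r w)) \<Longrightarrow> prod \<sigma> C = 1"
    and "(\<Union>i<(3::nat). F i) \<union> L = E" "disjoint_family_on F {..<3}" "(\<Union>i<(3::nat). F i) \<inter> L = {}"
    and "\<And>i. i < 3 \<Longrightarrow> odd_part (F i) l r \<sigma> v"
  shows "rooted3 E l r \<sigma> v"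
  using assms(3-)
proof (induction "card L" arbitrary: L F rule: less_induct)
  case less
  have finL: "finite L" using less.prems(3) assms(1) by auto
  show ?case
  proof (cases "L = {}")
    case True
    then show ?thesis using less.prems unfolding rooted3_def by (intro exI[of _ F]) auto
  next
    case False
    define W where "W = (\<Union>i<(3::nat). {w. (v, w) \<in> (adj (F i) l r)\<^sup>*})"
    have vW: "v \<in> W" by (auto simp: W_def intro: exI[of _ 0])
    have FW: "l e \<in> W \<and> r e \<in> W" if "e \<in> F i" "i < 3" for e i
    proof -
      have "conn (F i) l r v" using less.prems(6)[OF that(2)] by (simp add: odd_part_def)
      from conn_ends[OF this that(1) joins_lr] conn_ends[OF this that(1) joins_sym[OF joins_lr]]
      have "(v, l e) \<in> (adj (F i) l r)\<^sup>*" "(v, r e) \<in> (adj (F i) l r)\<^sup>*" .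
      then show ?thesis using that(2) by (auto simp: W_def)
    qed
    have "\<exists>f\<in>L. l f \<in> W \<or> r f \<in> W"
    proof (rule ccontr)
      assume nt: "\<not> ?thesis"
      have "w \<in> W" if "(v, w) \<in> (adj E l r)\<^sup>*" for w
        using that
      proof (induction rule: rtrancl_induct)
        case (step y z)
        from step.hyps(2) obtain e where e: "e \<in> E" "joins l r e y z" by (auto simp: adj_def)
        show ?case
        proof (cases "e \<in> L")
          case True
          with nt step.IH e(2) show ?thesis by (auto simp: joins_def)
        next
          case False
          with e(1) less.prems(3) obtain i where "i < 3" "e \<in> F i" by auto
          with FW e(2) show ?thesis by (auto simp: joins_def)
        qed
      qed (rule vW)
      moreover obtain e where "e \<in> L" using False by auto
      ultimately show False using nt assms(2) less.prems(3) by (auto simp: conn_def)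
    qed
    then obtain f w where f: "f \<in> L" "w \<in> W" "l f = w \<or> r f = w" by auto
    then obtain i where i: "i < 3" "(v, w) \<in> (adj (F i) l r)\<^sup>*" by (auto simp: W_def)
    define C where "C = comp_edges L l r w"
    have fC: "f \<in> C" using f comp_edges_r[of f L l r w] by (auto simp: C_def comp_edges_def)
    have CL: "C \<subseteq> L" by (auto simp: C_def comp_edges_def)
    have finC: "finite C" using CL finL finite_subset by blast
    have evC: "even (deg C l r x)" for x
      unfolding C_def deg_comp_edges[OF finL] using less.prems(1) by simp
    have finF: "finite (F j)" if "j < 3" for j using assms(1) less.prems(3) that
      by (metis UN_I Un_iff finite_subset lessThan_iff subsetI)
    define F' where "F' = F(i := F i \<union> C)"
    have disj: "F i \<inter> C = {}" using CL less.prems(5) i(1) by auto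
    show ?thesis
    proof (rule less.hyps[of "L - C" F'])
      show "card (L - C) < card L" using fC CL finL f(1) by (intro psubset_card_mono) auto
      show "even (deg (L - C) l r x)" for x
        using less.prems(1) evC by (simp add: deg_diff[OF finL CL])
      show "prod \<sigma> D = 1" if "D \<subseteq> L - C" "\<And>w. even (deg D l r w)" for D
        using that less.prems(2) by blast
      show "(\<Union>i<(3::nat). F' i) \<union> (L - C) = E"
        using less.prems(3) CL i(1) by (auto simp: F'_def split: if_splits)
      show "disjoint_family_on F' {..<3}"
        using less.prems(4,5) CL i(1) by (auto simp: F'_def disjoint_family_on_def split: if_splits)
      show "(\<Union>i<(3::nat). F' i) \<inter> (L - C) = {}"
        using less.prems(5) CL i(1) by (auto simp: F'_def split: if_splits)
      show "odd_part (F' j) l r \<sigma> v" if "j < 3" for j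
      proof (cases "j = i")
        case True
        have op: "odd_part (F i) l r \<sigma> v" by (rule less.prems(6)[OF i(1)])
        have "prod \<sigma> (F i \<union> C) = prod \<sigma> (F i) * prod \<sigma> C"
          by (rule prod.union_disjoint[OF finF[OF i(1)] finC disj])
        moreover have "prod \<sigma> C = 1" using less.prems(2)[OF CL] evC by simp
        moreover have "conn (F i \<union> C) l r v"
          using op i(2) conn_comp_edges[of L l r w] by (intro conn_Un) (auto simp: odd_part_def C_def)
        ultimately show ?thesis using op evC True
          by (simp add: F'_def odd_part_def deg_Un[OF finF[OF i(1)] finC disj])
      qed (use that less.prems(6) in \<open>simp add: F'_def\<close>)
    qed
  qed
qed

text \<open>A form of Menger's theorem: tokens are walked to \<open>v\<close> one edge at a time, and a token at
  \<open>x\<close> may use an edge whose other end lies outside the largest tight set that avoids \<open>x\<close>.\<close>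

lemma token_paths:
  fixes y :: "'j \<Rightarrow> 'v"
  assumes "finite J" "finite V" "finite E" "\<And>e. e \<in> E \<Longrightarrow> l e \<in> V \<and> r e \<in> V" "v \<in> V"
    and "\<And>j. j \<in> J \<Longrightarrow> y j \<in> V"
    and "\<And>w. w \<in> V - {v} \<Longrightarrow> even (deg E l r w + int (card {j \<in> J. y j = w}))"
    and "\<And>B. B \<subseteq> V - {v} \<Longrightarrow> int (card {j \<in> J. y j \<in> B}) \<le> dcut E l r B"
  shows "\<exists>H. (\<forall>j\<in>J. H j \<subseteq> E \<and> (v, y j) \<in> (adj (H j) l r)\<^sup>* \<and> conn (H j) l r v \<and>
            (\<forall>w. odd (deg (H j) l r w) \<longleftrightarrow> (w = y j) \<noteq> (w = v))) \<and> disjoint_family_on H J"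
  using assms(3,4,6-)
proof (induction "card E" arbitrary: E y rule: less_induct)
  case less
  show ?case
  proof (cases "\<forall>j\<in>J. y j = v")
    case True
    then show ?thesis
      by (intro exI[of _ "\<lambda>_. {}"]) (auto simp: conn_def disjoint_family_on_def)
  next
    case False
    then obtain i where i: "i \<in> J" "y i \<noteq> v" by auto
    let ?x0 = "y i"
    define tk where "tk B = int (card {j \<in> J. y j \<in> B})" for B
    have tk_sum: "tk B = (\<Sum>j\<in>J. of_bool (y j \<in> B))" for B
      using assms(1) by (simp add: tk_def of_bool_def sum.If_cases Int_def)
    have tk_IU: "tk (A \<inter> B) + tk (A \<union> B) = tk A + tk B" for A B
      unfolding tk_sum sum.distrib[symmetric] by (rule sum.cong) auto
    have dtk: "tk B \<le> dcut E l r B" if "B \<subseteq> V - {v}" for B using less.prems(5)[OF that] by (simp add: tk_def)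
    \<comment> \<open>A set that is not tight therefore has slack at least 2. This is needed when a
      token moves into the set: the set gains a token and loses an edge of its cut at once.\<close>
    have par: "even (dcut E l r B - tk B)" if "B \<subseteq> V - {v}" for B
    proof -
      have finB: "finite B" using that assms(2) finite_subset by blast
      have "(\<Sum>w\<in>V. deg E l r w * of_bool (w \<in> B)) = (\<Sum>e\<in>E. of_bool (l e \<in> B) + of_bool (r e \<in> B))"
        by (rule sum_deg) (use less.prems assms in auto)
      also have "(\<Sum>w\<in>V. deg E l r w * of_bool (w \<in> B)) = (\<Sum>w\<in>B. deg E l r w)"
        using that assms(2) by (intro sum.mono_neutral_cong_right) auto
      finally have s1: "(\<Sum>w\<in>B. deg E l r w) = (\<Sum>e\<in>E. of_bool (l e \<in> B) + of_bool (r e \<in> B))" .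
      have "even ((\<Sum>e\<in>E. of_bool (l e \<in> B) + of_bool (r e \<in> B)) - dcut E l r B)"
        unfolding dcut_def sum_subtractf[symmetric] by (rule dvd_sum) (auto simp: crosses_def)
      moreover have "(\<Sum>w\<in>B. int (card {j \<in> J. y j = w})) = tk B"
      proof -
        have "{j \<in> J. y j \<in> B} = (\<Union>w\<in>B. {j \<in> J. y j = w})" by auto
        also have "card \<dots> = (\<Sum>w\<in>B. card {j \<in> J. y j = w})"
          by (rule card_UN_disjoint) (use finB assms(1) in auto)
        finally show ?thesis by (simp add: tk_def)
      qed
      moreover have "even (\<Sum>w\<in>B. deg E l r w + int (card {j \<in> J. y j = w}))"
        by (rule dvd_sum) (use less.prems(4) that in auto)
      ultimately show ?thesis using s1 by (simp add: sum.distrib)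
    qed
    \<comment> \<open>The family contains the empty set and is closed under union, since
      \<open>tk\<close> is modular and \<open>dcut\<close> submodular; hence its union is the
      largest member.\<close>
    define T where "T = {B. B \<subseteq> V - {v} \<and> ?x0 \<notin> B \<and> dcut E l r B = tk B}"
    have TUn: "A \<union> B \<in> T" if "A \<in> T" "B \<in> T" for A B
    proof -
      have "A \<inter> B \<subseteq> V - {v}" "A \<union> B \<subseteq> V - {v}" using that by (auto simp: T_def)
      from dtk[OF this(1)] dtk[OF this(2)] dcut_Int_Un[of E l r A B] tk_IU[of A B] that
      show ?thesis by (auto simp: T_def)
    qed
    have finT: "finite T" by (rule finite_subset[of _ "Pow V"]) (use assms(2) in \<open>auto simp: T_def\<close>)
    have "\<Union>T' \<in> T" if "finite T'" "T' \<subseteq> T" for T'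
      using that by induction (auto simp: TUn, auto simp: T_def dcut_def crosses_def tk_def)
    from this[OF finT order_refl] have UT: "\<Union>T \<in> T" .
    define B where "B = \<Union>T"
    have B: "B \<subseteq> V - {v}" "?x0 \<notin> B" "dcut E l r B = tk B" using UT by (auto simp: B_def T_def)
    \<comment> \<open>Otherwise adding \<open>?x0\<close> to the tight set \<open>B\<close> would
      not enlarge its cut, but would bring in at least one more token.\<close>
    have "\<exists>e\<in>E. \<exists>x. joins l r e ?x0 x \<and> x \<noteq> ?x0 \<and> x \<notin> B"
    proof (rule ccontr)
      assume n: "\<not> ?thesis"
      have "dcut E l r (insert ?x0 B) \<le> dcut E l r B"
        unfolding dcut_def
      proof (rule sum_mono)
        fix e assume "e \<in> E"
        with n show "crosses l r (insert ?x0 B) e \<le> crosses l r B e"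
          by (auto simp: crosses_def joins_def)
      qed
      moreover have "insert ?x0 B \<subseteq> V - {v}" using B i less.prems(3) by auto
      moreover have "tk (insert ?x0 B) = tk B + tk {?x0}"
        using tk_IU[of "{?x0}" B] B(2) by (simp add: tk_def)
      moreover have "tk {?x0} > 0" using i assms(1) by (auto simp: tk_def card_gt_0_iff)
      ultimately show False using dtk[of "insert ?x0 B"] B(3) by simp
    qed
    then obtain e x where e: "e \<in> E" "joins l r e ?x0 x" "x \<noteq> ?x0" "x \<notin> B" by auto
    have xV: "x \<in> V" using e less.prems(2) by (auto simp: joins_def)
    define y' where "y' = y(i := x)"
    define tk' where "tk' B = int (card {j \<in> J. y' j \<in> B})" for B
    have tk'_sum: "tk' B = (\<Sum>j\<in>J. of_bool (y' j \<in> B))" for B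
      using assms(1) by (simp add: tk'_def of_bool_def sum.If_cases Int_def)
    have tk': "tk' B + of_bool (?x0 \<in> B) = tk B + of_bool (x \<in> B)" for B
    proof -
      have "(\<Sum>j\<in>J - {i}. of_bool (y' j \<in> B)) = (\<Sum>j\<in>J - {i}. of_bool (y j \<in> B) :: int)"
        by (rule sum.cong) (auto simp: y'_def)
      then show ?thesis
        unfolding tk_sum tk'_sum sum.remove[OF assms(1) i(1)] by (simp add: y'_def)
    qed
    have dge: "deg E l r w = of_bool (w = ?x0) + of_bool (w = x) + deg (E - {e}) l r w" for w
      using deg_remove[OF less.prems(1) e(1), of l r w] e(2,3) by (auto simp: joins_def)
    have dce: "dcut E l r D = of_bool ((?x0 \<in> D) \<noteq> (x \<in> D)) + dcut (E - {e}) l r D" for D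
      unfolding dcut_def using sum.remove[OF less.prems(1) e(1)] crosses_joins[OF e(2)] by metis
    have "\<exists>H. (\<forall>j\<in>J. H j \<subseteq> E - {e} \<and> (v, y' j) \<in> (adj (H j) l r)\<^sup>* \<and> conn (H j) l r v \<and>
            (\<forall>w. odd (deg (H j) l r w) \<longleftrightarrow> (w = y' j) \<noteq> (w = v))) \<and> disjoint_family_on H J"
    proof (rule less.hyps)
      show "card (E - {e}) < card E" using e(1) less.prems(1) by (rule card_Diff1_less[rotated])
      show "finite (E - {e})" using less.prems(1) by simp
      show "\<And>e'. e' \<in> E - {e} \<Longrightarrow> l e' \<in> V \<and> r e' \<in> V" using less.prems(2) by auto
      show "\<And>j. j \<in> J \<Longrightarrow> y' j \<in> V" using less.prems(3) xV by (auto simp: y'_def)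
      show "even (deg (E - {e}) l r w + int (card {j \<in> J. y' j = w}))" if w: "w \<in> V - {v}" for w
      proof -
        have "deg (E - {e}) l r w + tk' {w} = deg E l r w + tk {w} - 2 * of_bool (w = ?x0)"
          using tk'[of "{w}"] dge[of w] by (auto simp: of_bool_def split: if_splits)
        moreover have "even (deg E l r w + tk {w} - 2 * of_bool (w = ?x0))"
          using less.prems(4)[OF w] by (simp add: tk_def)
        ultimately show ?thesis by (simp add: tk'_def)
      qed
      show "int (card {j \<in> J. y' j \<in> D}) \<le> dcut (E - {e}) l r D" if D: "D \<subseteq> V - {v}" for D
      proof -
        have "tk' D \<le> dcut (E - {e}) l r D"
        proof (cases "x \<in> D \<and> ?x0 \<notin> D")
          case True
          then have "D \<notin> T" using e(4) by (auto simp: B_def)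
          then have "dcut E l r D \<noteq> tk D" using True D by (auto simp: T_def)
          with dtk[OF D] par[OF D] have "tk D + 2 \<le> dcut E l r D" by presburger
          then show ?thesis using tk'[of D] dce[of D] True by simp
        next
          case False
          then show ?thesis using tk'[of D] dce[of D] dtk[OF D]
            by (auto simp: of_bool_def split: if_splits)
        qed
        then show ?thesis by (simp add: tk'_def)
      qed
    qed
    then obtain H where H0: "\<forall>j\<in>J. H j \<subseteq> E - {e} \<and> (v, y' j) \<in> (adj (H j) l r)\<^sup>* \<and>
        conn (H j) l r v \<and> (\<forall>w. odd (deg (H j) l r w) \<longleftrightarrow> (w = y' j) \<noteq> (w = v))"
      and Hd: "disjoint_family_on H J" by (elim exE conjE)
    have H: "H j \<subseteq> E - {e} \<and> (v, y' j) \<in> (adj (H j) l r)\<^sup>* \<and>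
        conn (H j) l r v \<and> (\<forall>w. odd (deg (H j) l r w) \<longleftrightarrow> (w = y' j) \<noteq> (w = v))" if "j \<in> J" for j
      using H0 that by (rule bspec)
    define H' where "H' = H(i := insert e (H i))"
    have eH: "e \<notin> H j" if "j \<in> J" for j using H[OF that] by auto
    have Hi: "(v, x) \<in> (adj (H i) l r)\<^sup>*" "conn (H i) l r v"
      "odd (deg (H i) l r w) \<longleftrightarrow> (w = x) \<noteq> (w = v)" for w
      using H[OF i(1)] by (auto simp: y'_def)
    have finHi: "finite (H i)" using H[OF i(1)] less.prems(1) finite_subset by blast
    have Hi': "conn (insert e (H i)) l r v" "(v, ?x0) \<in> (adj (insert e (H i)) l r)\<^sup>*"
    proof -
      have "conn (H i \<union> {e}) l r v"
      proof (rule conn_Un[OF Hi(2,1)])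
        have "(x, ?x0) \<in> adj {e} l r" using e(2) by (intro adj_edge[of e]) (auto simp: joins_sym)
        then show "conn {e} l r x" using e(2) by (auto simp: conn_def joins_def)
      qed
      then show c: "conn (insert e (H i)) l r v" by simp
      from conn_ends[OF c _ e(2)] show "(v, ?x0) \<in> (adj (insert e (H i)) l r)\<^sup>*" by simp
    qed
    have par: "odd (deg (insert e (H i)) l r w) \<longleftrightarrow> (w = ?x0) \<noteq> (w = v)" for w
    proof -
      have "deg (insert e (H i)) l r w = of_bool (l e = w) + of_bool (r e = w) + deg (H i) l r w"
        using deg_remove[of "insert e (H i)" e l r w] finHi eH[OF i(1)] by simp
      also have "of_bool (l e = w) + of_bool (r e = w) = (of_bool (w = ?x0) + of_bool (w = x) :: int)"
        using e(2,3) by (auto simp: joins_def)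
      finally show ?thesis using Hi(3)[of w] e(3) by (auto)
    qed
    have "H' j \<subseteq> E \<and> (v, y j) \<in> (adj (H' j) l r)\<^sup>* \<and> conn (H' j) l r v \<and>
        (\<forall>w. odd (deg (H' j) l r w) \<longleftrightarrow> (w = y j) \<noteq> (w = v))" if j: "j \<in> J" for j
    proof (cases "j = i")
      case True
      then show ?thesis using Hi' par H[OF i(1)] e(1) by (auto simp: H'_def)
    next
      case False
      then have "y' j = y j" "H' j = H j" by (simp_all add: y'_def H'_def)
      then show ?thesis using H[OF j] by auto
    qed
    moreover have "disjoint_family_on H' J"
      using Hd eH by (simp add: H'_def disjoint_family_on_def)
    ultimately show ?thesis by blast
  qed
qed

section \<open>Splitting off two edges\<close>

lemma deg_cong: "(\<And>e. e \<in> A \<Longrightarrow> l e = l' e \<and> r e = r' e) \<Longrightarrow> deg A l r w = deg A l' r' w"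
  unfolding deg_def by (rule sum.cong) auto

lemma adj_cong: "(\<And>e. e \<in> A \<Longrightarrow> l e = l' e \<and> r e = r' e) \<Longrightarrow> adj A l r = adj A l' r'"
  unfolding adj_def joins_def by (auto; metis)

lemma conn_cong:
  assumes "\<And>e. e \<in> A \<Longrightarrow> l e = l' e \<and> r e = r' e"
  shows "conn A l r v = conn A l' r' v"
proof -
  have "adj A l r = adj A l' r'" by (rule adj_cong) (use assms in auto)
  then show ?thesis using assms by (auto simp: conn_def)
qed

lemma odd_part_cong:
  assumes "\<And>e. e \<in> A \<Longrightarrow> l e = l' e \<and> r e = r' e \<and> \<sigma> e = \<sigma>' e"
  shows "odd_part A l r \<sigma> v = odd_part A l' r' \<sigma>' v"
proof -
  have "deg A l r w = deg A l' r' w" for w by (rule deg_cong) (use assms in auto)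
  moreover have "conn A l r v = conn A l' r' v" by (rule conn_cong) (use assms in auto)
  moreover have "prod \<sigma> A = prod \<sigma>' A" by (rule prod.cong) (use assms in auto)
  ultimately show ?thesis by (simp add: odd_part_def)
qed

text \<open>The edge \<open>e\<close> of the split graph stands for the path \<open>x\<close>,
  \<open>u\<close>, \<open>y\<close>. Putting this path back changes only the degree of
  \<open>u\<close>, by 2, and the path has the same sign as the edge.\<close>

lemma odd_part_split:
  assumes fin: "finite A" and e: "e \<in> A" "f \<notin> A" "joins l r e x u" "joins l r f u y"
    and op: "odd_part A (l(e := x)) (r(e := y)) (\<sigma>(e := \<sigma> e * \<sigma> f)) v"
  shows "odd_part (insert f A) l r \<sigma> v"
proof -
  let ?l = "l(e := x)" and ?r = "r(e := y)" and ?B = "insert f A"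
  have "deg ?B l r w = deg A ?l ?r w + 2 * of_bool (w = u)" for w
  proof -
    have "deg ?B l r w = of_bool (l f = w) + of_bool (r f = w) + deg A l r w"
      using deg_remove[of ?B f l r w] fin e(2) by simp
    also have "deg A l r w = of_bool (l e = w) + of_bool (r e = w) + deg (A - {e}) l r w"
      by (rule deg_remove[OF fin e(1)])
    also have "deg (A - {e}) l r w = deg (A - {e}) ?l ?r w"
      by (rule deg_cong) auto
    finally show ?thesis using deg_remove[OF fin e(1), of ?l ?r w] e(3,4)
      by (auto simp: joins_def)
  qed
  then have ev: "even (deg ?B l r w)" for w using op by (simp add: odd_part_def)
  have xu: "(x, u) \<in> adj ?B l r" and uy: "(u, y) \<in> adj ?B l r"
    using e adj_edge[of e ?B l r x u] adj_edge[of f ?B l r u y] by auto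
  have sub: "adj A ?l ?r \<subseteq> (adj ?B l r)\<^sup>*"
  proof (clarify)
    fix a b assume "(a, b) \<in> adj A ?l ?r"
    then obtain g where g: "g \<in> A" "joins ?l ?r g a b" by (auto simp: adj_def)
    show "(a, b) \<in> (adj ?B l r)\<^sup>*"
    proof (cases "g = e")
      case True
      then have "a = x \<and> b = y \<or> a = y \<and> b = x" using g(2) by (auto simp: joins_def)
      moreover have "(x, y) \<in> (adj ?B l r)\<^sup>*" using xu uy by (meson r_into_rtrancl rtrancl.rtrancl_into_rtrancl)
      ultimately show ?thesis by (auto dest: adj_rtrancl_sym)
    next
      case False
      then have "joins l r g a b" using g(2) by (auto simp: joins_def)
      then show ?thesis using adj_edge[of g ?B l r a b] g(1) by auto
    qed
  qed
  have reach: "(v, w) \<in> (adj A ?l ?r)\<^sup>* \<Longrightarrow> (v, w) \<in> (adj ?B l r)\<^sup>*" for w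
    using rtrancl_subset_rtrancl[OF sub] by blast
  have cn: "conn A ?l ?r v" using op by (simp add: odd_part_def)
  have "(v, ?l e) \<in> (adj A ?l ?r)\<^sup>*" using cn e(1) unfolding conn_def by blast
  then have vx: "(v, x) \<in> (adj ?B l r)\<^sup>*" using reach by simp
  then have vu: "(v, u) \<in> (adj ?B l r)\<^sup>*" using xu by simp
  then have vy: "(v, y) \<in> (adj ?B l r)\<^sup>*" using uy by simp
  have "conn ?B l r v" unfolding conn_def
  proof
    fix g assume g: "g \<in> ?B"
    consider "g = e" | "g = f" | "g \<noteq> e" "g \<noteq> f" by auto
    then show "(v, l g) \<in> (adj ?B l r)\<^sup>*"
    proof cases
      case 3
      then have "(v, ?l g) \<in> (adj A ?l ?r)\<^sup>*" using cn g unfolding conn_def by blast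
      with 3 reach show ?thesis by simp
    qed (use e(3,4) vx vu vy in \<open>auto simp: joins_def\<close>)
  qed
  moreover have "prod \<sigma> ?B = prod (\<sigma>(e := \<sigma> e * \<sigma> f)) A"
  proof -
    have "prod \<sigma> (A - {e}) = prod (\<sigma>(e := \<sigma> e * \<sigma> f)) (A - {e})" by (rule prod.cong) auto
    then show ?thesis using fin e(1,2) by (simp add: prod.remove[OF fin e(1)] mult.assoc mult.left_commute)
  qed
  ultimately show ?thesis using ev op by (simp add: odd_part_def)
qed

lemma rooted3_split:
  assumes "finite E" "e \<in> E" "f \<in> E" "e \<noteq> f" "joins l r e x u" "joins l r f u y"
    and "rooted3 (E - {f}) (l(e := x)) (r(e := y)) (\<sigma>(e := \<sigma> e * \<sigma> f)) v"
  shows "rooted3 E l r \<sigma> v"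
proof -
  let ?l = "l(e := x)" and ?r = "r(e := y)" and ?\<sigma> = "\<sigma>(e := \<sigma> e * \<sigma> f)"
  obtain F where F: "(\<Union>i<(3::nat). F i) = E - {f}" "disjoint_family_on F {..<3}"
    "\<And>i. i < 3 \<Longrightarrow> odd_part (F i) ?l ?r ?\<sigma> v"
    using assms(7) by (auto simp: rooted3_def)
  have "e \<in> (\<Union>i<(3::nat). F i)" using F(1) assms(2,4) by simp
  then obtain i where i: "i < 3" "e \<in> F i" by auto
  have sub: "F j \<subseteq> E - {f}" if "j < 3" for j using F(1) that by blast
  have fin: "finite (F j)" if "j < 3" for j using sub[OF that] assms(1) by (auto intro: finite_subset)
  have nf: "f \<notin> F j" if "j < 3" for j using sub[OF that] by auto
  have ne: "e \<notin> F j" if "j < 3" "j \<noteq> i" for j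
    using F(2) i that by (auto simp: disjoint_family_on_def)
  let ?F = "F(i := insert f (F i))"
  have "odd_part (?F j) l r \<sigma> v" if j: "j < 3" for j
  proof (cases "j = i")
    case True
    then show ?thesis using odd_part_split[OF fin[OF j] _ nf[OF j] assms(5,6)] F(3)[OF j] i by simp
  next
    case False
    have "odd_part (F j) ?l ?r ?\<sigma> v = odd_part (F j) l r \<sigma> v"
      by (rule odd_part_cong) (use ne[OF j False] in auto)
    with False F(3)[OF j] show ?thesis by simp
  qed
  moreover have "(\<Union>j<(3::nat). ?F j) = E"
  proof
    show "(\<Union>j<(3::nat). ?F j) \<subseteq> E"
    proof
      fix g assume "g \<in> (\<Union>j<(3::nat). ?F j)"
      then obtain j where "j < 3" "g \<in> ?F j" by blast
      then show "g \<in> E" using sub[of j] sub[OF i(1)] assms(3) by (auto split: if_splits)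
    qed
    show "E \<subseteq> (\<Union>j<(3::nat). ?F j)"
    proof
      fix g assume "g \<in> E"
      show "g \<in> (\<Union>j<(3::nat). ?F j)"
      proof (cases "g = f")
        case True
        then show ?thesis using i(1) by (auto intro: bexI[of _ i])
      next
        case False
        with \<open>g \<in> E\<close> F(1) have "g \<in> (\<Union>i<(3::nat). F i)" by simp
        then show ?thesis by auto
      qed
    qed
  qed
  moreover have "disjoint_family_on ?F {..<3}"
    using F(2) nf i(1) unfolding disjoint_family_on_def by simp
  ultimately show ?thesis unfolding rooted3_def by (intro exI[of _ ?F]) simp
qed

text \<open>A positive loop is by itself an even edge set of product 1, which is what
  \<open>attach\<close> distributes.\<close>

lemma rooted3_even_loop:
  assumes "finite E" "f \<in> E" "l f = r f" "\<sigma> f = 1" "conn E l r v" "rooted3 (E - {f}) l r \<sigma> v"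
  shows "rooted3 E l r \<sigma> v"
proof -
  obtain F where F: "(\<Union>i<(3::nat). F i) = E - {f}" "disjoint_family_on F {..<3}"
    "\<And>i. i < 3 \<Longrightarrow> odd_part (F i) l r \<sigma> v"
    using assms(6) by (auto simp: rooted3_def)
  show ?thesis
  proof (rule attach[OF assms(1,5), of "{f}" \<sigma> F])
    show "even (deg {f} l r w)" for w using assms(3) by (auto simp: deg_def)
    show "prod \<sigma> C = 1" if "C \<subseteq> {f}" for C using that assms(4) by (auto simp: subset_singleton_iff)
  qed (use F assms(2) in auto)
qed

text \<open>\<open>\<sigma> e * s x\<close> and \<open>\<sigma> f * s y\<close> are the values at
  the far ends as seen from \<open>u\<close>. The identity says that the cost falls by twice the
  distance of \<open>s u\<close> from the interval between them, which for ternary \<open>s\<close>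
  is 0, 2 or 4.\<close>

lemma cost_split:
  assumes fin: "finite E" and e: "e \<in> E" "f \<in> E" "e \<noteq> f" "joins l r e x u" "joins l r f u y"
    and "\<sigma> e = 1 \<or> \<sigma> e = - 1" "\<sigma> f = 1 \<or> \<sigma> f = - 1"
  shows "cost E l r \<sigma> s + \<bar>\<sigma> e * s x - \<sigma> f * s y\<bar> =
    cost (E - {f}) (l(e := x)) (r(e := y)) (\<sigma>(e := \<sigma> e * \<sigma> f)) s + \<bar>\<sigma> e * s x - s u\<bar> + \<bar>\<sigma> f * s y - s u\<bar>"
    (is "_ = cost _ ?l ?r ?\<sigma> s + _ + _")
proof -
  have "cost E l r \<sigma> s = ecost l r \<sigma> s f + (ecost l r \<sigma> s e + (\<Sum>g\<in>E - {f} - {e}. ecost l r \<sigma> s g))"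
    unfolding cost_def using fin e by (simp add: sum.remove[of _ f] sum.remove[of _ e])
  moreover have "cost (E - {f}) ?l ?r ?\<sigma> s = ecost ?l ?r ?\<sigma> s e + (\<Sum>g\<in>E - {f} - {e}. ecost ?l ?r ?\<sigma> s g)"
    unfolding cost_def using fin e by (simp add: sum.remove[of _ e])
  moreover have "(\<Sum>g\<in>E - {f} - {e}. ecost ?l ?r ?\<sigma> s g) = (\<Sum>g\<in>E - {f} - {e}. ecost l r \<sigma> s g)"
    by (rule sum.cong) (auto simp: ecost_def)
  moreover have "ecost ?l ?r ?\<sigma> s e = \<bar>\<sigma> e * s x - \<sigma> f * s y\<bar>"
    using assms(7,8) by (auto simp: ecost_def)
  moreover have "ecost l r \<sigma> s e = \<bar>\<sigma> e * s x - s u\<bar>" by (rule ecost_joins) (use e(4) assms(7) in auto)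
  moreover have "ecost l r \<sigma> s f = \<bar>\<sigma> f * s y - s u\<bar>" by (rule ecost_joins) (use joins_sym[OF e(5)] assms(8) in auto)
  ultimately show ?thesis by simp
qed

lemma dcut_split:
  assumes fin: "finite E" and e: "e \<in> E" "f \<in> E" "e \<noteq> f" "joins l r e x u" "joins l r f u y"
  shows "dcut E l r K + of_bool ((x \<in> K) \<noteq> (y \<in> K)) =
    dcut (E - {f}) (l(e := x)) (r(e := y)) K + of_bool ((x \<in> K) \<noteq> (u \<in> K)) + of_bool ((y \<in> K) \<noteq> (u \<in> K))"
  using cost_split[OF assms, of "\<lambda>_. 1" "\<lambda>w. of_bool (w \<in> K)"] unfolding dcut_cost
  by (simp add: fun_upd_def of_bool_def split: if_splits)

lemma deg_split:
  assumes fin: "finite E" and e: "e \<in> E" "f \<in> E" "e \<noteq> f" "joins l r e x u" "joins l r f u y"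
  shows "deg E l r w = deg (E - {f}) (l(e := x)) (r(e := y)) w + 2 * of_bool (w = u)"
proof -
  let ?l = "l(e := x)" and ?r = "r(e := y)"
  have "deg E l r w = of_bool (l f = w) + of_bool (r f = w) + deg (E - {f}) l r w"
    by (rule deg_remove[OF fin e(2)])
  also have "deg (E - {f}) l r w = of_bool (l e = w) + of_bool (r e = w) + deg (E - {f} - {e}) l r w"
    by (rule deg_remove) (use fin e in auto)
  also have "deg (E - {f} - {e}) l r w = deg (E - {f} - {e}) ?l ?r w" by (rule deg_cong) auto
  finally show ?thesis using deg_remove[of "E - {f}" e ?l ?r w] fin e
    by (auto simp: joins_def)
qed

locale signed_graph =
  fixes V :: "'v set" and E :: "'e set" and l r :: "'e \<Rightarrow> 'v" and \<sigma> :: "'e \<Rightarrow> int" and v :: 'v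
  assumes finV: "finite V" and finE: "finite E" and vV: "v \<in> V"
    and ends: "e \<in> E \<Longrightarrow> l e \<in> V \<and> r e \<in> V"
    and sgn: "e \<in> E \<Longrightarrow> \<sigma> e = 1 \<or> \<sigma> e = - 1"
    and deg_v: "deg E l r v = 6"
    and deg_even: "even (deg E l r w)"
    and odd_total: "prod \<sigma> E = - 1"
begin

lemma signed_graph_split:
  assumes e: "e \<in> E" "f \<in> E" "e \<noteq> f" "joins l r e x u" "joins l r f u y" and "u \<noteq> v"
  shows "signed_graph V (E - {f}) (l(e := x)) (r(e := y)) (\<sigma>(e := \<sigma> e * \<sigma> f)) v"
proof
  have xy: "x \<in> V" "y \<in> V" using e ends[OF e(1)] ends[OF e(2)] by (auto simp: joins_def)
  show "(l(e := x)) g \<in> V \<and> (r(e := y)) g \<in> V" if "g \<in> E - {f}" for g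
    using that xy ends by auto
  show "(\<sigma>(e := \<sigma> e * \<sigma> f)) g = 1 \<or> (\<sigma>(e := \<sigma> e * \<sigma> f)) g = - 1" if "g \<in> E - {f}" for g
    using that sgn[of g] sgn[OF e(1)] sgn[OF e(2)] by auto
  note d = deg_split[OF finE e]
  show "deg (E - {f}) (l(e := x)) (r(e := y)) v = 6" using d[of v] deg_v assms(6) by simp
  show "even (deg (E - {f}) (l(e := x)) (r(e := y)) w)" for w
    using d[of w] deg_even[of w] by simp
  let ?P = "prod \<sigma> (E - {f} - {e})" and ?\<sigma> = "\<sigma>(e := \<sigma> e * \<sigma> f)"
  have "prod ?\<sigma> (E - {f}) = ?\<sigma> e * prod ?\<sigma> (E - {f} - {e})"
    by (rule prod.remove) (use finE e in auto)
  also have "prod ?\<sigma> (E - {f} - {e}) = ?P"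
    by (rule prod.cong) auto
  also have "?\<sigma> e * ?P = \<sigma> f * (\<sigma> e * ?P)"
    by simp
  also have "\<sigma> e * ?P = prod \<sigma> (E - {f})"
    by (rule prod.remove[symmetric]) (use finE e in auto)
  also have "\<sigma> f * prod \<sigma> (E - {f}) = prod \<sigma> E"
    by (rule prod.remove[symmetric]) (use finE e in auto)
  finally show "prod ?\<sigma> (E - {f}) = - 1" using odd_total by simp
qed (use finV finE vV in auto)

end

text \<open>Restricting to sets that miss \<open>v\<close> and to maps with value 1 at
  \<open>v\<close> only normalises: complementary sets have the same cut, and \<open>s\<close> and
  its negative have the same cost.\<close>

locale rooted_graph = signed_graph V E l r \<sigma> v
  for V :: "'v set" and E :: "'e set" and l r :: "'e \<Rightarrow> 'v" and \<sigma> :: "'e \<Rightarrow> int" and v :: 'v +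
  assumes cut_ge4: "K \<subseteq> V - {v} \<Longrightarrow> K \<noteq> {} \<Longrightarrow> 4 \<le> dcut E l r K"
    and cost_ge6: "tern s \<Longrightarrow> s v = 1 \<Longrightarrow> 6 \<le> cost E l r \<sigma> s"
begin

lemma reach_V: "w \<in> V \<Longrightarrow> (v, w) \<in> (adj E l r)\<^sup>*"
proof (rule ccontr)
  assume w: "w \<in> V" "(v, w) \<notin> (adj E l r)\<^sup>*"
  define K where "K = {w \<in> V. (v, w) \<notin> (adj E l r)\<^sup>*}"
  have "dcut E l r K = 0" unfolding dcut_def
  proof (rule sum.neutral, rule ballI)
    fix e assume e: "e \<in> E"
    then have "(l e, r e) \<in> adj E l r" "(r e, l e) \<in> adj E l r"
      by (auto simp: adj_def joins_def)
    then have "(v, l e) \<in> (adj E l r)\<^sup>* \<longleftrightarrow> (v, r e) \<in> (adj E l r)\<^sup>*"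
      by (meson rtrancl.rtrancl_into_rtrancl)
    then show "crosses l r K e = 0" using ends[OF e] by (simp add: crosses_def K_def)
  qed
  moreover have "K \<subseteq> V - {v}" "K \<noteq> {}" using w by (auto simp: K_def)
  ultimately show False using cut_ge4[of K] by simp
qed

lemma conn_E: "conn E l r v"
  using reach_V ends by (auto simp: conn_def)

lemma cost_ev: "even (cost E l r \<sigma> s)"
  by (rule cost_even[OF finE deg_even sgn])

lemma dcut_ev: "even (dcut E l r K)"
  by (rule dcut_even[OF finE deg_even])

end

section \<open>Contraction of tight sets\<close>

text \<open>It turns a degree sum of 2 into two edge ends, possibly at the same vertex.\<close>

lemma sum_eq_two:
  fixes h :: "'v \<Rightarrow> int"
  assumes "finite X" "\<And>w. 0 \<le> h w" "(\<Sum>w\<in>X. h w) = 2"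
  shows "\<exists>y\<in>X. \<exists>z\<in>X. \<forall>w\<in>X. h w = of_bool (w = y) + of_bool (w = z)"
proof -
  have *: "\<exists>y\<in>X. 0 < k y" if "0 < (\<Sum>w\<in>X. k w)" for k :: "'v \<Rightarrow> int"
    using that by (meson linorder_not_less sum_nonpos)
  obtain y where y: "y \<in> X" "0 < h y" using *[of h] assms(3) by auto
  define h1 where "h1 w = h w - of_bool (w = y)" for w
  have h1: "0 \<le> h1 w" for w using y assms(2)[of w] by (auto simp: h1_def)
  have s1: "(\<Sum>w\<in>X. h1 w) = 1"
    using assms(1,3) y(1) by (simp add: h1_def sum_subtractf of_bool_def)
  obtain z where z: "z \<in> X" "0 < h1 z" using *[of h1] s1 by auto
  define h2 where "h2 w = h1 w - of_bool (w = z)" for w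
  have h2: "0 \<le> h2 w" for w using z h1[of w] by (auto simp: h2_def)
  have "(\<Sum>w\<in>X. h2 w) = 0"
    using assms(1) s1 z(1) by (simp add: h2_def sum_subtractf of_bool_def)
  then have "\<forall>w\<in>X. h2 w = 0" using assms(1) h2 by (simp add: sum_nonneg_eq_0_iff)
  then have "h w = of_bool (w = y) + of_bool (w = z)" if "w \<in> X" for w
    using that unfolding h2_def h1_def by (metis diff_eq_eq add.commute add_0)
  with y(1) z(1) show ?thesis by blast
qed

text \<open>The product -1 makes the part nonempty, its first edge on the way from \<open>v\<close>
  meets \<open>v\<close>, and the degree is even. Since \<open>v\<close> has degree 6, each of three
  disjoint parts then uses exactly two ends there.\<close>

lemma odd_part_deg_pos:
  assumes "finite A" "odd_part A l r \<sigma> v"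
  shows "2 \<le> deg A l r v"
proof -
  have "A \<noteq> {}" using assms(2) by (auto simp: odd_part_def)
  then obtain e where e: "e \<in> A" by auto
  have "(v, l e) \<in> (adj A l r)\<^sup>*" using assms(2) e by (auto simp: odd_part_def conn_def)
  then have "0 < deg A l r v"
  proof (cases rule: converse_rtranclE)
    case base
    then show ?thesis using deg_pos[OF assms(1) e, of l r v "r e"] by (auto simp: joins_def)
  next
    case (step y)
    then obtain g where "g \<in> A" "joins l r g v y" by (auto simp: adj_def)
    then show ?thesis by (rule deg_pos[OF assms(1)])
  qed
  moreover have "even (deg A l r v)" using assms(2) by (simp add: odd_part_def)
  ultimately show ?thesis by presburger
qed

context rooted_graph
begin

text \<open>The edges \<open>Eg\<close> of cost 0 inside the support \<open>X\<close> of a tight \<open>s\<close> are balanced, so after contraction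
  of \<open>X\<close> to \<open>v\<close> it remains to link the other edge ends at \<open>X\<close> to \<open>v\<close> through \<open>Eg\<close>, whatever the pairing.\<close>

lemma contract_tight:
  assumes s: "tern s" "s v = 1" "cost E l r \<sigma> s = 6"
    and X_def: "X = {w \<in> V. s w \<noteq> 0}"
    and IH: "\<And>E' l' r' \<sigma>'. E' \<subseteq> E \<Longrightarrow> rooted_graph (insert v (V - X)) E' l' r' \<sigma>' v \<Longrightarrow> rooted3 E' l' r' \<sigma>' v"
  shows "rooted3 E l r \<sigma> v"
proof -
  \<comment> \<open>Switching by \<open>s\<close> on \<open>X\<close> makes all edges of
    \<open>Eg\<close> positive, so that \<open>X\<close> can be collapsed without losing
    signs.\<close>
  define \<eta> where "\<eta> w = (if w \<in> X then s w else 1)" for w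
  define c where "c w = (if w \<in> X then v else w)" for w
  define Eg where "Eg = {e \<in> E. l e \<in> X \<and> r e \<in> X \<and> s (l e) = \<sigma> e * s (r e)}"
  define Eo where "Eo = E - Eg"
  define l' where "l' e = c (l e)" for e
  define r' where "r' e = c (r e)" for e
  define \<sigma>' where "\<sigma>' e = \<sigma> e * (\<eta> (l e) * \<eta> (r e))" for e
  have vX: "v \<in> X" using s vV by (simp add: X_def)
  have XV: "X \<subseteq> V" by (auto simp: X_def)
  have finX: "finite X" using XV finV finite_subset by blast
  have triE: "s w = - 1 \<or> s w = 0 \<or> s w = 1" for w using s(1) by (simp add: tern_def)
  have sX: "s w = 1 \<or> s w = - 1" if "w \<in> X" for w using that triE[of w] by (auto simp: X_def)
  have s0: "s w = 0" if "w \<in> V" "w \<notin> X" for w using that by (auto simp: X_def)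
  have \<eta>1: "\<eta> w = 1 \<or> \<eta> w = - 1" for w using sX by (auto simp: \<eta>_def)
  have EgE: "Eg \<subseteq> E" and EoE: "Eo \<subseteq> E" by (auto simp: Eg_def Eo_def)
  have finEg: "finite Eg" and finEo: "finite Eo" using EgE EoE finE finite_subset by blast+
  have EgX: "l e \<in> X" "r e \<in> X" "s (l e) = \<sigma> e * s (r e)" "e \<in> E" if "e \<in> Eg" for e
    using that by (auto simp: Eg_def)
  have ecost_o: "ecost l r \<sigma> s e = of_bool (l e \<in> X) + of_bool (r e \<in> X)" if "e \<in> Eo" for e
  proof -
    have e: "e \<in> E" "\<not> (l e \<in> X \<and> r e \<in> X \<and> s (l e) = \<sigma> e * s (r e))"
      using that by (auto simp: Eo_def Eg_def)
    show ?thesis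
      using e(2) sgn[OF e(1)] ends[OF e(1)] sX[of "l e"] sX[of "r e"] s0[of "l e"] s0[of "r e"]
      by (cases "l e \<in> X"; cases "r e \<in> X") (auto simp: ecost_def)
  qed
  have ecost_g: "ecost l r \<sigma> s e = 0" if "e \<in> Eg" for e using EgX[OF that] by (simp add: ecost_def)
  have gsplit: "(\<Sum>e\<in>E. h e) = (\<Sum>e\<in>Eg. h e) + (\<Sum>e\<in>Eo. h e)" for h :: "'e \<Rightarrow> int"
    unfolding Eo_def using sum.subset_diff[OF EgE finE, of h] by simp
  \<comment> \<open>Edges outside \<open>Eg\<close> cost as many units as they have ends in
    \<open>X\<close>. So the cost 6 of \<open>s\<close> is the degree of the contracted
    vertex.\<close>
  have darts: "(\<Sum>e\<in>Eo. of_bool (l e \<in> X) + of_bool (r e \<in> X)) = (6::int)"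
    using s(3) gsplit[of "ecost l r \<sigma> s"] ecost_g ecost_o by (simp add: cost_def)
  have dgo: "deg Eo l' r' w = deg E l r w" if "w \<notin> X" for w
  proof -
    have "deg Eg l r w = 0" unfolding deg_def
      by (rule sum.neutral) (use EgX that in auto)
    moreover have "deg E l r w = deg Eg l r w + deg Eo l r w"
      unfolding deg_def by (rule gsplit)
    moreover have "deg Eo l' r' w = deg Eo l r w" unfolding deg_def
      by (rule sum.cong) (use that vX in \<open>auto simp: l'_def r'_def c_def\<close>)
    ultimately show ?thesis by simp
  qed
  have dgv': "deg A l' r' v = (\<Sum>e\<in>A. of_bool (l e \<in> X) + of_bool (r e \<in> X))" for A
    unfolding deg_def by (rule sum.cong) (use vX in \<open>auto simp: l'_def r'_def c_def\<close>)
  have dg0: "deg A l' r' w = 0" if "w \<in> X" "w \<noteq> v" for w A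
    unfolding deg_def by (rule sum.neutral) (use that in \<open>auto simp: l'_def r'_def c_def\<close>)
  have \<sigma>'g: "\<sigma>' e = 1" if "e \<in> Eg" for e
    using EgX[OF that] sX[of "l e"] sX[of "r e"] by (auto simp: \<sigma>'_def \<eta>_def)
  have sgn': "\<sigma>' e = 1 \<or> \<sigma>' e = - 1" if "e \<in> E" for e
    using sgn[OF that] \<eta>1[of "l e"] \<eta>1[of "r e"] by (auto simp: \<sigma>'_def)
  have prod': "prod \<sigma>' A = prod \<sigma> A" if "finite A" "\<And>w. even (deg A l r w)" for A
  proof -
    have "prod \<sigma>' A = prod \<sigma> A * (\<Prod>e\<in>A. \<eta> (l e) * \<eta> (r e))"
      by (simp add: \<sigma>'_def prod.distrib)
    also have "(\<Prod>e\<in>A. \<eta> (l e) * \<eta> (r e)) = 1"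
      by (rule prod_deg[OF that]) (rule \<eta>1)
    finally show ?thesis by simp
  qed
  have "rooted3 Eo l' r' \<sigma>' v"
  proof (rule IH[OF EoE], unfold_locales)
    show "finite (insert v (V - X))" using finV by simp
    show "finite Eo" by (rule finEo)
    show "v \<in> insert v (V - X)" by simp
    show "l' e \<in> insert v (V - X) \<and> r' e \<in> insert v (V - X)" if "e \<in> Eo" for e
      using that EoE ends by (auto simp: l'_def r'_def c_def)
    show "\<sigma>' e = 1 \<or> \<sigma>' e = - 1" if "e \<in> Eo" for e using that EoE sgn' by auto
    show "deg Eo l' r' v = 6" using darts dgv' by simp
    show "even (deg Eo l' r' w)" for w
      using dgo[of w] dg0[of w Eo] dgv'[of Eo] darts deg_even[of w] by (cases "w \<in> X"; cases "w = v") auto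
    have "prod \<sigma>' E = prod \<sigma>' Eo * prod \<sigma>' Eg"
      unfolding Eo_def by (rule prod.subset_diff[OF EgE finE])
    also have "prod \<sigma>' Eg = 1" using \<sigma>'g by (rule prod.neutral[OF ballI])
    finally show "prod \<sigma>' Eo = - 1" using prod'[OF finE deg_even] odd_total by simp
    show "4 \<le> dcut Eo l' r' K" if K: "K \<subseteq> insert v (V - X) - {v}" "K \<noteq> {}" for K
    proof -
      have KX: "w \<notin> K" if "w \<in> X" for w using that K(1) by auto
      have "dcut E l r K = dcut Eg l r K + dcut Eo l r K" unfolding dcut_def by (rule gsplit)
      also have "dcut Eg l r K = 0" unfolding dcut_def
        by (rule sum.neutral) (use EgX KX in \<open>auto simp: crosses_def\<close>)
      also have "dcut Eo l r K = dcut Eo l' r' K" unfolding dcut_def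
        by (rule sum.cong) (use KX vX in \<open>auto simp: crosses_def l'_def r'_def c_def\<close>)
      finally show ?thesis using cut_ge4[of K] K by auto
    qed
    show "6 \<le> cost Eo l' r' \<sigma>' t'" if t': "tern t'" "t' v = 1" for t'
    proof -
      \<comment> \<open>A map of the contracted graph is extended over \<open>X\<close> by
        \<open>s\<close>. The edges of \<open>Eg\<close> then cost nothing, and the other costs are
        unchanged.\<close>
      define t where "t w = (if w \<in> X then s w else t' w)" for w
      have t: "tern t" "t v = 1" using t' s vX by (auto simp: t_def tern_def)
      have t\<eta>: "t w = \<eta> w * t' (c w)" for w using t'(2) by (simp add: t_def \<eta>_def c_def)
      have "cost E l r \<sigma> t = cost Eg l r \<sigma> t + cost Eo l r \<sigma> t" unfolding cost_def by (rule gsplit)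
      also have "cost Eg l r \<sigma> t = 0" unfolding cost_def
        by (rule sum.neutral) (use EgX in \<open>auto simp: ecost_def t_def\<close>)
      also have "cost Eo l r \<sigma> t = cost Eo l' r' \<sigma>' t'" unfolding cost_def
      proof (rule sum.cong[OF refl])
        fix e assume "e \<in> Eo"
        show "ecost l r \<sigma> t e = ecost l' r' \<sigma>' t' e"
          unfolding ecost_def t\<eta> l'_def r'_def \<sigma>'_def
          using \<eta>1[of "l e"] \<eta>1[of "r e"] by (elim disjE) (simp_all add: abs_if)
      qed
      finally show ?thesis using cost_ge6[OF t] by simp
    qed
  qed
  then obtain F where F: "(\<Union>i<(3::nat). F i) = Eo" "disjoint_family_on F {..<3}"
    "\<And>i. i < 3 \<Longrightarrow> odd_part (F i) l' r' \<sigma>' v"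
    unfolding rooted3_def by blast
  have FEo: "F i \<subseteq> Eo" if "i < 3" for i using F(1) that by blast
  have finF: "finite (F i)" if "i < 3" for i using FEo[OF that] finEo finite_subset by blast
  have Fsum: "(\<Sum>e\<in>Eo. h e) = (\<Sum>i<3. \<Sum>e\<in>F i. h e)" for h :: "'e \<Rightarrow> int"
    unfolding F(1)[symmetric]
    by (rule sum.UNION_disjoint_family) (use F(2) finF in auto)
  have ge2: "2 \<le> deg (F i) l' r' v" if "i < 3" for i
    by (rule odd_part_deg_pos[OF finF[OF that] F(3)[OF that]])
  have "(\<Sum>i<3. deg (F i) l' r' v) = 6"
    using darts Fsum[of "\<lambda>e. of_bool (l e \<in> X) + of_bool (r e \<in> X)"] by (simp add: dgv')
  \<comment> \<open>Three parts share six ends and each needs at least two of them.\<close>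
  then have eq2: "deg (F i) l' r' v = 2" if "i < 3" for i
    using ge2[of 0] ge2[of "Suc 0"] ge2[of "Suc (Suc 0)"] that by (auto simp: numeral_3_eq_3 less_Suc_eq)
  have Fends: "\<exists>y\<in>X. \<exists>z\<in>X. \<forall>w\<in>X. deg (F i) l r w = of_bool (w = y) + of_bool (w = z)" if "i < 3" for i
  proof (rule sum_eq_two[OF finX deg_nonneg])
    have "(\<Sum>w\<in>V. deg (F i) l r w * of_bool (w \<in> X)) = (\<Sum>e\<in>F i. of_bool (l e \<in> X) + of_bool (r e \<in> X))"
      by (rule sum_deg[OF finF[OF that] finV]) (use FEo[OF that] EoE ends in auto)
    also have "(\<Sum>w\<in>V. deg (F i) l r w * of_bool (w \<in> X)) = (\<Sum>w\<in>X. deg (F i) l r w)"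
      using XV finV by (intro sum.mono_neutral_cong_right) auto
    finally show "(\<Sum>w\<in>X. deg (F i) l r w) = 2" using eq2[OF that] by (simp add: dgv')
  qed
  then have "\<forall>i\<in>{..<3}. \<exists>y\<in>X. \<exists>z\<in>X. \<forall>w\<in>X. deg (F i) l r w = of_bool (w = y) + of_bool (w = z)" by simp
  then obtain y where "\<forall>i\<in>{..<3}. y i \<in> X \<and> (\<exists>z\<in>X. \<forall>w\<in>X. deg (F i) l r w = of_bool (w = y i) + of_bool (w = z))"
    by (metis (no_types, lifting))
  then obtain z where yz0: "\<forall>i\<in>{..<3}. y i \<in> X \<and> z i \<in> X \<and> (\<forall>w\<in>X. deg (F i) l r w = of_bool (w = y i) + of_bool (w = z i))"
    by (metis (no_types, lifting))
  have yz: "y i \<in> X" "z i \<in> X" "\<And>w. w \<in> X \<Longrightarrow> deg (F i) l r w = of_bool (w = y i) + of_bool (w = z i)" if "i < 3" for i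
    using yz0 that by auto
  \<comment> \<open>Six tokens, two for each part, placed where the edges of the part enter
    \<open>X\<close> once \<open>X\<close> is expanded again.\<close>
  define J where "J = {..<3::nat} \<times> (UNIV :: bool set)"
  define tk where "tk j = (if snd j then y (fst j) else z (fst j))" for j
  have finJ: "finite J" by (simp add: J_def)
  have tkX: "tk j \<in> X" if "j \<in> J" for j using that yz by (auto simp: J_def tk_def)
  have cardJ: "int (card {j \<in> J. tk j \<in> B}) = (\<Sum>i<3. of_bool (y i \<in> B) + of_bool (z i \<in> B))" for B
  proof -
    have "int (card {j \<in> J. tk j \<in> B}) = (\<Sum>j\<in>J. of_bool (tk j \<in> B))"
      using finJ by (simp add: of_bool_def sum.If_cases Int_def)
    also have "\<dots> = (\<Sum>i<3. \<Sum>b\<in>UNIV. of_bool (tk (i, b) \<in> B))"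
      unfolding J_def sum.cartesian_product by (rule sum.cong) auto
    also have "\<dots> = (\<Sum>i<3. of_bool (y i \<in> B) + of_bool (z i \<in> B))"
      by (simp add: UNIV_bool tk_def add.commute del: sum_of_bool_eq)
    finally show ?thesis .
  qed
  have tok: "(\<Sum>i<3. of_bool (y i \<in> B) + of_bool (z i \<in> B)) = (\<Sum>e\<in>Eo. of_bool (l e \<in> B) + of_bool (r e \<in> B) :: int)"
    if B: "B \<subseteq> X" for B
    unfolding Fsum
  proof (rule sum.cong[OF refl])
    fix i assume "i \<in> {..<3::nat}"
    then have i: "i < 3" by simp
    have "(\<Sum>e\<in>F i. of_bool (l e \<in> B) + of_bool (r e \<in> B)) = (\<Sum>w\<in>V. deg (F i) l r w * of_bool (w \<in> B))"
      by (rule sum_deg[OF finF[OF i] finV, symmetric]) (use FEo[OF i] EoE ends in auto)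
    also have "\<dots> = (\<Sum>w\<in>X. (of_bool (w = y i) + of_bool (w = z i)) * of_bool (w \<in> B))"
      using XV finV B yz[OF i] by (intro sum.mono_neutral_cong_right) auto
    also have "\<dots> = (\<Sum>w\<in>X. if w = y i then of_bool (y i \<in> B) else 0) + (\<Sum>w\<in>X. if w = z i then of_bool (z i \<in> B) else 0)"
      unfolding sum.distrib[symmetric] by (rule sum.cong) auto
    also have "\<dots> = of_bool (y i \<in> B) + of_bool (z i \<in> B)"
      using finX yz[OF i] by simp
    finally show "of_bool (y i \<in> B) + of_bool (z i \<in> B) = (\<Sum>e\<in>F i. of_bool (l e \<in> B) + of_bool (r e \<in> B) :: int)" by simp
  qed
  have "\<exists>H. (\<forall>j\<in>J. H j \<subseteq> Eg \<and> (v, tk j) \<in> (adj (H j) l r)\<^sup>* \<and> conn (H j) l r v \<and>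
            (\<forall>w. odd (deg (H j) l r w) \<longleftrightarrow> (w = tk j) \<noteq> (w = v))) \<and> disjoint_family_on H J"
  proof (rule token_paths[OF finJ finX finEg _ vX tkX])
    show "l e \<in> X \<and> r e \<in> X" if "e \<in> Eg" for e using EgX[OF that] by simp
    show "even (deg Eg l r w + int (card {j \<in> J. tk j = w}))" if w: "w \<in> X - {v}" for w
    proof -
      have "int (card {j \<in> J. tk j = w}) = deg Eo l r w"
        using cardJ[of "{w}"] tok[of "{w}"] w by (simp add: deg_def)
      moreover have "deg E l r w = deg Eg l r w + deg Eo l r w"
        unfolding deg_def by (rule gsplit)
      ultimately show ?thesis using deg_even[of w] by simp
    qed
    show "int (card {j \<in> J. tk j \<in> B}) \<le> dcut Eg l r B" if B: "B \<subseteq> X - {v}" for B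
    proof -
      \<comment> \<open>Setting \<open>s\<close> to 0 on \<open>B\<close> adds
        \<open>dcut Eg B\<close> to the cost and saves the ends of outer edges in \<open>B\<close>,
        which are the tokens in \<open>B\<close>. As the result still costs at least 6, the cut is
        at least as large as the number of tokens.\<close>
      define t where "t w = (if w \<in> B then 0 else s w)" for w
      have t: "tern t" "t v = 1" using B s by (auto simp: t_def tern_def)
      have "cost E l r \<sigma> t = cost Eg l r \<sigma> t + cost Eo l r \<sigma> t" unfolding cost_def by (rule gsplit)
      also have "cost Eg l r \<sigma> t = dcut Eg l r B" unfolding cost_def dcut_def
      proof (rule sum.cong[OF refl])
        fix e assume e: "e \<in> Eg"
        show "ecost l r \<sigma> t e = crosses l r B e"
          using EgX[OF e] sX[of "l e"] sX[of "r e"] sgn[of e] by (auto simp: ecost_def crosses_def t_def)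
      qed
      also have "cost Eo l r \<sigma> t = (\<Sum>e\<in>Eo. of_bool (l e \<in> X - B) + of_bool (r e \<in> X - B))" unfolding cost_def
      proof (rule sum.cong[OF refl])
        fix e assume "e \<in> Eo"
        then have e: "e \<in> E" "\<not> (l e \<in> X \<and> r e \<in> X \<and> s (l e) = \<sigma> e * s (r e))"
          by (auto simp: Eo_def Eg_def)
        show "ecost l r \<sigma> t e = of_bool (l e \<in> X - B) + of_bool (r e \<in> X - B)"
          using e(2) sgn[OF e(1)] ends[OF e(1)] sX[of "l e"] sX[of "r e"] s0[of "l e"] s0[of "r e"]
          by (cases "l e \<in> X"; cases "r e \<in> X"; cases "l e \<in> B"; cases "r e \<in> B") (auto simp: ecost_def t_def)
      qed
      also have "\<dots> = 6 - (\<Sum>e\<in>Eo. of_bool (l e \<in> B) + of_bool (r e \<in> B))"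
        unfolding darts[symmetric] sum_subtractf[symmetric] by (rule sum.cong) (use B in auto)
      finally have "(\<Sum>e\<in>Eo. of_bool (l e \<in> B) + of_bool (r e \<in> B)) \<le> dcut Eg l r B"
        using cost_ge6[OF t] by simp
      moreover have "B \<subseteq> X" using B by auto
      ultimately show ?thesis unfolding cardJ using tok by simp
    qed
  qed
  then obtain H where H0: "\<forall>j\<in>J. H j \<subseteq> Eg \<and> (v, tk j) \<in> (adj (H j) l r)\<^sup>* \<and> conn (H j) l r v \<and>
            (\<forall>w. odd (deg (H j) l r w) \<longleftrightarrow> (w = tk j) \<noteq> (w = v))"
    and Hd: "disjoint_family_on H J" by (elim exE conjE)
  have H: "H (i, b) \<subseteq> Eg" "(v, tk (i, b)) \<in> (adj (H (i, b)) l r)\<^sup>*" "conn (H (i, b)) l r v"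
    "\<And>w. odd (deg (H (i, b)) l r w) \<longleftrightarrow> (w = tk (i, b)) \<noteq> (w = v)" if "i < 3" for i b
    using bspec[OF H0, of "(i, b)"] that by (auto simp: J_def)
  have Hdis: "H (i, b) \<inter> H (j, b') = {}" if "i < 3" "j < 3" "i \<noteq> j \<or> b \<noteq> b'" for i j b b'
    using Hd that by (auto simp: disjoint_family_on_def J_def)
  have finH: "finite (H (i, b))" if "i < 3" for i b using H(1)[OF that] finEg finite_subset by blast
  \<comment> \<open>The two linking walks make all degrees of the part even again. The edges of
    \<open>Eg\<close> that no part uses go to \<open>attach\<close>.\<close>
  define D where "D i = F i \<union> (H (i, True) \<union> H (i, False))" for i
  define L where "L = Eg - (\<Union>i<(3::nat). D i)"
  have FH: "F i \<inter> H (j, b) = {}" if "i < 3" "j < 3" for i j b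
    using FEo[OF that(1)] H(1)[OF that(2), of b] by (auto simp: Eo_def)
  have finD: "finite (D i)" if "i < 3" for i using finF finH that by (simp add: D_def)
  have dgD: "deg (D i) l r w = deg (F i) l r w + (deg (H (i, True)) l r w + deg (H (i, False)) l r w)" if i: "i < 3" for i w
    unfolding D_def using finF[OF i] finH[OF i] FH[OF i i] Hdis[OF i i, of True False]
    by (subst deg_Un; (subst deg_Un)?; auto)
  have evD: "even (deg (D i) l r w)" if i: "i < 3" for i w
  proof (cases "w \<in> X")
    case True
    show ?thesis using dgD[OF i, of w] yz(3)[OF i True] H(4)[OF i, of True w] H(4)[OF i, of False w]
      by (auto simp: tk_def)
  next
    case False
    have "deg (F i) l' r' w = deg (F i) l r w" unfolding deg_def
      by (rule sum.cong) (use False vX in \<open>auto simp: l'_def r'_def c_def\<close>)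
    then have "even (deg (F i) l r w)" using F(3)[OF i] unfolding odd_part_def by metis
    moreover have "w \<noteq> v" "w \<noteq> y i" "w \<noteq> z i" using False vX yz[OF i] by auto
    ultimately show ?thesis using dgD[OF i, of w] H(4)[OF i, of True w] H(4)[OF i, of False w]
      by (auto simp: tk_def)
  qed
  have Ddisj: "disjoint_family_on D {..<3}"
    unfolding disjoint_family_on_def
  proof (intro ballI impI)
    fix i j :: nat assume ij: "i \<in> {..<3}" "j \<in> {..<3}" "i \<noteq> j"
    then have "F i \<inter> F j = {}" using F(2) by (auto simp: disjoint_family_on_def)
    with ij FH[of i j] FH[of j i] Hdis[of i j] show "D i \<inter> D j = {}"
      unfolding D_def by (auto simp: Int_Un_distrib Int_Un_distrib2 Int_commute)
  qed
  have DE: "D i \<subseteq> E" if "i < 3" for i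
    using FEo[OF that] H(1)[OF that] EgE EoE by (auto simp: D_def)
  have UE: "(\<Union>i<(3::nat). D i) \<union> L = E"
  proof
    show "(\<Union>i<(3::nat). D i) \<union> L \<subseteq> E" using DE EgE by (auto simp: L_def)
    have "Eo \<subseteq> (\<Union>i<(3::nat). D i)" unfolding F(1)[symmetric] by (auto simp: D_def)
    then show "E \<subseteq> (\<Union>i<(3::nat). D i) \<union> L" by (auto simp: L_def Eo_def)
  qed
  show ?thesis
  proof (rule attach[OF finE conn_E _ _ UE Ddisj])
    have L2: "L = E - (\<Union>i<(3::nat). D i)" using UE by (auto simp: L_def)
    have UDE: "(\<Union>i<(3::nat). D i) \<subseteq> E" using DE by auto
    have "deg (\<Union>i<(3::nat). D i) l r w = (\<Sum>i<3. deg (D i) l r w)" for w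
      unfolding deg_def by (rule sum.UNION_disjoint_family) (use Ddisj finD in auto)
    moreover have "even (\<Sum>i<3. deg (D i) l r w)" for w by (rule dvd_sum) (use evD in auto)
    ultimately show "even (deg L l r w)" for w
      unfolding L2 deg_diff[OF finE UDE] using deg_even[of w] by simp
    show "prod \<sigma> C = 1" if C: "C \<subseteq> L" "\<And>w. even (deg C l r w)" for C
    proof -
      have CE: "C \<subseteq> Eg" using C(1) by (auto simp: L_def)
      then have "finite C" using finEg finite_subset by blast
      then have "prod \<sigma> C = prod \<sigma>' C" using prod'[of C] C(2) by simp
      also have "\<dots> = 1" by (rule prod.neutral) (use CE \<sigma>'g in auto)
      finally show ?thesis .
    qed
    show "(\<Union>i<(3::nat). D i) \<inter> L = {}" by (auto simp: L_def)
    show "odd_part (D i) l r \<sigma> v" if i: "i < 3" for i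
      unfolding odd_part_def
    proof (intro conjI allI evD[OF i])
      let ?H = "H (i, True) \<union> H (i, False)"
      have HEg: "?H \<subseteq> Eg" using H(1)[OF i] by auto
      have "prod \<sigma> (D i) = prod \<sigma>' (D i)" using prod'[OF finD[OF i] evD[OF i]] by simp
      also have "\<dots> = prod \<sigma>' (F i) * prod \<sigma>' ?H"
        unfolding D_def by (rule prod.union_disjoint) (use finF[OF i] finH[OF i] FH[OF i i] in auto)
      also have "prod \<sigma>' ?H = 1" by (rule prod.neutral) (use HEg \<sigma>'g in auto)
      finally show "prod \<sigma> (D i) = - 1" using F(3)[OF i] by (simp add: odd_part_def)
      let ?R = "\<lambda>w. (v, w) \<in> (adj (D i) l r)\<^sup>*"
      have HR: "?R (tk (i, b))" for b
        using H(2)[OF i, of b] by (rule adj_rtrancl_mono) (cases b, auto simp: D_def)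
      have XR: "?R a" if "e \<in> F i" "joins l r e a b" "a \<in> X" for e a b
      proof -
        have "0 < deg (F i) l r a" by (rule deg_pos[OF finF[OF i] that(1,2)])
        then have "a = y i \<or> a = z i" using yz(3)[OF i that(3)] by (auto split: if_splits)
        then show ?thesis using HR[of True] HR[of False] by (auto simp: tk_def)
      qed
      have step: "?R b" if "?R a" "e \<in> F i" "joins l r e a b" for a b e
        using that adj_edge[of e "D i" l r a b] by (auto simp: D_def)
      \<comment> \<open>A walk in the contracted graph may enter \<open>X\<close> at one vertex and
        leave it at another. It is resumed at the vertex where it leaves: there \<open>F i\<close>
        has an edge end, so a linking walk of \<open>D i\<close> joins this vertex to
        \<open>v\<close>.\<close>
      have R: "q \<notin> X \<longrightarrow> ?R q" if "(v, q) \<in> (adj (F i) l' r')\<^sup>*" for q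
        using that
      proof (induction rule: rtrancl_induct)
        case base
        then show ?case by simp
      next
        case (step p q)
        from step.hyps(2) obtain e where e: "e \<in> F i" "joins l' r' e p q" by (auto simp: adj_def)
        show ?case
        proof
          assume q: "q \<notin> X"
          have "\<exists>a b. joins l r e a b \<and> p = c a \<and> q = c b"
            using e(2) by (auto simp: joins_def l'_def r'_def)
          then obtain a b where ab: "joins l r e a b" "p = c a" "q = c b" by blast
          then have bq: "b = q" using q vX by (auto simp: c_def split: if_splits)
          have "?R a"
          proof (cases "a \<in> X")
            case True
            show ?thesis by (rule XR[OF e(1) ab(1) True])
          next
            case False
            then show ?thesis using step.IH ab(2) by (simp add: c_def)
          qed
          then show "?R q" using \<open>?R a \<Longrightarrow> e \<in> F i \<Longrightarrow> joins l r e a b \<Longrightarrow> ?R b\<close> e(1) ab(1) bq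
            using adj_edge[of e "D i" l r a b] by (auto simp: D_def)
        qed
      qed
      show "conn (D i) l r v" unfolding conn_def
      proof
        fix e assume "e \<in> D i"
        then consider "e \<in> F i" | b where "e \<in> H (i, b)" by (auto simp: D_def)
        then show "?R (l e)"
        proof cases
          case 1
          show ?thesis
          proof (cases "l e \<in> X")
            case True
            show ?thesis by (rule XR[OF 1 joins_lr True])
          next
            case False
            have "(v, l' e) \<in> (adj (F i) l' r')\<^sup>*" using F(3)[OF i] 1 by (auto simp: odd_part_def conn_def)
            from R[OF this] False show ?thesis by (simp add: l'_def c_def)
          qed
        next
          case (2 b)
          have "(v, l e) \<in> (adj (H (i, b)) l r)\<^sup>*" using H(3)[OF i, of b] 2 by (auto simp: conn_def)
          then show ?thesis by (rule adj_rtrancl_mono) (cases b, auto simp: D_def)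
        qed
      qed
    qed
  qed
qed

end

section \<open>Reductions in the absence of tight sets\<close>

text \<open>Costs are even, so a map that does not cost 6 costs at least 8.\<close>

locale untight_graph = rooted_graph V E l r \<sigma> v
  for V :: "'v set" and E :: "'e set" and l r :: "'e \<Rightarrow> 'v" and \<sigma> :: "'e \<Rightarrow> int" and v :: 'v +
  assumes cost_ge8: "tern s \<Longrightarrow> s v = 1 \<Longrightarrow> w \<in> V - {v} \<Longrightarrow> s w \<noteq> 0 \<Longrightarrow> 8 \<le> cost E l r \<sigma> s"
begin

text \<open>The smaller instance is only a \<open>rooted_graph\<close>: a reduction may create tight
  maps again, which then have to be contracted.\<close>

definition reducible :: bool where
  "reducible \<longleftrightarrow> (\<exists>V' E' l' r' \<sigma>'. rooted_graph (V' :: 'v set) (E' :: 'e set) l' r' \<sigma>' v \<and>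
     card V' + card E' < card V + card E \<and>
     (rooted3 E' l' r' \<sigma>' v \<longrightarrow> rooted3 E l r \<sigma> v))"

lemma ternD: "tern s \<Longrightarrow> s w = - 1 \<or> s w = 0 \<or> s w = 1"
  by (simp add: tern_def)

lemma tern_upd: "tern s \<Longrightarrow> k = - 1 \<or> k = 0 \<or> k = 1 \<Longrightarrow> tern (s(u := k))"
  by (simp add: tern_def)

lemma cost_full:
  assumes "tern s" "s v = 1" "\<And>w. w \<in> V \<Longrightarrow> s w \<noteq> 0"
  shows "cost E l r \<sigma> s mod 4 = 2"
proof (rule cost_full_mod4[OF finE deg_even sgn odd_total])
  fix e assume "e \<in> E"
  from ends[OF this] assms(3)[of "l e"] assms(3)[of "r e"]
    ternD[OF assms(1), of "l e"] ternD[OF assms(1), of "r e"]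
  show "(s (l e) = 1 \<or> s (l e) = - 1) \<and> (s (r e) = 1 \<or> s (r e) = - 1)" by auto
qed

lemma sum_darts_v: "(\<Sum>e\<in>E. of_bool (l e = v) + of_bool (r e = v)) = (6::int)"
  using deg_v by (simp add: deg_def)

text \<open>The map that is 1 at \<open>v\<close> and 0 elsewhere costs at most the number 6 of edge
  ends at \<open>v\<close>, and at least 6. So no edge falls short of its number of ends at
  \<open>v\<close>, whereas a positive loop would cost 0 instead of 2.\<close>

lemma loop_v:
  assumes "e \<in> E" "l e = v" "r e = v"
  shows "\<sigma> e = - 1"
proof -
  define d where "d w = (if w = v then 1 else 0 :: int)" for w
  have le: "ecost l r \<sigma> d g \<le> of_bool (l g = v) + of_bool (r g = v)" if "g \<in> E" for g
    using sgn[OF that] by (auto simp: ecost_def d_def)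
  have "cost E l r \<sigma> d \<le> 6"
    unfolding cost_def sum_darts_v[symmetric] by (rule sum_mono[OF le])
  moreover have "6 \<le> cost E l r \<sigma> d" by (rule cost_ge6) (auto simp: tern_def d_def)
  ultimately have "cost E l r \<sigma> d = (\<Sum>e\<in>E. of_bool (l e = v) + of_bool (r e = v))"
    using sum_darts_v by simp
  from sum_mono_inv[OF this[unfolded cost_def] le assms(1) finE]
  show ?thesis using assms sgn[OF assms(1)] by (auto simp: ecost_def d_def)
qed

text \<open>Each edge end at \<open>v\<close> contributes 2 to the sum of the two costs, which leaves no room for both
  a conflict away from \<open>v\<close> and an edge from the support to its complement.\<close>

lemma cost_opposite:
  assumes s: "tern s" "s v = 1" and t: "tern t" "t v = 1" and st: "\<And>w. w \<in> V - {v} \<Longrightarrow> t w = - s w"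
    and w0: "w0 \<in> V - {v}" "s w0 \<noteq> 0"
    and e0: "e0 \<in> E" "l e0 \<noteq> v" "r e0 \<noteq> v" "2 \<le> ecost l r \<sigma> s e0"
  shows "18 \<le> cost E l r \<sigma> s + cost E l r \<sigma> t"
proof (cases "\<forall>w\<in>V. s w \<noteq> 0")
  case True
  have "t w \<noteq> 0" if "w \<in> V" for w using True that st[of w] t(2) by (cases "w = v") auto
  \<comment> \<open>Both maps cover all vertices, and a cost of at least 8 that is 2 modulo 4 is at
    least 10.\<close>
  then have "cost E l r \<sigma> s mod 4 = 2" "cost E l r \<sigma> t mod 4 = 2"
    using cost_full s t True by auto
  moreover have "8 \<le> cost E l r \<sigma> s" "8 \<le> cost E l r \<sigma> t"
    using cost_ge8[OF s w0] cost_ge8[OF t w0(1)] st[OF w0(1)] w0(2) by auto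
  ultimately show ?thesis by presburger
next
  case False
  define Y where "Y = {w \<in> V - {v}. s w \<noteq> 0}"
  define Z where "Z = {w \<in> V - {v}. s w = 0}"
  define x where "x e = (of_bool (l e \<in> Y \<and> r e \<in> Z \<or> l e \<in> Z \<and> r e \<in> Y) :: int)" for e
  define d where "d e = (of_bool (l e = v) + of_bool (r e = v) :: int)" for e
  have dsum: "(\<Sum>e\<in>E. d e) = 6" using sum_darts_v by (simp add: d_def)
  have Z0: "Z \<noteq> {}" using False s(2) by (auto simp: Z_def)
  have cases3: "w = v \<or> w \<in> Y \<or> w \<in> Z" if "w \<in> V" for w using that by (auto simp: Y_def Z_def)
  have vY: "v \<notin> Y" "v \<notin> Z" "\<And>w. w \<in> Y \<Longrightarrow> w \<notin> Z" by (auto simp: Y_def Z_def)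
  have Yv: "(s w = 1 \<or> s w = - 1) \<and> t w = - s w" if "w \<in> Y" for w
    using that ternD[OF s(1), of w] st[of w] by (auto simp: Y_def)
  have Zv: "s w = 0 \<and> t w = 0" if "w \<in> Z" for w
    using that st[of w] by (auto simp: Z_def)
  \<comment> \<open>The edge ends at \<open>v\<close> account for at most 6 of these 8, so there is
    an edge between \<open>Y\<close> and \<open>Z\<close>, which lies in both cuts.\<close>
  have "8 \<le> dcut E l r Y + dcut E l r Z"
    using cut_ge4[of Y] cut_ge4[of Z] Z0 w0 by (force simp: Y_def Z_def)
  also have "\<dots> \<le> (\<Sum>e\<in>E. d e + 2 * x e)"
    unfolding dcut_def sum.distrib[symmetric]
  proof (rule sum_mono)
    fix e assume "e \<in> E"
    from ends[OF this] cases3[of "l e"] cases3[of "r e"] vY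
    show "crosses l r Y e + crosses l r Z e \<le> d e + 2 * x e"
      by (auto simp: crosses_def d_def x_def)
  qed
  finally have xs: "1 \<le> (\<Sum>e\<in>E. x e)"
    using dsum by (simp add: sum.distrib sum_distrib_left[symmetric])
  \<comment> \<open>The total is 12 from the ends at \<open>v\<close>, at least 2 from edges between
    \<open>Y\<close> and \<open>Z\<close>, and 4 from \<open>e0\<close>; it exceeds the 16 of two
    maps of cost 8.\<close>
  have "(\<Sum>e\<in>E. 2 * d e + 2 * x e + (if e = e0 then 4 else 0)) \<le> cost E l r \<sigma> s + cost E l r \<sigma> t"
    unfolding cost_def sum.distrib[symmetric]
  proof (rule sum_mono)
    fix e assume e: "e \<in> E"
    have lr: "l e = v \<or> l e \<in> Y \<or> l e \<in> Z" "r e = v \<or> r e \<in> Y \<or> r e \<in> Z"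
      using ends[OF e] cases3 by auto
    show "2 * d e + 2 * x e + (if e = e0 then 4 else 0) \<le> ecost l r \<sigma> s e + ecost l r \<sigma> t e"
    proof (cases "e = e0")
      case True
      have c: "\<not> (l e \<in> Z \<or> r e \<in> Z)" using e0(4) sgn[OF e] ternD[OF s(1), of "l e"] ternD[OF s(1), of "r e"] Zv True
        by (auto simp: ecost_def)
      then have "l e \<in> Y" "r e \<in> Y" using lr e0 True by auto
      with True e0(2-4) c sgn[OF e] show ?thesis
        using Yv[of "l e"] Yv[of "r e"] by (auto simp: d_def x_def ecost_def)
    next
      case False
      from lr loop_v[OF e] s(2) t(2) sgn[OF e] Yv[of "l e"] Yv[of "r e"] Zv[of "l e"] Zv[of "r e"] vY False
      show ?thesis by (elim disjE) (auto simp: d_def x_def ecost_def)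
    qed
  qed
  then show ?thesis using dsum xs e0(1) finE
    by (simp add: sum.distrib sum_distrib_left[symmetric])
qed

text \<open>A cut shrinks, by 2, only if it separates \<open>u\<close> from both far ends, which
  \<open>K\<close> forbids for cuts of size 4. A cost drops by 4 only if both far values are
  opposite to \<open>s u\<close> and nonzero, which \<open>C2\<close> forbids at cost 8; a drop by 2
  is always affordable there. A map that vanishes off \<open>v\<close> may cost just 6, but then
  \<open>s u\<close> is 0 and by \<open>C1\<close> so is one of the far values, and nothing is
  lost.\<close>

lemma reducible_split:
  assumes e: "e \<in> E" "f \<in> E" "e \<noteq> f" "joins l r e x u" "joins l r f u y" and "u \<noteq> v"
    and K: "\<And>K. K \<subseteq> V - {v} \<Longrightarrow> K \<noteq> {} \<Longrightarrow> dcut E l r K = 4 \<Longrightarrow>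
        (x \<in> K \<longleftrightarrow> u \<in> K) \<or> (y \<in> K \<longleftrightarrow> u \<in> K)"
    and C1: "\<not> (x = v \<and> y = v)"
    and C2: "\<And>s. tern s \<Longrightarrow> s v = 1 \<Longrightarrow> cost E l r \<sigma> s = 8 \<Longrightarrow> s u \<noteq> 0 \<Longrightarrow>
        \<sigma> e * s x = - s u \<Longrightarrow> \<sigma> f * s y \<noteq> - s u"
  shows reducible
proof -
  let ?E = "E - {f}" and ?l = "l(e := x)" and ?r = "r(e := y)" and ?\<sigma> = "\<sigma>(e := \<sigma> e * \<sigma> f)"
  interpret r0: signed_graph V ?E ?l ?r ?\<sigma> v by (rule signed_graph_split[OF e assms(6)])
  have "rooted_graph V ?E ?l ?r ?\<sigma> v"
  proof unfold_locales
    fix K assume K': "K \<subseteq> V - {v}" "K \<noteq> {}"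
    have "dcut E l r K = 4 \<or> 6 \<le> dcut E l r K" using cut_ge4[OF K'] dcut_ev[of K] by presburger
    then show "4 \<le> dcut ?E ?l ?r K"
      using dcut_split[OF finE e, of K] K[OF K'] by (auto simp: of_bool_def split: if_splits)
  next
    fix s assume s: "tern s" "s v = 1"
    have g: "cost E l r \<sigma> s + \<bar>\<sigma> e * s x - \<sigma> f * s y\<bar> =
       cost ?E ?l ?r ?\<sigma> s + \<bar>\<sigma> e * s x - s u\<bar> + \<bar>\<sigma> f * s y - s u\<bar>"
      by (rule cost_split[OF finE e]) (use sgn e in auto)
    have xy: "x \<in> V" "y \<in> V" "u \<in> V" using e ends[OF e(1)] ends[OF e(2)] by (auto simp: joins_def)
    define a where "a = \<sigma> e * s x"
    define b where "b = \<sigma> f * s y"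
    have ab: "a = - 1 \<or> a = 0 \<or> a = 1" "b = - 1 \<or> b = 0 \<or> b = 1" "s u = - 1 \<or> s u = 0 \<or> s u = 1"
      using ternD[OF s(1), of u] sgn[OF e(1)] sgn[OF e(2)] ternD[OF s(1), of x] ternD[OF s(1), of y]
      by (auto simp: a_def b_def)
    show "6 \<le> cost ?E ?l ?r ?\<sigma> s"
    proof (cases "\<exists>w\<in>V - {v}. s w \<noteq> 0")
      case True
      then have "8 \<le> cost E l r \<sigma> s" using cost_ge8[OF s] by blast
      then have "cost E l r \<sigma> s = 8 \<or> 10 \<le> cost E l r \<sigma> s" using cost_ev[of s] by presburger
      moreover have "s u \<noteq> 0 \<Longrightarrow> a = - s u \<Longrightarrow> b \<noteq> - s u" if "cost E l r \<sigma> s = 8"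
        using C2[OF s that] by (simp add: a_def b_def)
      ultimately show ?thesis using g ab unfolding a_def[symmetric] b_def[symmetric]
        by (elim disjE) simp_all
    next
      case False
      then have "s u = 0" "a = 0 \<or> b = 0" using xy assms(6) C1 by (auto simp: a_def b_def)
      then show ?thesis using g cost_ge6[OF s] unfolding a_def[symmetric] b_def[symmetric] by auto
    qed
  qed
  moreover have "card V + card ?E < card V + card E"
    using card_Diff1_less[OF finE e(2)] by linarith
  moreover have "rooted3 ?E ?l ?r ?\<sigma> v \<longrightarrow> rooted3 E l r \<sigma> v"
    using rooted3_split[OF finE e] by blast
  ultimately show ?thesis unfolding reducible_def by blast
qed

text \<open>Cuts of size 4 do not separate \<open>u\<close> from \<open>x\<close>, so only maps of
  cost 8 can prevent the splitting of \<open>e\<close> with another edge \<open>f\<close> at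
  \<open>u\<close>. All maps that conflict on \<open>e\<close> turn out to share a smallest one, and
  its minimality yields an \<open>f\<close> that agrees with all of them.\<close>

lemma reducible_inner_edge:
  assumes KV: "K \<subseteq> V - {v}" and ux: "u \<in> K" "x \<in> K" "u \<noteq> x" and e: "e \<in> E" "joins l r e x u"
    and star: "\<And>K'. K' \<subseteq> V - {v} \<Longrightarrow> K' \<noteq> {} \<Longrightarrow> dcut E l r K' = 4 \<Longrightarrow> K \<subseteq> K' \<or> K \<inter> K' = {}"
  shows reducible
proof -
  define Bad where "Bad = {s. tern s \<and> s v = 1 \<and> cost E l r \<sigma> s = 8 \<and> s u \<noteq> 0 \<and> \<sigma> e * s x = - s u}"
  have uV: "u \<in> V - {v}" and xV: "x \<in> V - {v}" using KV ux by auto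
  have \<sigma>e: "\<sigma> e = 1 \<or> \<sigma> e = - 1" by (rule sgn[OF e(1)])
  have same: "s u = t u" if st: "s \<in> Bad" "t \<in> Bad" for s t
  proof (rule ccontr)
    assume ne: "s u \<noteq> t u"
    have s: "tern s" "s v = 1" "cost E l r \<sigma> s = 8" "s u \<noteq> 0" "\<sigma> e * s x = - s u"
      and t: "tern t" "t v = 1" "cost E l r \<sigma> t = 8" "t u \<noteq> 0" "\<sigma> e * t x = - t u"
      using st by (auto simp: Bad_def)
    have tu: "t u = - s u" using ne ternD[OF s(1), of u] ternD[OF t(1), of u] s(4) t(4) by auto
    have tx: "t x = - s x" using \<sigma>e s(5) t(5) tu by auto
    have "s x \<noteq> 0" using s(4,5) by auto
    have cs: "ecost l r \<sigma> s e = 2" "ecost l r \<sigma> t e = 2" "ecost l r \<sigma> (meet s t) e = 0" "ecost l r \<sigma> (join s t) e = 0"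
      unfolding ecost_joins[where \<sigma>=\<sigma>, OF e(2) \<sigma>e] using s t tu tx ternD[OF s(1), of u] \<open>s x \<noteq> 0\<close>
      by (auto simp: meet_def join_def)
    \<comment> \<open>Both maps conflict on \<open>e\<close>, with opposite values, so uncrossing
      saves 4. At most 12 remains, the meet takes 6 of it, and a join of cost below 8 vanishes off
      \<open>v\<close>: the maps are opposite, and \<open>cost_opposite\<close> applies.\<close>
    have "cost E l r \<sigma> (meet s t) + cost E l r \<sigma> (join s t) + 4 \<le> cost E l r \<sigma> s + cost E l r \<sigma> t"
      by (rule cost_meet_join_drop[OF finE e(1) s(1) t(1) sgn]) (use cs in auto)
    moreover have mj: "tern (meet s t)" "meet s t v = 1" "tern (join s t)" "join s t v = 1"
      using s t tern_meet tern_join by (auto simp: meet_def join_def)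
    ultimately have lt: "\<not> 8 \<le> cost E l r \<sigma> (join s t)"
      using s(3) t(3) cost_ge6[OF mj(1,2)] by simp
    have "t w = - s w" if w: "w \<in> V - {v}" for w
    proof (rule ccontr)
      assume "t w \<noteq> - s w"
      then have "join s t w \<noteq> 0" by (auto simp: join_def sgn_if)
      with cost_ge8[OF mj(3,4) w] lt show False by blast
    qed
    from cost_opposite[OF s(1,2) t(1,2) this uV s(4) e(1)] e(2) uV xV cs(1) s(3) t(3)
    show False by (auto simp: joins_def)
  qed
  have cl: "meet s t \<in> Bad" if st: "s \<in> Bad" "t \<in> Bad" for s t
  proof -
    have s: "tern s" "s v = 1" "cost E l r \<sigma> s = 8" "s u \<noteq> 0" "\<sigma> e * s x = - s u"
      and t: "tern t" "t v = 1" "cost E l r \<sigma> t = 8" "t u \<noteq> 0" "\<sigma> e * t x = - t u"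
      using st by (auto simp: Bad_def)
    have tu: "t u = s u" using same[OF st] by simp
    have tx: "t x = s x" using \<sigma>e s(5) t(5) tu by auto
    have mj: "tern (meet s t)" "meet s t v = 1" "tern (join s t)" "join s t v = 1"
      using s t tern_meet tern_join by (auto simp: meet_def join_def)
    have u: "meet s t u = s u" "join s t u \<noteq> 0" "meet s t x = s x"
      using tu tx s(4) by (auto simp: meet_def join_def sgn_if)
    have "cost E l r \<sigma> (meet s t) + cost E l r \<sigma> (join s t) \<le> cost E l r \<sigma> s + cost E l r \<sigma> t"
      by (rule cost_meet_join[OF s(1) t(1) sgn])
    moreover have "8 \<le> cost E l r \<sigma> (meet s t)" using cost_ge8[OF mj(1,2) uV] u s(4) by simp
    moreover have "8 \<le> cost E l r \<sigma> (join s t)" using cost_ge8[OF mj(3,4) uV] u by simp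
    ultimately have "cost E l r \<sigma> (meet s t) = 8" using s(3) t(3) by simp
    then show ?thesis using mj u s by (simp add: Bad_def)
  qed
  have "\<exists>f\<in>E. \<exists>y. f \<noteq> e \<and> joins l r f u y \<and> (\<forall>s\<in>Bad. \<sigma> f * s y \<noteq> - s u)"
  proof (cases "Bad = {}")
    case True
    have "4 \<le> dcut E l r {u}" by (rule cut_ge4) (use uV in auto)
    also have "dcut E l r {u} = crosses l r {u} e + (\<Sum>g\<in>E - {e}. crosses l r {u} g)"
      unfolding dcut_def by (rule sum.remove[OF finE e(1)])
    also have "crosses l r {u} e \<le> 1" by (simp add: crosses_def)
    finally have "(\<Sum>g\<in>E - {e}. crosses l r {u} g) \<noteq> 0" by simp
    then obtain f where "f \<in> E - {e}" "crosses l r {u} f \<noteq> 0" by (meson sum.neutral)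
    then have "f \<in> E" "f \<noteq> e" "l f = u \<or> r f = u" by (auto simp: crosses_def split: if_splits)
    then have "\<exists>y. joins l r f u y" by (auto simp: joins_def)
    with \<open>f \<in> E\<close> \<open>f \<noteq> e\<close> True show ?thesis by blast
  next
    case False
    obtain s where sB: "s \<in> Bad"
      and smin: "\<And>t. t \<in> Bad \<Longrightarrow> card {w \<in> V. s w \<noteq> 0} \<le> card {w \<in> V. t w \<noteq> 0}"
      using False ex_has_least_nat[of "\<lambda>s. s \<in> Bad" _ "\<lambda>s. card {w \<in> V. s w \<noteq> 0}"] by blast
    have s: "tern s" "s v = 1" "cost E l r \<sigma> s = 8" "s u \<noteq> 0" "\<sigma> e * s x = - s u"
      using sB by (auto simp: Bad_def)
    \<comment> \<open>By minimality the meet of \<open>s\<close> with any member of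
      \<open>Bad\<close> has the same support as \<open>s\<close>.\<close>
    have agree: "t w = s w" if t: "t \<in> Bad" and w: "w \<in> V" "s w \<noteq> 0" for t w
    proof -
      have sub: "{w \<in> V. meet s t w \<noteq> 0} \<subseteq> {w \<in> V. s w \<noteq> 0}" by (auto simp: meet_def)
      have "{w \<in> V. meet s t w \<noteq> 0} = {w \<in> V. s w \<noteq> 0}"
        by (rule card_seteq[OF _ sub smin[OF cl[OF sB t]]]) (use finV in auto)
      then have "meet s t w \<noteq> 0" using w by auto
      then show ?thesis by (auto simp: meet_def split: if_splits)
    qed
    \<comment> \<open>Without an agreeing edge at \<open>u\<close>, setting \<open>s u\<close> to 0
      would raise no edge cost and would lower that of \<open>e\<close>, giving a cost below 8
      although \<open>x\<close> is still in the support.\<close>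
    have "\<exists>f\<in>E. \<exists>y. joins l r f u y \<and> \<sigma> f * s y = s u \<and> y \<noteq> u"
    proof (rule ccontr)
      assume n: "\<not> ?thesis"
      let ?t = "s(u := 0)"
      have t: "tern ?t" "?t v = 1" "?t x \<noteq> 0" using s ux uV by (auto simp: tern_upd)
      have "cost E l r \<sigma> ?t < cost E l r \<sigma> s" unfolding cost_def
      proof (rule sum_strict_mono_ex1[OF finE])
        show "\<exists>a\<in>E. ecost l r \<sigma> ?t a < ecost l r \<sigma> s a"
        proof (rule bexI[OF _ e(1)])
          show "ecost l r \<sigma> ?t e < ecost l r \<sigma> s e"
            unfolding ecost_joins[where \<sigma>=\<sigma>, OF e(2) \<sigma>e] using s(4,5) ux ternD[OF s(1), of u] by auto
        qed
        show "\<forall>g\<in>E. ecost l r \<sigma> ?t g \<le> ecost l r \<sigma> s g"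
        proof
          fix g assume g: "g \<in> E"
          show "ecost l r \<sigma> ?t g \<le> ecost l r \<sigma> s g"
          proof (cases "\<exists>y. joins l r g u y")
            case True
            then obtain y where y: "joins l r g u y" by blast
            show ?thesis
            proof (cases "y = u")
              case True
              then show ?thesis using y by (auto simp: ecost_def joins_def)
            next
              case False
              have "\<sigma> g * s y \<noteq> s u" using n g y False by blast
              then show ?thesis
                unfolding ecost_joins[where \<sigma>=\<sigma>, OF joins_sym[OF y] sgn[OF g]]
                using False ternD[OF s(1), of u] ternD[OF s(1), of y] sgn[OF g] s(4) by auto
            qed
          next
            case False
            then have "l g \<noteq> u" "r g \<noteq> u" by (auto simp: joins_def)
            then show ?thesis by (simp add: ecost_def)
          qed
        qed
      qed
      with cost_ge8[OF t(1,2) xV t(3)] s(3) show False by linarith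
    qed
    then obtain f y where f: "f \<in> E" "joins l r f u y" "\<sigma> f * s y = s u" "y \<noteq> u" by blast
    have "y \<in> V" using f ends by (auto simp: joins_def)
    have "s y \<noteq> 0" using f s(4) by auto
    have "f \<noteq> e"
    proof
      assume "f = e"
      then have "y = x" using f(2) e(2) ux(3) f(4) by (auto simp: joins_def)
      then show False using \<open>f = e\<close> f(3) s(4,5) by auto
    qed
    moreover have "\<sigma> f * t y \<noteq> - t u" if "t \<in> Bad" for t
      using agree[OF that \<open>y \<in> V\<close> \<open>s y \<noteq> 0\<close>] agree[OF that _ s(4)] uV f(3) s(4) by auto
    ultimately show ?thesis using f by blast
  qed
  then obtain f y where f: "f \<in> E" "f \<noteq> e" "joins l r f u y" "\<And>s. s \<in> Bad \<Longrightarrow> \<sigma> f * s y \<noteq> - s u" by blast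
  show ?thesis
  proof (rule reducible_split[OF e(1) f(1) f(2)[symmetric] e(2) f(3)])
    show "u \<noteq> v" using uV by simp
    show "\<not> (x = v \<and> y = v)" using xV by simp
    show "(x \<in> K' \<longleftrightarrow> u \<in> K') \<or> (y \<in> K' \<longleftrightarrow> u \<in> K')"
      if "K' \<subseteq> V - {v}" "K' \<noteq> {}" "dcut E l r K' = 4" for K'
      using star[OF that] ux by auto
  qed (use f(4) in \<open>auto simp: Bad_def\<close>)
qed

end

section \<open>A vertex with a negative loop\<close>

definition oth :: "('e \<Rightarrow> 'v) \<Rightarrow> ('e \<Rightarrow> 'v) \<Rightarrow> 'v \<Rightarrow> 'e \<Rightarrow> 'v" where
  "oth l r u e = (if l e = u then r e else l e)"

lemma joins_oth: "l e = u \<or> r e = u \<Longrightarrow> joins l r e (oth l r u e) u"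
  by (auto simp: oth_def joins_def)

context untight_graph
begin

text \<open>Splitting an edge \<open>e\<close> together with the loop removes the loop and flips the
  sign of \<open>e\<close>. No cut changes, and the loop conflicts with every nonzero value at
  \<open>u\<close>, so the only obstruction is a map of cost 8 that conflicts on \<open>e\<close>
  itself. The four edges leaving \<open>u\<close> cannot all be obstructed.\<close>

lemma reducible_odd_loop:
  assumes uV: "u \<in> V - {v}" and d4: "V = {u, v} \<or> dcut E l r {u} = 4"
    and f: "f \<in> E" "l f = u" "r f = u" "\<sigma> f = - 1"
  shows reducible
proof -
  define N where "N = {e \<in> E. (l e = u) \<noteq> (r e = u)}"
  define x where "x e = oth l r u e" for e
  have NE: "e \<in> E" "joins l r e (x e) u" "x e \<noteq> u" "e \<noteq> f" "x e \<in> V" if "e \<in> N" for e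
    using that f ends[of e] joins_oth[of l e u r] by (auto simp: N_def x_def oth_def)
  have finN: "finite N" using finE by (simp add: N_def)
  have cardN: "dcut E l r {u} = int (card N)"
    using finE by (simp add: dcut_def crosses_def N_def Int_def)
  have xsg: "\<sigma> e * s (x e) = - 1 \<or> \<sigma> e * s (x e) = 0 \<or> \<sigma> e * s (x e) = 1" if "e \<in> N" "tern s" for e s
    using sgn[OF NE(1)[OF that(1)]] ternD[OF that(2), of "x e"] by auto
  define Bad where "Bad e s \<longleftrightarrow> tern s \<and> s v = 1 \<and> cost E l r \<sigma> s = 8 \<and> s u \<noteq> 0 \<and> \<sigma> e * s (x e) = - s u" for e s
  have good: ?thesis if e: "e \<in> N" and n: "\<And>s. \<not> Bad e s" for e
  proof (rule reducible_split[OF NE(1)[OF e] f(1) NE(4)[OF e] NE(2)[OF e]])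
    show "joins l r f u u" using f by (simp add: joins_def)
    show "u \<noteq> v" using uV by simp
    show "\<not> (x e = v \<and> u = v)" using uV by simp
    show "\<sigma> f * s u \<noteq> - s u" if "tern s" "s v = 1" "cost E l r \<sigma> s = 8" "s u \<noteq> 0" "\<sigma> e * s (x e) = - s u" for s
      using that n[of s] by (simp add: Bad_def)
  qed simp
  show ?thesis
  proof (cases "V = {u, v}")
    case True
    have "4 \<le> dcut E l r {u}" by (rule cut_ge4) (use uV in auto)
    then obtain e where "e \<in> N" using cardN by fastforce
    moreover have "\<not> Bad e s" for e s
    proof
      assume "Bad e s"
      then have s: "tern s" "s v = 1" "cost E l r \<sigma> s = 8" "s u \<noteq> 0" by (auto simp: Bad_def)
      have "cost E l r \<sigma> s mod 4 = 2" by (rule cost_full[OF s(1,2)]) (use True s in auto)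
      with s(3) show False by simp
    qed
    ultimately show ?thesis using good by blast
  next
    case False
    then have N4: "card N = 4" using d4 cardN by simp
    \<comment> \<open>Setting \<open>s u\<close> to 0 saves 2 at the loop, adds 1 for each edge of
      \<open>N\<close> that agrees with \<open>s u\<close>, and saves 1 for each of the others: 8 -
      2 + p - (4 - p) with p agreeing edges.\<close>
    have zero: "cost E l r \<sigma> (s(u := 0)) \<le> 2 * int (card {e \<in> N. \<sigma> e * s (x e) = s u}) + 2"
      if s: "tern s" "s v = 1" "cost E l r \<sigma> s = 8" "s u \<noteq> 0" for s
    proof -
      let ?t = "s(u := 0)"
      define h where "h e = (if e \<in> N then if \<sigma> e * s (x e) = s u then 1 else - 1 else 0 :: int)" for e
      have su: "s u = 1 \<or> s u = - 1" using ternD[OF s(1), of u] s(4) by auto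
      have "cost E l r \<sigma> ?t \<le> (\<Sum>e\<in>E. ecost l r \<sigma> s e + h e - (if e = f then 2 else 0))"
        unfolding cost_def
      proof (rule sum_mono)
        fix e assume e: "e \<in> E"
        show "ecost l r \<sigma> ?t e \<le> ecost l r \<sigma> s e + h e - (if e = f then 2 else 0)"
        proof (cases "e \<in> N")
          case True
          show ?thesis
            unfolding ecost_joins[where \<sigma>=\<sigma>, OF NE(2)[OF True] sgn[OF e]]
            using NE(3,4)[OF True] xsg[OF True s(1)] su sgn[OF e] True by (auto simp: h_def)
        next
          case False
          then have "l e = u \<and> r e = u \<or> l e \<noteq> u \<and> r e \<noteq> u" using e by (auto simp: N_def)
          then show ?thesis using False f su by (auto simp: h_def ecost_def)
        qed
      qed
      also have "\<dots> = 8 + (\<Sum>e\<in>E. h e) - 2"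
        using finE f(1) s(3) by (simp add: sum_subtractf sum.distrib cost_def)
      also have "(\<Sum>e\<in>E. h e) = (\<Sum>e\<in>N. h e)"
        by (rule sum.mono_neutral_right[OF finE]) (auto simp: N_def h_def)
      also have "\<dots> = (\<Sum>e\<in>N. 2 * of_bool (\<sigma> e * s (x e) = s u) - 1)"
        by (rule sum.cong) (auto simp: h_def)
      also have "\<dots> = 2 * int (card {e \<in> N. \<sigma> e * s (x e) = s u}) - 4"
        using finN N4 by (simp add: sum_subtractf sum_distrib_left[symmetric] Int_def)
      finally show ?thesis by linarith
    qed
    \<comment> \<open>If all four edges led to \<open>v\<close>, at most two edge ends at
      \<open>v\<close> would be left to connect the remaining vertices, against the cut
      condition.\<close>
    have nonv: "\<exists>e\<in>N. x e \<noteq> v"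
    proof (rule ccontr)
      assume n: "\<not> ?thesis"
      define W where "W = V - {u, v}"
      have W: "W \<noteq> {}" "W \<subseteq> V - {v}" using False uV vV by (auto simp: W_def)
      have "dcut E l r W \<le> (\<Sum>e\<in>E. (of_bool (l e = v) + of_bool (r e = v)) - of_bool (e \<in> N))"
        unfolding dcut_def
      proof (rule sum_mono)
        fix e assume e: "e \<in> E"
        show "crosses l r W e \<le> (of_bool (l e = v) + of_bool (r e = v)) - of_bool (e \<in> N)"
        proof (cases "e \<in> N")
          case True
          then have "x e = v" using n by auto
          with NE(2)[OF True] uV True show ?thesis by (auto simp: crosses_def W_def joins_def)
        next
          case False
          with e ends[OF e] uV show ?thesis by (auto simp: crosses_def W_def N_def)
        qed
      qed
      also have "\<dots> = 6 - int (card (E \<inter> N))"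
        using sum_darts_v finE by (simp add: sum_subtractf)
      also have "E \<inter> N = N" by (auto simp: N_def)
      finally show False using cut_ge4[OF W(2,1)] N4 by simp
    qed
    \<comment> \<open>An obstruction to \<open>g\<close> also conflicts on \<open>h\<close>, so at
      most two edges agree. Zeroing at \<open>u\<close> then gives a map of cost at most 6, which
      must vanish off \<open>v\<close>; but the agreeing edges include one whose far end is not
      \<open>v\<close>.\<close>
    have pairv: ?thesis if gh: "g \<in> N" "h \<in> N" "g \<noteq> h" "x g = v" "x h = v" "\<sigma> g = \<sigma> h" for g h
    proof (rule good[OF gh(1)], rule notI)
      fix s assume "Bad g s"
      then have s: "tern s" "s v = 1" "cost E l r \<sigma> s = 8" "s u \<noteq> 0" "\<sigma> g * s (x g) = - s u"
        by (auto simp: Bad_def)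
      let ?P = "{e \<in> N. \<sigma> e * s (x e) = s u}"
      have "g \<notin> ?P" "h \<notin> ?P" using s(4,5) gh(4-6) by auto
      then have sub: "?P \<subseteq> N - {g, h}" by auto
      have c2: "card (N - {g, h}) = 2" using gh(1-3) finN N4 by (simp add: card_Diff_subset)
      have t: "tern (s(u := 0))" "(s(u := 0)) v = 1" using s uV by (auto simp: tern_upd)
      have "2 \<le> card ?P" using zero[OF s(1-4)] cost_ge6[OF t] by linarith
      then have P: "?P = N - {g, h}" using sub c2 finN by (intro card_seteq) auto
      then have "cost E l r \<sigma> (s(u := 0)) \<le> 6" using zero[OF s(1-4)] c2 by simp
      then have triv: "(s(u := 0)) w = 0" if "w \<in> V - {v}" for w using cost_ge8[OF t that] by fastforce
      obtain k where k: "k \<in> N" "x k \<noteq> v" using nonv by auto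
      then have "k \<in> ?P" using P gh(4,5) by auto
      then have "s (x k) \<noteq> 0" using s(4) by auto
      with triv[of "x k"] k NE(3,5)[OF k(1)] show False by auto
    qed
    show ?thesis
    proof (rule ccontr)
      assume nr: "\<not> reducible"
      have bad: "\<exists>s. Bad e s" if "e \<in> N" for e using good[OF that] nr by blast
      have "inj_on \<sigma> {e \<in> N. x e = v}"
        using pairv nr by (auto simp: inj_on_def)
      moreover have "\<sigma> ` {e \<in> N. x e = v} \<subseteq> {1, - 1}" using sgn NE(1) by auto
      ultimately have "card {e \<in> N. x e = v} \<le> card {1, - 1 :: int}"
        by (intro card_inj_on_le) auto
      moreover have "card {e \<in> N. x e = v} + card {e \<in> N. x e \<noteq> v} = 4"
      proof -
        have "card N = card ({e \<in> N. x e = v} \<union> {e \<in> N. x e \<noteq> v})"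
          by (rule arg_cong[of _ _ card]) auto
        also have "\<dots> = card {e \<in> N. x e = v} + card {e \<in> N. x e \<noteq> v}"
          by (rule card_Un_disjoint) (use finN in auto)
        finally show ?thesis using N4 by simp
      qed
      ultimately have "2 \<le> card {e \<in> N. x e \<noteq> v}" by simp
      then obtain a b where ab: "a \<in> N" "b \<in> N" "a \<noteq> b" "x a \<noteq> v" "x b \<noteq> v"
        using card_le_Suc0_iff_eq[of "{e \<in> N. x e \<noteq> v}"] finN by fastforce
      \<comment> \<open>After zeroing at \<open>u\<close> the far end of \<open>e\<close> is still
        in the support, so the cost is at least 8 and three edges agree: all except
        \<open>e\<close>.\<close>
      have thr: "\<sigma> k * s (x k) = s u" if B: "Bad e s" "e \<in> N" "x e \<noteq> v" and k: "k \<in> N" "k \<noteq> e" for e s k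
      proof -
        have s: "tern s" "s v = 1" "cost E l r \<sigma> s = 8" "s u \<noteq> 0" "\<sigma> e * s (x e) = - s u"
          using B(1) by (auto simp: Bad_def)
        let ?P = "{e \<in> N. \<sigma> e * s (x e) = s u}"
        have t: "tern (s(u := 0))" "(s(u := 0)) v = 1" using s uV by (auto simp: tern_upd)
        have "8 \<le> cost E l r \<sigma> (s(u := 0))"
          by (rule cost_ge8[OF t, of "x e"]) (use B NE(3,5)[OF B(2)] s(4,5) in auto)
        then have "3 \<le> card ?P" using zero[OF s(1-4)] by linarith
        moreover have "?P \<subseteq> N - {e}" using s(4,5) by auto
        moreover have "card (N - {e}) = 3" using N4 finN B(2) by simp
        ultimately have "?P = N - {e}" using finN by (intro card_seteq) auto
        with k show ?thesis by auto
      qed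
      obtain s where Bs: "Bad a s" using bad ab(1) by blast
      obtain t where Bt: "Bad b t" using bad ab(2) by blast
      have s: "tern s" "s v = 1" "cost E l r \<sigma> s = 8" "s u \<noteq> 0" "\<sigma> a * s (x a) = - s u"
        using Bs by (auto simp: Bad_def)
      have t: "tern t" "t v = 1" "cost E l r \<sigma> t = 8" "t u \<noteq> 0" "\<sigma> b * t (x b) = - t u"
        using Bt by (auto simp: Bad_def)
      have mj: "tern (meet s t)" "meet s t v = 1" "tern (join s t)" "join s t v = 1"
        using s t tern_meet tern_join by (auto simp: meet_def join_def)
      have ta: "\<sigma> a * t (x a) = t u" by (rule thr[OF Bt ab(2,5,1,3)])
      have sb: "\<sigma> b * s (x b) = s u" by (rule thr[OF Bs ab(1,4,2)]) (use ab in auto)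
      have \<sigma>a: "\<sigma> a = 1 \<or> \<sigma> a = - 1" and \<sigma>b: "\<sigma> b = 1 \<or> \<sigma> b = - 1" using sgn NE(1) ab by auto
      show False
      proof (cases "t u = s u")
        case False
        \<comment> \<open>The loop conflicts under both maps and saves 4, but the meet is nonzero at
          \<open>x a\<close> and costs at least 8: 8 + 6 + 4 exceeds 16.\<close>
        then have tu: "t u = - s u" using ternD[OF s(1), of u] ternD[OF t(1), of u] s(4) t(4) by auto
        have "s (x a) = t (x a)" "s (x a) \<noteq> 0" using ta s(4,5) tu \<sigma>a by auto
        then have "meet s t (x a) \<noteq> 0" by (simp add: meet_def)
        then have "8 \<le> cost E l r \<sigma> (meet s t)"
          using cost_ge8[OF mj(1,2), of "x a"] NE(5)[OF ab(1)] ab(4) by blast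
        moreover have "6 \<le> cost E l r \<sigma> (join s t)" by (rule cost_ge6[OF mj(3,4)])
        moreover have "cost E l r \<sigma> (meet s t) + cost E l r \<sigma> (join s t) + 4 \<le> cost E l r \<sigma> s + cost E l r \<sigma> t"
        proof (rule cost_meet_join_drop[OF finE f(1) s(1) t(1) sgn])
          show "ecost l r \<sigma> (meet s t) f + ecost l r \<sigma> (join s t) f + 4 \<le> ecost l r \<sigma> s f + ecost l r \<sigma> t f"
            using f tu s(4) ternD[OF s(1), of u] by (auto simp: ecost_def meet_def join_def)
        qed
        ultimately show False using s(3) t(3) by simp
      next
        case True
        \<comment> \<open>The meet is again a map of cost 8, and it vanishes at \<open>x a\<close>
          and \<open>x b\<close>. Zeroing it at \<open>u\<close> leaves a map trivial off
          \<open>v\<close>, so the other two edges lead to \<open>v\<close> with equal signs, which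
          is the case \<open>pairv\<close>.\<close>
        define q where "q = meet s t"
        have q: "tern q" "q v = 1" "q u = s u" using mj True by (auto simp: q_def meet_def)
        have "8 \<le> cost E l r \<sigma> q" using cost_ge8[OF q(1,2) uV] q(3) s(4) by simp
        moreover have "join s t u \<noteq> 0" using True s(4) by (simp add: join_def sgn_if)
        then have "8 \<le> cost E l r \<sigma> (join s t)" by (rule cost_ge8[OF mj(3,4) uV])
        moreover have "cost E l r \<sigma> q + cost E l r \<sigma> (join s t) \<le> cost E l r \<sigma> s + cost E l r \<sigma> t"
          unfolding q_def by (rule cost_meet_join[OF s(1) t(1) sgn])
        ultimately have q8: "cost E l r \<sigma> q = 8" using s(3) t(3) by simp
        have "q (x a) = 0" "q (x b) = 0"
          using s(4,5) t(4,5) ta sb True \<sigma>a \<sigma>b by (auto simp: q_def meet_def)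
        then have "{e \<in> N. \<sigma> e * q (x e) = q u} \<subseteq> N - {a, b}" using s(4) q(3) by auto
        then have "card {e \<in> N. \<sigma> e * q (x e) = q u} \<le> card (N - {a, b})" using finN by (intro card_mono) auto
        moreover have c2: "card (N - {a, b}) = 2" using ab finN N4 by (simp add: card_Diff_subset)
        ultimately have g6: "cost E l r \<sigma> (q(u := 0)) \<le> 6"
          using zero[OF q(1,2) q8] q(3) s(4) by simp
        have q0: "tern (q(u := 0))" "(q(u := 0)) v = 1" using q uV by (auto simp: tern_upd)
        obtain c d where cd: "N - {a, b} = {c, d}" "c \<noteq> d" using c2 by (meson card_2_iff)
        have vk: "x k = v \<and> \<sigma> k = s u" if "k \<in> {c, d}" for k
        proof -
          have k: "k \<in> N" "k \<noteq> a" "k \<noteq> b" using that cd by auto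
          have ks: "\<sigma> k * s (x k) = s u" by (rule thr[OF Bs ab(1,4) k(1,2)])
          have kt: "\<sigma> k * t (x k) = s u" using thr[OF Bt ab(2,5) k(1,3)] True by simp
          have "s (x k) = t (x k)" "s (x k) \<noteq> 0" using ks kt s(4) sgn[OF NE(1)[OF k(1)]] by auto
          then have "(q(u := 0)) (x k) \<noteq> 0" using NE(3)[OF k(1)] by (simp add: q_def meet_def)
          then have "x k \<notin> V - {v}" using cost_ge8[OF q0, of "x k"] g6 by linarith
          then have "x k = v" using NE(5)[OF k(1)] by simp
          then show ?thesis using ks s(2) by simp
        qed
        have "c \<in> N" "d \<in> N" using cd by auto
        with pairv[of c d] vk[of c] vk[of d] cd(2) nr show False by auto
      qed
    qed
  qed
qed

end

text \<open>The best \<open>k\<close> lies between the intervals spanned by \<open>a\<close>,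
  \<open>b\<close> and by \<open>c\<close>, \<open>d\<close>, and its four distances sum to the two
  lengths plus twice the gap. Hence 8 is at most 4 plus twice the gap, and a gap of 2 determines all
  values. With 6 in place of 8, as in \<open>pairing_trivial\<close>, only a positive gap
  follows.\<close>

lemma pairing_nontrivial:
  fixes a b c d g :: int
  assumes "a \<in> {- 1, 0, 1}" "b \<in> {- 1, 0, 1}" "c \<in> {- 1, 0, 1}" "d \<in> {- 1, 0, 1}"
    and "\<And>k. k \<in> {- 1, 0, 1} \<Longrightarrow> 8 \<le> g + \<bar>a - k\<bar> + \<bar>b - k\<bar> + \<bar>c - k\<bar> + \<bar>d - k\<bar>"
    and "g + \<bar>a - b\<bar> + \<bar>c - d\<bar> \<le> 4"
  shows "g = 4 \<and> a \<noteq> 0 \<and> b = a \<and> c = - a \<and> d = - a"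
  using assms(1-4,6) assms(5)[of "- 1"] assms(5)[of 0] assms(5)[of 1]
  by (simp only: insert_iff empty_iff simp_thms) (elim disjE; hypsubst; simp)

lemma pairing_trivial:
  fixes a b c d g :: int
  assumes "a \<in> {- 1, 0, 1}" "b \<in> {- 1, 0, 1}" "c \<in> {- 1, 0, 1}" "d \<in> {- 1, 0, 1}"
    and "\<And>k. k \<in> {- 1, 0, 1} \<Longrightarrow> 6 \<le> g + \<bar>a - k\<bar> + \<bar>b - k\<bar> + \<bar>c - k\<bar> + \<bar>d - k\<bar>"
    and "g + \<bar>a - b\<bar> + \<bar>c - d\<bar> \<le> 4"
  shows "max a b < min c d \<or> max c d < min a b"
  using assms(1-4,6) assms(5)[of "- 1"] assms(5)[of 0] assms(5)[of 1]
  by (simp only: insert_iff empty_iff simp_thms) (elim disjE; hypsubst; simp)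

text \<open>Among three values, two separated intervals cannot both have length 1, and one of them
  must be a single extreme value.\<close>

lemma separated_pairs:
  fixes a b c d :: int
  assumes "a \<in> {- 1, 0, 1}" "b \<in> {- 1, 0, 1}" "c \<in> {- 1, 0, 1}" "d \<in> {- 1, 0, 1}"
    and "max a b < min c d \<or> max c d < min a b"
  shows "a = b \<and> a \<noteq> 0 \<or> c = d \<and> c \<noteq> 0"
  using assms by (simp only: insert_iff empty_iff simp_thms) (elim disjE; hypsubst; simp)

text \<open>The same gap argument with two values; the gap is at most 1, and parity closes the
  remaining difference.\<close>

lemma pairing_cut:
  fixes g :: int and a b c d :: bool
  assumes "\<And>j. 4 \<le> g + of_bool (a \<noteq> j) + of_bool (b \<noteq> j) + of_bool (c \<noteq> j) + of_bool (d \<noteq> j)"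
    and "\<And>j. even (g + of_bool (a \<noteq> j) + of_bool (b \<noteq> j) + of_bool (c \<noteq> j) + of_bool (d \<noteq> j))"
    and "g + of_bool (a \<noteq> b) + of_bool (c \<noteq> d) < 4"
  shows "a = b \<and> c = d \<and> a \<noteq> c \<and> g = 2"
  using assms(1)[of True] assms(1)[of False] assms(2)[of True] assms(3)
  by (cases a; cases b; cases c; cases d; simp; presburger?)

section \<open>Complete splitting at a vertex of degree 4\<close>

context untight_graph
begin

text \<open>\<open>a\<close>, \<open>b\<close>, \<open>c\<close>, \<open>d\<close> are the edges at a vertex \<open>u\<close> of degree 4; \<open>val s e\<close> is the value that
  \<open>s\<close> assigns, seen from \<open>u\<close>, to the far end of \<open>e\<close>.\<close>

definition star4 :: "'v \<Rightarrow> 'e \<Rightarrow> 'e \<Rightarrow> 'e \<Rightarrow> 'e \<Rightarrow> bool" where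
  "star4 u a b c d \<longleftrightarrow> u \<in> V - {v} \<and> distinct [a, b, c, d] \<and>
     {a, b, c, d} = {e \<in> E. l e = u \<or> r e = u} \<and> (\<forall>e\<in>E. \<not> (l e = u \<and> r e = u))"

definition rest :: "'v \<Rightarrow> 'e set" where
  "rest u = {e \<in> E. l e \<noteq> u \<and> r e \<noteq> u}"

definition val :: "'v \<Rightarrow> ('v \<Rightarrow> int) \<Rightarrow> 'e \<Rightarrow> int" where
  "val u s e = \<sigma> e * s (oth l r u e)"

lemma star4D:
  assumes "star4 u a b c d" "e \<in> {a, b, c, d}"
  shows "e \<in> E" "joins l r e (oth l r u e) u" "oth l r u e \<noteq> u" "oth l r u e \<in> V" "\<sigma> e = 1 \<or> \<sigma> e = - 1"
proof -
  from assms have e: "e \<in> E" "l e = u \<or> r e = u" by (auto simp: star4_def)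
  then show "e \<in> E" "joins l r e (oth l r u e) u" by (auto intro: joins_oth)
  show "oth l r u e \<noteq> u" using assms(1) e by (auto simp: star4_def oth_def)
  show "oth l r u e \<in> V" using ends[OF e(1)] by (auto simp: oth_def)
  show "\<sigma> e = 1 \<or> \<sigma> e = - 1" by (rule sgn[OF e(1)])
qed

lemma star4_sum:
  fixes h :: "'e \<Rightarrow> int"
  assumes "star4 u a b c d"
  shows "sum h E = sum h (rest u) + h a + h b + h c + h d"
proof -
  have "E = rest u \<union> {a, b, c, d}" using assms by (auto simp: star4_def rest_def)
  moreover have "rest u \<inter> {a, b, c, d} = {}" using assms by (auto simp: star4_def rest_def)
  moreover have "finite (rest u)" using finE by (simp add: rest_def)
  ultimately have "sum h E = sum h (rest u) + sum h {a, b, c, d}"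
    using sum.union_disjoint[of "rest u" "{a, b, c, d}" h] by (metis finite.emptyI finite_insert)
  also have "sum h {a, b, c, d} = h a + h b + h c + h d"
  proof -
    have "distinct [a, b, c, d]" using assms unfolding star4_def by blast
    then show ?thesis by (simp add: add.assoc)
  qed
  finally show ?thesis by simp
qed

lemma cost_star4:
  assumes "star4 u a b c d"
  shows "cost E l r \<sigma> (s(u := k)) = cost (rest u) l r \<sigma> s +
     \<bar>val u s a - k\<bar> + \<bar>val u s b - k\<bar> + \<bar>val u s c - k\<bar> + \<bar>val u s d - k\<bar>"
proof -
  have "ecost l r \<sigma> (s(u := k)) e = \<bar>val u s e - k\<bar>" if "e \<in> {a, b, c, d}" for e
    using ecost_joins[where \<sigma>=\<sigma>, OF star4D(2,5)[OF assms that]] star4D(3)[OF assms that] by (simp add: val_def)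
  moreover have "sum (ecost l r \<sigma> (s(u := k))) (rest u) = cost (rest u) l r \<sigma> s"
    unfolding cost_def by (rule sum.cong) (auto simp: rest_def ecost_def)
  ultimately show ?thesis unfolding cost_def[of E] star4_sum[OF assms] by simp
qed

lemma dcut_star4:
  assumes "star4 u a b c d"
  shows "dcut E l r K = dcut (rest u) l r (K - {u}) +
     of_bool ((oth l r u a \<in> K) \<noteq> (u \<in> K)) + of_bool ((oth l r u b \<in> K) \<noteq> (u \<in> K)) +
     of_bool ((oth l r u c \<in> K) \<noteq> (u \<in> K)) + of_bool ((oth l r u d \<in> K) \<noteq> (u \<in> K))"
proof -
  have "crosses l r K e = of_bool ((oth l r u e \<in> K) \<noteq> (u \<in> K))" if "e \<in> {a, b, c, d}" for e
    by (rule crosses_joins[OF star4D(2)[OF assms that]])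
  moreover have "sum (crosses l r K) (rest u) = dcut (rest u) l r (K - {u})"
    unfolding dcut_def by (rule sum.cong) (auto simp: rest_def crosses_def)
  ultimately show ?thesis unfolding dcut_def[of E] star4_sum[OF assms] by simp
qed

lemma val_tern: "star4 u a b c d \<Longrightarrow> e \<in> {a, b, c, d} \<Longrightarrow> tern s \<Longrightarrow> val u s e \<in> {- 1, 0, 1}"
  using star4D(5)[of u a b c d e] ternD[of s "oth l r u e"] by (auto simp: val_def)

text \<open>Splitting off both pairs leaves no edge at \<open>u\<close>, so \<open>u\<close> can be
  deleted. Hence the conditions mention neither the value at \<open>u\<close> nor the side of
  \<open>u\<close>, and they have to hold only in the end, not after the first of the two
  splittings.\<close>

lemma reducible_pairing:
  assumes st: "star4 u a b c d"
    and g: "\<And>s. tern s \<Longrightarrow> s v = 1 \<Longrightarrow>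
      6 \<le> cost (rest u) l r \<sigma> s + \<bar>val u s a - val u s b\<bar> + \<bar>val u s c - val u s d\<bar>"
    and k: "\<And>K. K \<subseteq> V - {u, v} \<Longrightarrow> K \<noteq> {} \<Longrightarrow>
      4 \<le> dcut (rest u) l r K + of_bool ((oth l r u a \<in> K) \<noteq> (oth l r u b \<in> K))
        + of_bool ((oth l r u c \<in> K) \<noteq> (oth l r u d \<in> K))"
  shows reducible
proof -
  let ?o = "oth l r u"
  define E1 where "E1 = E - {b}"
  define l1 where "l1 = l(a := ?o a)"
  define r1 where "r1 = r(a := ?o b)"
  define \<sigma>1 where "\<sigma>1 = \<sigma>(a := \<sigma> a * \<sigma> b)"
  define E2 where "E2 = E1 - {d}"
  define l2 where "l2 = l1(c := ?o c)"
  define r2 where "r2 = r1(c := ?o d)"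
  define \<sigma>2 where "\<sigma>2 = \<sigma>1(c := \<sigma>1 c * \<sigma>1 d)"
  note A = star4D[OF st, of a, simplified] and B = star4D[OF st, of b, simplified]
    and C = star4D[OF st, of c, simplified] and D = star4D[OF st, of d, simplified]
  have dis: "a \<noteq> b" "a \<noteq> c" "a \<noteq> d" "b \<noteq> c" "b \<noteq> d" "c \<noteq> d" and uV: "u \<in> V" "u \<noteq> v"
    using st by (auto simp: star4_def)
  interpret r1: signed_graph V E1 l1 r1 \<sigma>1 v
    unfolding E1_def l1_def r1_def \<sigma>1_def
    by (rule signed_graph_split[OF A(1) B(1) dis(1) A(2) joins_sym[OF B(2)] uV(2)])
  have jc: "joins l1 r1 c (?o c) u" and jd: "joins l1 r1 d u (?o d)"
    using C(2) D(2) dis by (auto simp: joins_def l1_def r1_def)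
  have cdE: "c \<in> E1" "d \<in> E1" using C(1) D(1) dis by (auto simp: E1_def)
  interpret r2: signed_graph V E2 l2 r2 \<sigma>2 v
    unfolding E2_def l2_def r2_def \<sigma>2_def
    by (rule r1.signed_graph_split[OF cdE dis(6) jc jd uV(2)])
  have E2: "E2 = rest u \<union> {a, c}" using st dis by (auto simp: E2_def E1_def star4_def rest_def)
  have disj: "rest u \<inter> {a, c} = {}" using st by (auto simp: star4_def rest_def)
  have finr: "finite (rest u)" using finE by (simp add: rest_def)
  have ru: "l e \<noteq> u" "r e \<noteq> u" "e \<in> E" "e \<noteq> a" "e \<noteq> c" if "e \<in> rest u" for e
    using that disj by (auto simp: rest_def)
  have sum2: "sum h E2 = sum h (rest u) + h a + h c" for h :: "'e \<Rightarrow> int"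
    unfolding E2 using finr disj dis by (simp add: sum.union_disjoint)
  have same: "l2 e = l e" "r2 e = r e" "\<sigma>2 e = \<sigma> e" if "e \<in> rest u" for e
    using ru[OF that] by (auto simp: l2_def l1_def r2_def r1_def \<sigma>2_def \<sigma>1_def)
  have ac: "l2 a = ?o a" "r2 a = ?o b" "\<sigma>2 a = \<sigma> a * \<sigma> b" "l2 c = ?o c" "r2 c = ?o d" "\<sigma>2 c = \<sigma> c * \<sigma> d"
    using dis by (auto simp: l2_def l1_def r2_def r1_def \<sigma>2_def \<sigma>1_def)
  have "rooted_graph (V - {u}) E2 l2 r2 \<sigma>2 v"
  proof unfold_locales
    show "finite (V - {u})" "v \<in> V - {u}" using finV vV uV by auto
    show "finite E2" by (rule r2.finE)
    show "l2 e \<in> V - {u} \<and> r2 e \<in> V - {u}" if e2: "e \<in> E2" for e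
    proof -
      consider "e \<in> rest u" | "e = a" | "e = c" using e2 E2 by auto
      then show ?thesis
      proof cases
        case 1
        then show ?thesis using ru[OF 1] same[OF 1] ends by auto
      qed (use ac A B C D in auto)
    qed
    show "\<sigma>2 e = 1 \<or> \<sigma>2 e = - 1" if "e \<in> E2" for e by (rule r2.sgn[OF that])
    show "deg E2 l2 r2 v = 6" by (rule r2.deg_v)
    show "even (deg E2 l2 r2 w)" for w by (rule r2.deg_even)
    show "prod \<sigma>2 E2 = - 1" by (rule r2.odd_total)
    show "4 \<le> dcut E2 l2 r2 K" if K: "K \<subseteq> V - {u} - {v}" "K \<noteq> {}" for K
    proof -
      have "dcut E2 l2 r2 K = dcut (rest u) l r K + crosses l2 r2 K a + crosses l2 r2 K c"
        unfolding dcut_def sum2 using same by (auto simp: crosses_def intro!: sum.cong)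
      moreover have "K \<subseteq> V - {u, v}" using K(1) by auto
      ultimately show ?thesis using k[of K] K(2) by (simp add: crosses_def ac)
    qed
    show "6 \<le> cost E2 l2 r2 \<sigma>2 s" if s: "tern s" "s v = 1" for s
    proof -
      have "cost E2 l2 r2 \<sigma>2 s = cost (rest u) l r \<sigma> s + ecost l2 r2 \<sigma>2 s a + ecost l2 r2 \<sigma>2 s c"
        unfolding cost_def sum2 using same by (auto simp: ecost_def intro!: sum.cong)
      moreover have "ecost l2 r2 \<sigma>2 s a = \<bar>val u s a - val u s b\<bar>"
        using A(5) B(5) by (auto simp: ecost_def val_def ac)
      moreover have "ecost l2 r2 \<sigma>2 s c = \<bar>val u s c - val u s d\<bar>"
        using C(5) D(5) by (auto simp: ecost_def val_def ac)
      ultimately show ?thesis using g[OF s] by simp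
    qed
  qed
  moreover have "card (V - {u}) + card E2 < card V + card E"
  proof -
    have "card (V - {u}) < card V" using finV uV(1) by (rule card_Diff1_less)
    moreover have "card E2 \<le> card E" by (rule card_mono[OF finE]) (auto simp: E2_def E1_def)
    ultimately show ?thesis by linarith
  qed
  moreover have "rooted3 E l r \<sigma> v" if "rooted3 E2 l2 r2 \<sigma>2 v"
  proof -
    have "rooted3 E1 l1 r1 \<sigma>1 v"
      by (rule rooted3_split[OF r1.finE cdE dis(6) jc jd]) (use that in \<open>simp add: E2_def l2_def r2_def \<sigma>2_def\<close>)
    then show ?thesis
      unfolding E1_def l1_def r1_def \<sigma>1_def
      by (rule rooted3_split[OF finE A(1) B(1) dis(1) A(2) joins_sym[OF B(2)]])
  qed
  ultimately show ?thesis unfolding reducible_def by blast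
qed

definition cost_bad :: "'v \<Rightarrow> 'e \<Rightarrow> 'e \<Rightarrow> 'e \<Rightarrow> 'e \<Rightarrow> bool" where
  "cost_bad u a b c d \<longleftrightarrow> (\<exists>s. tern s \<and> s v = 1 \<and>
      cost (rest u) l r \<sigma> s + \<bar>val u s a - val u s b\<bar> + \<bar>val u s c - val u s d\<bar> < 6)"

definition cut_bad :: "'v \<Rightarrow> 'e \<Rightarrow> 'e \<Rightarrow> 'e \<Rightarrow> 'e \<Rightarrow> bool" where
  "cut_bad u a b c d \<longleftrightarrow> (\<exists>K. K \<subseteq> V - {u, v} \<and> K \<noteq> {} \<and>
      dcut (rest u) l r K + of_bool ((oth l r u a \<in> K) \<noteq> (oth l r u b \<in> K))
        + of_bool ((oth l r u c \<in> K) \<noteq> (oth l r u d \<in> K)) < 4)"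

text \<open>\<open>K\<close> separates \<open>a\<close>, \<open>b\<close> from \<open>c\<close>,
  \<open>d\<close>, and \<open>M\<close> separates \<open>a\<close>, \<open>c\<close> from
  \<open>b\<close>, \<open>d\<close>, each with only two edges in \<open>rest u\<close>. Then the
  intersection contains the far end of exactly one of the four edges and the union of exactly three,
  so either needs three edges in \<open>rest u\<close>; but 3 + 3 exceeds 2 + 2.\<close>

lemma two_cut_bad:
  assumes st: "star4 u a b c d" and "cut_bad u a b c d" "cut_bad u a c b d"
  shows False
proof -
  let ?o = "oth l r u"
  have uV: "u \<in> V" "u \<noteq> v" using st by (auto simp: star4_def)
  have lo: "4 \<le> dcut (rest u) l r K + of_bool ((?o a \<in> K) \<noteq> j) + of_bool ((?o b \<in> K) \<noteq> j) +
     of_bool ((?o c \<in> K) \<noteq> j) + of_bool ((?o d \<in> K) \<noteq> j)"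
    and ev: "even (dcut (rest u) l r K + of_bool ((?o a \<in> K) \<noteq> j) + of_bool ((?o b \<in> K) \<noteq> j) +
     of_bool ((?o c \<in> K) \<noteq> j) + of_bool ((?o d \<in> K) \<noteq> j))"
    if K: "K \<subseteq> V - {u, v}" "K \<noteq> {}" for K j
  proof -
    define K' where "K' = (if j then insert u K else K)"
    have o: "?o e \<in> K' \<longleftrightarrow> ?o e \<in> K" if "e \<in> {a, b, c, d}" for e
      using star4D(3)[OF st that] by (auto simp: K'_def)
    have "K' \<subseteq> V - {v}" "K' \<noteq> {}" "u \<in> K' \<longleftrightarrow> j" "K' - {u} = K" using K uV by (auto simp: K'_def)
    with cut_ge4[of K'] dcut_ev[of K'] dcut_star4[OF st, of K'] o
    show "4 \<le> dcut (rest u) l r K + of_bool ((?o a \<in> K) \<noteq> j) + of_bool ((?o b \<in> K) \<noteq> j) +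
       of_bool ((?o c \<in> K) \<noteq> j) + of_bool ((?o d \<in> K) \<noteq> j)"
      "even (dcut (rest u) l r K + of_bool ((?o a \<in> K) \<noteq> j) + of_bool ((?o b \<in> K) \<noteq> j) +
       of_bool ((?o c \<in> K) \<noteq> j) + of_bool ((?o d \<in> K) \<noteq> j))"
      by simp_all
  qed
  obtain K where K: "K \<subseteq> V - {u, v}" "K \<noteq> {}"
    "dcut (rest u) l r K + of_bool ((?o a \<in> K) \<noteq> (?o b \<in> K)) + of_bool ((?o c \<in> K) \<noteq> (?o d \<in> K)) < 4"
    using assms(2) unfolding cut_bad_def by blast
  obtain M where M: "M \<subseteq> V - {u, v}" "M \<noteq> {}"
    "dcut (rest u) l r M + of_bool ((?o a \<in> M) \<noteq> (?o c \<in> M)) + of_bool ((?o b \<in> M) \<noteq> (?o d \<in> M)) < 4"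
    using assms(3) unfolding cut_bad_def by blast
  have k: "(?o a \<in> K) = (?o b \<in> K)" "(?o c \<in> K) = (?o d \<in> K)" "(?o a \<in> K) \<noteq> (?o c \<in> K)" "dcut (rest u) l r K = 2"
    using pairing_cut[OF lo[OF K(1,2)] ev[OF K(1,2)] K(3)] by blast+
  have m0: "(?o a \<in> M) = (?o c \<in> M) \<and> (?o b \<in> M) = (?o d \<in> M) \<and> (?o a \<in> M) \<noteq> (?o b \<in> M) \<and>
      dcut (rest u) l r M = 2"
  proof (rule pairing_cut[OF _ _ M(3)])
    fix j
    have swap: "dcut (rest u) l r M + of_bool ((?o a \<in> M) \<noteq> j) + of_bool ((?o c \<in> M) \<noteq> j) +
      of_bool ((?o b \<in> M) \<noteq> j) + of_bool ((?o d \<in> M) \<noteq> j) =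
      dcut (rest u) l r M + of_bool ((?o a \<in> M) \<noteq> j) + of_bool ((?o b \<in> M) \<noteq> j) +
      of_bool ((?o c \<in> M) \<noteq> j) + of_bool ((?o d \<in> M) \<noteq> j)" by linarith
    show "4 \<le> dcut (rest u) l r M + of_bool ((?o a \<in> M) \<noteq> j) + of_bool ((?o c \<in> M) \<noteq> j) +
      of_bool ((?o b \<in> M) \<noteq> j) + of_bool ((?o d \<in> M) \<noteq> j)"
      unfolding swap by (rule lo[OF M(1,2)])
    show "even (dcut (rest u) l r M + of_bool ((?o a \<in> M) \<noteq> j) + of_bool ((?o c \<in> M) \<noteq> j) +
      of_bool ((?o b \<in> M) \<noteq> j) + of_bool ((?o d \<in> M) \<noteq> j))"
      unfolding swap by (rule ev[OF M(1,2)])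
  qed
  have m: "(?o a \<in> M) = (?o c \<in> M)" "(?o b \<in> M) = (?o d \<in> M)" "(?o a \<in> M) \<noteq> (?o b \<in> M)" "dcut (rest u) l r M = 2"
    using m0 by blast+
  have ne: "K \<inter> M \<noteq> {}" using k m by blast
  have sub: "K \<inter> M \<subseteq> V - {u, v}" "K \<union> M \<subseteq> V - {u, v}" using K M by auto
  have "3 \<le> dcut (rest u) l r (K \<inter> M)"
    using lo[OF sub(1) ne, of False] k m by (auto split: if_splits)
  moreover have "3 \<le> dcut (rest u) l r (K \<union> M)"
    using lo[OF sub(2) _, of True] K(2) k m by (auto split: if_splits)
  ultimately show False using dcut_Int_Un[of "rest u" l r K M] k(4) m(4) by simp
qed

text \<open>Meet and join both have values \<alpha>, 0, 0, -\<alpha> at the four edges. With value 0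
  at \<open>u\<close> their costs sum to at most 4 + 4 + 2 + 2 = 12, so the join is trivial,
  \<open>s\<close> and \<open>t\<close> are opposite off \<open>u\<close> and \<open>v\<close>, and
  \<open>cost_opposite\<close> finishes.\<close>

lemma crossing_pairings:
  assumes st: "star4 u a b c d" and s: "tern s" "s v = 1" and t: "tern t" "t v = 1"
    and gs: "cost (rest u) l r \<sigma> s = 4" and gt: "cost (rest u) l r \<sigma> t = 4"
    and vs: "val u s a = \<alpha>" "val u s b = \<alpha>" "val u s c = - \<alpha>" "val u s d = - \<alpha>"
    and vt: "val u t a = \<alpha>" "val u t b = - \<alpha>" "val u t c = \<alpha>" "val u t d = - \<alpha>"
    and \<alpha>: "\<alpha> \<noteq> 0"
  shows False
proof -
  have uV: "u \<in> V - {v}" using st by (auto simp: star4_def)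
  have \<alpha>1: "\<alpha> = 1 \<or> \<alpha> = - 1" using val_tern[OF st _ s(1), of a] vs(1) \<alpha> by auto
  have vm: "val u (meet s t) e = (if val u s e = val u t e then val u s e else 0)"
    and vj: "val u (join s t) e = sgn (val u s e + val u t e)" if "e \<in> {a, b, c, d}" for e
    using star4D(5)[OF st that] ternD[OF s(1), of "oth l r u e"] ternD[OF t(1), of "oth l r u e"]
    by (auto simp: val_def meet_def join_def)
  have four: "cost E l r \<sigma> (q(u := 0)) = cost (rest u) l r \<sigma> q + 2" if "q = meet s t \<or> q = join s t" for q
    using that cost_star4[OF st, of q 0] vm[of a] vm[of b] vm[of c] vm[of d]
      vj[of a] vj[of b] vj[of c] vj[of d] vs vt \<alpha>1 by auto
  have mj: "tern (meet s t)" "meet s t v = 1" "tern (join s t)" "join s t v = 1"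
    using s t tern_meet tern_join by (auto simp: meet_def join_def)
  have m0: "tern ((meet s t)(u := 0))" "((meet s t)(u := 0)) v = 1"
    and j0: "tern ((join s t)(u := 0))" "((join s t)(u := 0)) v = 1"
    using mj uV by (auto simp: tern_upd)
  have "cost (rest u) l r \<sigma> (meet s t) + cost (rest u) l r \<sigma> (join s t) \<le> cost (rest u) l r \<sigma> s + cost (rest u) l r \<sigma> t"
    by (rule cost_meet_join[OF s(1) t(1)]) (use sgn in \<open>auto simp: rest_def\<close>)
  then have jle: "\<not> 8 \<le> cost E l r \<sigma> ((join s t)(u := 0))"
    using cost_ge6[OF m0] four[OF disjI1[OF refl]] four[OF disjI2[OF refl]] gs gt by linarith
  \<comment> \<open>Values 1 and -1 make the maps opposite at \<open>u\<close> too. Two of the four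
    edges then conflict in each map, so that each costs 4 + 4.\<close>
  define s' where "s' = s(u := 1)"
  define t' where "t' = t(u := - 1)"
  have s': "tern s'" "s' v = 1" "s' u \<noteq> 0" and t': "tern t'" "t' v = 1"
    using s t uV by (auto simp: s'_def t'_def tern_upd)
  have opp': "t' w = - s' w" if w: "w \<in> V - {v}" for w
  proof (cases "w = u")
    case False
    have "((join s t)(u := 0)) w = 0" using cost_ge8[OF j0 w] jle by blast
    then show ?thesis using False by (simp add: join_def s'_def t'_def sgn_if split: if_splits)
  qed (simp add: s'_def t'_def)
  have gs': "cost E l r \<sigma> s' = 8" unfolding s'_def cost_star4[OF st] using gs vs \<alpha>1 by auto
  have gt': "cost E l r \<sigma> t' = 8" unfolding t'_def cost_star4[OF st] using gt vt \<alpha>1 by auto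
  \<comment> \<open>\<open>cost_opposite\<close> needs a conflict on an edge that avoids
    \<open>v\<close>. On \<open>b\<close> and \<open>c\<close> the maps differ, so the far end is
    not \<open>v\<close>, where both are 1; one of these edges conflicts with the value 1 at
    \<open>u\<close>.\<close>
  have "\<exists>e. e \<in> {b, c} \<and> val u s e = - 1" using vs \<alpha>1 by auto
  then obtain e where e: "e \<in> {a, b, c, d}" "e \<in> {b, c}" "val u s e = - 1" by auto
  note D = star4D[OF st e(1)]
  have "val u s e \<noteq> val u t e" using e(2) vs vt \<alpha> by auto
  then have "oth l r u e \<noteq> v" using s(2) t(2) by (auto simp: val_def)
  then have "l e \<noteq> v" "r e \<noteq> v" using D(2) uV by (auto simp: joins_def)
  moreover have "ecost l r \<sigma> s' e = 2"
    using ecost_joins[where \<sigma>=\<sigma>, OF D(2,5)] e(3) D(3) by (simp add: s'_def val_def)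
  ultimately have "18 \<le> cost E l r \<sigma> s' + cost E l r \<sigma> t'"
    by (intro cost_opposite[OF s'(1,2) t' opp' uV s'(3) D(1)]) auto
  with gs' gt' show False by simp
qed

lemma star4_swap: "star4 u a b c d \<Longrightarrow> star4 u b a d c"
  by (auto simp: star4_def)

text \<open>A blocking map with support beyond \<open>u\<close> and \<open>v\<close> has the pattern
  of \<open>pairing_nontrivial\<close>, and two such patterns are excluded by
  \<open>crossing_pairings\<close>. A map without such support sees nonzero values only through
  edges to \<open>v\<close>, where the other map has the same value; thus its separated pairs carry
  over and contradict the pattern of the other map.\<close>

lemma two_cost_bad:
  assumes st: "star4 u a b c d" and "cost_bad u a b c d" "cost_bad u a c b d"
  shows False
proof -
  have uV: "u \<in> V - {v}" using st by (auto simp: star4_def)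
  have lo6: "6 \<le> cost (rest u) l r \<sigma> s + \<bar>val u s a - k\<bar> + \<bar>val u s b - k\<bar> + \<bar>val u s c - k\<bar> + \<bar>val u s d - k\<bar>"
    if "tern s" "s v = 1" "k \<in> {- 1, 0, 1}" for s k
    unfolding cost_star4[OF st, symmetric] by (rule cost_ge6) (use that uV in \<open>auto simp: tern_upd\<close>)
  have lo8: "8 \<le> cost (rest u) l r \<sigma> s + \<bar>val u s a - k\<bar> + \<bar>val u s b - k\<bar> + \<bar>val u s c - k\<bar> + \<bar>val u s d - k\<bar>"
    if "tern s" "s v = 1" "k \<in> {- 1, 0, 1}" "w \<in> V - {u, v}" "s w \<noteq> 0" for s k w
    unfolding cost_star4[OF st, symmetric] by (rule cost_ge8[of _ w]) (use that uV in \<open>auto simp: tern_upd\<close>)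
  have par: "even (cost (rest u) l r \<sigma> s + \<bar>val u s a\<bar> + \<bar>val u s b\<bar> + \<bar>val u s c\<bar> + \<bar>val u s d\<bar>)" for s
    using cost_star4[OF st, of s 0] cost_ev[of "s(u := 0)"] by simp
  obtain s where s: "tern s" "s v = 1"
    "cost (rest u) l r \<sigma> s + \<bar>val u s a - val u s b\<bar> + \<bar>val u s c - val u s d\<bar> < 6"
    using assms(2) unfolding cost_bad_def by blast
  obtain t where t: "tern t" "t v = 1"
    "cost (rest u) l r \<sigma> t + \<bar>val u t a - val u t c\<bar> + \<bar>val u t b - val u t d\<bar> < 6"
    using assms(3) unfolding cost_bad_def by blast
  have vs: "val u s a \<in> {- 1, 0, 1}" "val u s b \<in> {- 1, 0, 1}" "val u s c \<in> {- 1, 0, 1}" "val u s d \<in> {- 1, 0, 1}"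
    and vt: "val u t a \<in> {- 1, 0, 1}" "val u t b \<in> {- 1, 0, 1}" "val u t c \<in> {- 1, 0, 1}" "val u t d \<in> {- 1, 0, 1}"
    using val_tern[OF st _ s(1)] val_tern[OF st _ t(1)] by simp_all
  have pe: "even (\<bar>x\<bar> + \<bar>y\<bar> + \<bar>z\<bar> + \<bar>w\<bar> - (\<bar>x - y\<bar> + \<bar>z - w\<bar>))" for x y z w :: int
    by (cases "even x"; cases "even y"; cases "even z"; cases "even w"; simp)
  have even_lt6: "even m \<Longrightarrow> m < 6 \<Longrightarrow> m \<le> 4" for m :: int by presburger
  have s4: "cost (rest u) l r \<sigma> s + \<bar>val u s a - val u s b\<bar> + \<bar>val u s c - val u s d\<bar> \<le> 4"
    using dvd_diff[OF par[of s] pe[of "val u s a" "val u s b" "val u s c" "val u s d"]]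
    by (intro even_lt6[OF _ s(3)]) (simp add: algebra_simps)
  have t4: "cost (rest u) l r \<sigma> t + \<bar>val u t a - val u t c\<bar> + \<bar>val u t b - val u t d\<bar> \<le> 4"
    using dvd_diff[OF par[of t] pe[of "val u t a" "val u t c" "val u t b" "val u t d"]]
    by (intro even_lt6[OF _ t(3)]) (simp add: algebra_simps)
  have vv: "val u s e = \<sigma> e" "val u t e = \<sigma> e" if "e \<in> {a, b, c, d}" "oth l r u e = v" for e
    using that s t by (auto simp: val_def)
  have triv: "oth l r u e = v" if "e \<in> {a, b, c, d}" "val u q e \<noteq> 0" "\<forall>w\<in>V - {u, v}. q w = 0" for e q
    using that star4D(3,4)[OF st that(1)] by (auto simp: val_def)
  have trivial_s: "max (val u s a) (val u s b) < min (val u s c) (val u s d) \<or>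
      max (val u s c) (val u s d) < min (val u s a) (val u s b)"
    by (rule pairing_trivial[OF vs lo6[OF s(1,2)] s4])
  have trivial_t: "max (val u t a) (val u t c) < min (val u t b) (val u t d) \<or>
      max (val u t b) (val u t d) < min (val u t a) (val u t c)"
  proof (rule pairing_trivial[OF vt(1,3,2,4) _ t4])
    fix k :: int assume "k \<in> {- 1, 0, 1}"
    from lo6[OF t(1,2) this] show "6 \<le> cost (rest u) l r \<sigma> t + \<bar>val u t a - k\<bar> + \<bar>val u t c - k\<bar> + \<bar>val u t b - k\<bar> + \<bar>val u t d - k\<bar>"
      by simp
  qed
  have nt_s: "cost (rest u) l r \<sigma> s = 4 \<and> val u s a \<noteq> 0 \<and> val u s b = val u s a \<and> val u s c = - val u s a \<and> val u s d = - val u s a"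
    if "\<exists>w\<in>V - {u, v}. s w \<noteq> 0"
    using that by (intro pairing_nontrivial[OF vs _ s4]) (use lo8[OF s(1,2)] in blast)
  have nt_t: "cost (rest u) l r \<sigma> t = 4 \<and> val u t a \<noteq> 0 \<and> val u t c = val u t a \<and> val u t b = - val u t a \<and> val u t d = - val u t a"
    if "\<exists>w\<in>V - {u, v}. t w \<noteq> 0"
  proof (rule pairing_nontrivial[OF vt(1,3,2,4) _ t4])
    fix k :: int assume "k \<in> {- 1, 0, 1}"
    with lo8[OF t(1,2) this] that
    show "8 \<le> cost (rest u) l r \<sigma> t + \<bar>val u t a - k\<bar> + \<bar>val u t c - k\<bar> + \<bar>val u t b - k\<bar> + \<bar>val u t d - k\<bar>"
      by (auto simp: add.commute add.left_commute)
  qed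
  show False
  proof (cases "\<exists>w\<in>V - {u, v}. s w \<noteq> 0")
    case True
    note S = nt_s[OF this]
    show False
    proof (cases "\<exists>w\<in>V - {u, v}. t w \<noteq> 0")
      case True
      note T = nt_t[OF this]
      show False
      proof (cases "val u t a = val u s a")
        case True
        with S T show False
          by (intro crossing_pairings[OF st s(1,2) t(1,2), of "val u s a"]) auto
      next
        case False
        then have "val u t a = - val u s a" using vs(1) vt(1) S T by auto
        with S T show False
          by (intro crossing_pairings[OF star4_swap[OF st] s(1,2) t(1,2), of "val u s a"]) auto
      qed
    next
      case False
      then have f: "\<forall>w\<in>V - {u, v}. t w = 0" by blast
      have eq: "val u s e = val u t e" if "e \<in> {a, b, c, d}" "val u t e \<noteq> 0" for e
        using vv[OF that(1) triv[OF that f]] by simp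
      have "val u t a = val u t c \<and> val u t a \<noteq> 0 \<or> val u t b = val u t d \<and> val u t b \<noteq> 0"
        by (rule separated_pairs[OF vt(1,3,2,4) trivial_t])
      then have "val u s a = val u s c \<or> val u s b = val u s d"
        using eq[of a] eq[of b] eq[of c] eq[of d] by force
      then show False using S by auto
    qed
  next
    case False
    then have f: "\<forall>w\<in>V - {u, v}. s w = 0" by blast
    have eq: "val u s e = val u t e" if "e \<in> {a, b, c, d}" "val u s e \<noteq> 0" for e
      using vv[OF that(1) triv[OF that f]] by simp
    show False
    proof (cases "\<exists>w\<in>V - {u, v}. t w \<noteq> 0")
      case True
      note T = nt_t[OF this]
      have "val u s a = val u s b \<and> val u s a \<noteq> 0 \<or> val u s c = val u s d \<and> val u s c \<noteq> 0"
        by (rule separated_pairs[OF vs trivial_s])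
      then have "val u t a = val u t b \<or> val u t c = val u t d"
        using eq[of a] eq[of b] eq[of c] eq[of d] by force
      then show False using T by auto
    next
      case False
      then have f': "\<forall>w\<in>V - {u, v}. t w = 0" by blast
      have "val u s e = val u t e" if e: "e \<in> {a, b, c, d}" for e
      proof (cases "val u t e = 0")
        case True
        then show ?thesis using eq[OF e] by (cases "val u s e = 0") simp_all
      next
        case False
        then show ?thesis using vv[OF e triv[OF e False f']] by simp
      qed
      then have "val u t a = val u s a" "val u t b = val u s b" "val u t c = val u s c" "val u t d = val u s d"
        by simp_all
      with trivial_s trivial_t show False by linarith
    qed
  qed
qed

lemma cost_bad_commute: "cost_bad u a b c d = cost_bad u a b d c" "cost_bad u a b c d = cost_bad u c d a b"
  unfolding cost_bad_def by (simp_all add: abs_minus_commute add.commute add.left_commute)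

lemma cut_bad_commute: "cut_bad u a b c d = cut_bad u a b d c" "cut_bad u a b c d = cut_bad u c d a b"
  unfolding cut_bad_def by (auto simp: add.commute add.left_commute eq_commute)

text \<open>Pigeonhole: there are three pairings but two kinds of obstruction, and each kind blocks
  at most one pairing.\<close>

lemma reducible_star4:
  assumes st: "star4 u a b c d"
  shows reducible
proof (rule ccontr)
  assume nr: "\<not> reducible"
  have bad: "cost_bad u p q x y \<or> cut_bad u p q x y" if "star4 u p q x y" for p q x y
  proof (rule ccontr)
    assume "\<not> ?thesis"
    then have ng: "\<not> cost_bad u p q x y" and nd: "\<not> cut_bad u p q x y" by auto
    have reducible
    proof (rule reducible_pairing[OF that]; rule leI; rule notI)
      fix s assume "tern s" "s v = 1" "cost (rest u) l r \<sigma> s + \<bar>val u s p - val u s q\<bar> + \<bar>val u s x - val u s y\<bar> < 6"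
      then have "cost_bad u p q x y" unfolding cost_bad_def by (intro exI[of _ s] conjI)
      with ng show False ..
    next
      fix K assume "K \<subseteq> V - {u, v}" "K \<noteq> {}"
        "dcut (rest u) l r K + of_bool ((oth l r u p \<in> K) \<noteq> (oth l r u q \<in> K))
        + of_bool ((oth l r u x \<in> K) \<noteq> (oth l r u y \<in> K)) < 4"
      then have "cut_bad u p q x y" unfolding cut_bad_def by (intro exI[of _ K] conjI)
      with nd show False ..
    qed
    with nr show False ..
  qed
  have st2: "star4 u a c b d" "star4 u a d b c" "star4 u a b d c" "star4 u a c d b" using st by (auto simp: star4_def)
  have "\<not> (cost_bad u a b c d \<and> cost_bad u a c b d)" "\<not> (cut_bad u a b c d \<and> cut_bad u a c b d)"
    using two_cost_bad[OF st] two_cut_bad[OF st] by blast+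
  moreover have "\<not> (cost_bad u a b c d \<and> cost_bad u a d b c)" "\<not> (cut_bad u a b c d \<and> cut_bad u a d b c)"
    using two_cost_bad[OF st2(3)] two_cut_bad[OF st2(3)] cost_bad_commute(1)[of u a b c d] cut_bad_commute(1)[of u a b c d] by blast+
  moreover have "\<not> (cost_bad u a c b d \<and> cost_bad u a d b c)" "\<not> (cut_bad u a c b d \<and> cut_bad u a d b c)"
    using two_cost_bad[OF st2(4)] two_cut_bad[OF st2(4)] cost_bad_commute(1)[of u a c b d] cut_bad_commute(1)[of u a c b d]
      cost_bad_commute(1)[of u a d b c] cut_bad_commute(1)[of u a d b c] by blast+
  ultimately show False using bad[OF st] bad[OF st2(1)] bad[OF st2(2)] by blast
qed

text \<open>Both full maps cost at least 10, being at least 8 and 2 modulo 4. Without a loop at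
  \<open>u\<close> every edge meets \<open>v\<close>, and the six ends there allow a total of only
  12.\<close>

lemma two_vertices_loop:
  assumes V: "V = {u, v}" "u \<noteq> v"
  shows "\<exists>f\<in>E. l f = u \<and> r f = u"
proof (rule ccontr)
  assume n: "\<not> ?thesis"
  define s where "s w = (if w = v then 1 else if w = u then 1 else 0 :: int)" for w
  define t where "t w = (if w = v then 1 else if w = u then - 1 else 0 :: int)" for w
  have st: "tern s" "s v = 1" "tern t" "t v = 1" "s u \<noteq> 0" "t u \<noteq> 0"
    using V by (auto simp: tern_def s_def t_def)
  have u: "u \<in> V - {v}" using V by auto
  have "cost E l r \<sigma> s mod 4 = 2" by (rule cost_full[OF st(1,2)]) (auto simp: V s_def)
  moreover have "cost E l r \<sigma> t mod 4 = 2" by (rule cost_full[OF st(3,4)]) (auto simp: V t_def)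
  moreover have "8 \<le> cost E l r \<sigma> s" "8 \<le> cost E l r \<sigma> t"
    using cost_ge8[OF st(1,2) u st(5)] cost_ge8[OF st(3,4) u st(6)] by auto
  ultimately have "20 \<le> cost E l r \<sigma> s + cost E l r \<sigma> t" by presburger
  also have "\<dots> \<le> (\<Sum>e\<in>E. 2 * (of_bool (l e = v) + of_bool (r e = v)))"
    unfolding cost_def sum.distrib[symmetric]
  proof (rule sum_mono)
    fix e assume e: "e \<in> E"
    have "l e = u \<or> l e = v" "r e = u \<or> r e = v" "\<not> (l e = u \<and> r e = u)" using ends[OF e] V n e by auto
    then show "ecost l r \<sigma> s e + ecost l r \<sigma> t e \<le> 2 * (of_bool (l e = v) + of_bool (r e = v))"
      using sgn[OF e] V(2) by (auto simp: ecost_def s_def t_def)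
  qed
  also have "\<dots> = 12" using sum_darts_v by (simp only: sum_distrib_left[symmetric])
  finally show False by simp
qed

section \<open>Existence of a reduction and the main induction\<close>

lemma dcut_compl_v: "dcut E l r (V - {v}) \<le> 6"
  unfolding dcut_def sum_darts_v[symmetric] by (rule sum_mono) (use ends in \<open>auto simp: crosses_def\<close>)

lemma reducible_even_loop:
  assumes f: "f \<in> E" "l f = r f" "l f \<noteq> v" "\<sigma> f = 1"
  shows reducible
proof -
  have "rooted_graph V (E - {f}) l r \<sigma> v"
  proof unfold_locales
    show "deg (E - {f}) l r v = 6" using deg_remove[OF finE f(1), of l r v] deg_v f by simp
    show "even (deg (E - {f}) l r w)" for w using deg_remove[OF finE f(1), of l r w] deg_even[of w] f(2) by auto
    show "prod \<sigma> (E - {f}) = - 1" using prod.remove[OF finE f(1), of \<sigma>] odd_total f(4) by simp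
    show "4 \<le> dcut (E - {f}) l r K" if "K \<subseteq> V - {v}" "K \<noteq> {}" for K
    proof -
      have "dcut E l r K = crosses l r K f + dcut (E - {f}) l r K"
        unfolding dcut_def by (rule sum.remove[OF finE f(1)])
      then show ?thesis using cut_ge4[OF that] f(2) by (simp add: crosses_def)
    qed
    show "6 \<le> cost (E - {f}) l r \<sigma> s" if "tern s" "s v = 1" for s
    proof -
      have "cost E l r \<sigma> s = ecost l r \<sigma> s f + cost (E - {f}) l r \<sigma> s"
        unfolding cost_def by (rule sum.remove[OF finE f(1)])
      then show ?thesis using cost_ge6[OF that] f(2,4) by (simp add: ecost_def)
    qed
  qed (use finV finE vV ends sgn in auto)
  moreover have "card V + card (E - {f}) < card V + card E"
    using card_Diff1_less[OF finE f(1)] by linarith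
  moreover have "rooted3 E l r \<sigma> v" if "rooted3 (E - {f}) l r \<sigma> v"
    by (rule rooted3_even_loop[OF finE f(1,2,4) conn_E that])
  ultimately show ?thesis unfolding reducible_def by blast
qed

lemma reducible:
  assumes "V \<noteq> {v}"
  shows reducible
proof -
  define \<K> where "\<K> K \<longleftrightarrow> K \<subseteq> V - {v} \<and> K \<noteq> {} \<and> (dcut E l r K = 4 \<or> K = V - {v})" for K
  have "\<K> (V - {v})" using assms vV by (auto simp: \<K>_def)
  then obtain K where K: "\<K> K" and Kmin: "\<And>M. \<K> M \<Longrightarrow> card K \<le> card M"
    using ex_has_least_nat[of \<K> _ card] by blast
  have KV: "K \<subseteq> V - {v}" "K \<noteq> {}" using K by (auto simp: \<K>_def)
  have finK: "finite K" using KV finV finite_subset by blast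
  have dK6: "dcut E l r K \<le> 6" using K dcut_compl_v by (auto simp: \<K>_def)
  \<comment> \<open>If \<open>M\<close> crossed \<open>K\<close>, minimality would give the
    intersection a cut of at least 6; with 4 for the union this exceeds the 4 + 4 of
    submodularity.\<close>
  have star: "K \<subseteq> M \<or> K \<inter> M = {}" if M: "M \<subseteq> V - {v}" "M \<noteq> {}" "dcut E l r M = 4" for M
  proof (rule ccontr)
    assume n: "\<not> ?thesis"
    then have KM: "K \<inter> M \<subseteq> V - {v}" "K \<inter> M \<noteq> {}" "K \<inter> M \<subset> K" "K \<union> M \<subseteq> V - {v}" "K \<union> M \<noteq> {}"
      using KV M by auto
    then have "card (K \<inter> M) < card K" using finK psubset_card_mono by blast
    then have "\<not> \<K> (K \<inter> M)" using Kmin by force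
    then have "dcut E l r (K \<inter> M) \<noteq> 4" using KM by (auto simp: \<K>_def)
    with cut_ge4[OF KM(1,2)] dcut_ev[of "K \<inter> M"] have "6 \<le> dcut E l r (K \<inter> M)" by presburger
    moreover have "dcut E l r K = 4"
    proof -
      have "\<K> M" using M by (auto simp: \<K>_def)
      have "K \<noteq> V - {v}"
      proof
        assume "K = V - {v}"
        then have "M \<subseteq> K" using M by simp
        then have "M = K" using Kmin[OF \<open>\<K> M\<close>] card_seteq[OF finK] by blast
        with n show False by simp
      qed
      then show ?thesis using K by (auto simp: \<K>_def)
    qed
    ultimately show False using dcut_Int_Un[of E l r K M] cut_ge4[OF KM(4,5)] M(3) by simp
  qed
  obtain u where u: "u \<in> K" using KV by auto
  have uV: "u \<in> V - {v}" using u KV by auto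
  show ?thesis
  proof (cases "K = {u}")
    case False
    \<comment> \<open>Otherwise the cuts of \<open>{u}\<close> and of the rest of \<open>K\<close>
      would add up to at least 8 edges in the cut of \<open>K\<close>.\<close>
    have "\<exists>e\<in>E. \<exists>x\<in>K. joins l r e x u \<and> x \<noteq> u"
    proof (rule ccontr)
      assume n: "\<not> ?thesis"
      have "dcut E l r {u} + dcut E l r (K - {u}) \<le> dcut E l r K"
        unfolding dcut_def sum.distrib[symmetric]
      proof (rule sum_mono)
        fix e assume "e \<in> E"
        with n show "crosses l r {u} e + crosses l r (K - {u}) e \<le> crosses l r K e"
          using u by (auto simp: crosses_def joins_def)
      qed
      moreover have "4 \<le> dcut E l r {u}" "4 \<le> dcut E l r (K - {u})"
        using uV KV False u by (auto intro!: cut_ge4)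
      ultimately show False using dK6 by simp
    qed
    then obtain e x where "e \<in> E" "x \<in> K" "joins l r e x u" "x \<noteq> u" by blast
    then show ?thesis using reducible_inner_edge[OF KV(1) u, of x e] star by blast
  next
    case True
    then have d4: "V = {u, v} \<or> dcut E l r {u} = 4" using K vV by (auto simp: \<K>_def)
    show ?thesis
    proof (cases "\<exists>f\<in>E. l f = u \<and> r f = u")
      case True
      then obtain f where f: "f \<in> E" "l f = u" "r f = u" by blast
      then show ?thesis
        using sgn[OF f(1)] reducible_odd_loop[OF uV d4 f] reducible_even_loop[OF f(1)] uV by auto
    next
      case False
      then have du: "dcut E l r {u} = 4" using d4 two_vertices_loop uV by blast
      have "dcut E l r {u} = int (card {e \<in> E. l e = u \<or> r e = u})"
      proof -
        have "dcut E l r {u} = (\<Sum>e\<in>E. of_bool (l e = u \<or> r e = u))"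
          unfolding dcut_def by (rule sum.cong) (use False in \<open>auto simp: crosses_def\<close>)
        also have "\<dots> = int (card (E \<inter> {e. l e = u \<or> r e = u}))" by (rule sum_of_bool_eq) (rule finE)+
        finally show ?thesis by (simp add: Int_def)
      qed
      then have "card {e \<in> E. l e = u \<or> r e = u} = 4" using du by simp
      then obtain a b c d where "{e \<in> E. l e = u \<or> r e = u} = {a, b, c, d}" "distinct [a, b, c, d]"
        by (auto simp: card_Suc_eq numeral_eq_Suc)
      then have "star4 u a b c d" using False uV by (auto simp: star4_def)
      then show ?thesis by (rule reducible_star4)
    qed
  qed
qed

end

text \<open>The induction runs over all signed graphs because splitting and switching create
  arbitrary signs. In the base case the six ends at \<open>v\<close> form three loops, and the cost
  bound makes each of them negative and hence a part of its own.\<close>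

theorem rooted_graph_rooted3:
  assumes "rooted_graph V E l r \<sigma> v"
  shows "rooted3 E l r \<sigma> v"
  using assms
proof (induction "card V + card E" arbitrary: V E l r \<sigma> rule: less_induct)
  case less
  interpret rooted_graph V E l r \<sigma> v by (rule less.prems)
  show ?case
  proof (cases "\<exists>s w. tern s \<and> s v = 1 \<and> w \<in> V - {v} \<and> s w \<noteq> 0 \<and> cost E l r \<sigma> s = 6")
    case True
    then obtain s w where s: "tern s" "s v = 1" "w \<in> V - {v}" "s w \<noteq> 0" "cost E l r \<sigma> s = 6" by blast
    define X where "X = {w \<in> V. s w \<noteq> 0}"
    show ?thesis
    proof (rule contract_tight[OF s(1,2,5) X_def])
      fix E' l' r' \<sigma>' assume E': "E' \<subseteq> E" "rooted_graph (insert v (V - X)) E' l' r' \<sigma>' v"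
      have "insert v (V - X) \<subset> V" using s vV by (auto simp: X_def)
      then have "card (insert v (V - X)) < card V" using finV psubset_card_mono by blast
      moreover have "card E' \<le> card E" using E'(1) finE card_mono by blast
      ultimately show "rooted3 E' l' r' \<sigma>' v" using less.hyps[OF _ E'(2)] by simp
    qed
  next
    case False
    show ?thesis
    proof (cases "V = {v}")
      case True
      have loop: "l e = v" "r e = v" if "e \<in> E" for e using ends[OF that] True by auto
      have "deg E l r v = 2 * int (card E)"
        using loop by (simp add: deg_def)
      then have "card E = 3" using deg_v by simp
      then obtain h where h: "bij_betw h {..<3::nat} E"
        using ex_bij_betw_nat_finite[OF finE] by (auto simp: atLeast0LessThan)
      define d where "d w = (if w = v then 1 else 0 :: int)" for w
      have le: "ecost l r \<sigma> d e \<le> 2" if "e \<in> E" for e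
        using sgn[OF that] loop[OF that] by (auto simp: ecost_def d_def)
      have "6 \<le> cost E l r \<sigma> d" by (rule cost_ge6) (auto simp: tern_def d_def)
      moreover have "cost E l r \<sigma> d \<le> (\<Sum>e\<in>E. 2)" unfolding cost_def by (rule sum_mono[OF le])
      ultimately have "cost E l r \<sigma> d = (\<Sum>e\<in>E. 2)" using \<open>card E = 3\<close> by simp
      then have eq: "ecost l r \<sigma> d e = 2" if "e \<in> E" for e
        using sum_mono_inv[OF _ le that finE] by (simp add: cost_def)
      have m1: "\<sigma> e = - 1" if "e \<in> E" for e
        using eq[OF that] sgn[OF that] loop[OF that] by (auto simp: ecost_def d_def)
      have hE: "h i \<in> E" if "i < 3" for i using h that by (auto simp: bij_betw_def)
      have "odd_part {h i} l r \<sigma> v" if "i < 3" for i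
        using loop[OF hE[OF that]] m1[OF hE[OF that]] by (auto simp: odd_part_def deg_def conn_def)
      moreover have "(\<Union>i<3. {h i}) = E" using h by (auto simp: bij_betw_def)
      moreover have "disjoint_family_on (\<lambda>i. {h i}) {..<3}"
        using h by (auto simp: disjoint_family_on_def bij_betw_def inj_on_def)
      ultimately show ?thesis unfolding rooted3_def by (intro exI[of _ "\<lambda>i. {h i}"]) simp
    next
      case V: False
      have "8 \<le> cost E l r \<sigma> s" if "tern s" "s v = 1" "w \<in> V - {v}" "s w \<noteq> 0" for s w
      proof -
        have "cost E l r \<sigma> s \<noteq> 6" using False that by blast
        with cost_ge6[OF that(1,2)] cost_ev[of s] show ?thesis by presburger
      qed
      then interpret untight_graph V E l r \<sigma> v by unfold_locales
      from reducible[OF V] show ?thesis unfolding reducible_def using less.hyps by blast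
    qed
  qed
qed

section \<open>Six-regular graphs of odd order\<close>

abbreviation neg :: "'e \<Rightarrow> int" where
  "neg \<equiv> \<lambda>_. - 1"

lemma cost_uminus: "cost E l r \<sigma> (\<lambda>w. - s w) = cost E l r \<sigma> s"
  unfolding cost_def ecost_def by (rule sum.cong) (auto simp: abs_if)

lemma prod_neg: "prod neg F = - 1 \<longleftrightarrow> odd (card F)"
  by (cases "even (card F)") simp_all

locale six_regular =
  fixes V :: "'v set" and E :: "'e set" and l r :: "'e \<Rightarrow> 'v"
  assumes finV: "finite V" and finE: "finite E"
    and ends: "e \<in> E \<Longrightarrow> l e \<in> V \<and> r e \<in> V"
    and deg6: "w \<in> V \<Longrightarrow> deg E l r w = 6"
    and odd_order: "odd (card V)"
    and cut_pos: "K \<subseteq> V \<Longrightarrow> K \<noteq> {} \<Longrightarrow> K \<noteq> V \<Longrightarrow> 0 < dcut E l r K"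
begin

lemma deg_even: "even (deg E l r w)"
proof (cases "w \<in> V")
  case False
  then have "deg E l r w = 0" unfolding deg_def by (intro sum.neutral) (use ends in auto)
  then show ?thesis by simp
qed (simp add: deg6)

lemma dcut_ev: "even (dcut E l r K)"
  by (rule dcut_even[OF finE deg_even])

lemma card_darts:
  assumes "X \<subseteq> V"
  shows "6 * int (card X) = (\<Sum>e\<in>E. of_bool (l e \<in> X) + of_bool (r e \<in> X))"
proof -
  have "(\<Sum>e\<in>E. of_bool (l e \<in> X) + of_bool (r e \<in> X)) = (\<Sum>w\<in>V. deg E l r w * of_bool (w \<in> X))"
    by (rule sum_deg[OF finE finV ends, symmetric])
  also have "\<dots> = (\<Sum>w\<in>X. 6)"
    by (rule sum.mono_neutral_cong_right) (use finV assms deg6 in auto)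
  finally show ?thesis by simp
qed

lemma odd_edges: "odd (card E)"
proof -
  have "6 * int (card V) = (\<Sum>e\<in>E. 2)"
    unfolding card_darts[OF order_refl] by (rule sum.cong) (use ends in auto)
  then have "card E = 3 * card V" by simp
  then show ?thesis using odd_order by simp
qed

text \<open>Costs are even, so a cost of at most 4 is a violation of the bound 6. It is a violation
  for every vertex of \<open>X\<close> at once, since negating \<open>s\<close> keeps the
  cost.\<close>

definition bad :: "'v set \<Rightarrow> ('v \<Rightarrow> int) \<Rightarrow> bool" where
  "bad X s \<longleftrightarrow> tern s \<and> cost E l r neg s \<le> 4 \<and> X = {w \<in> V. s w \<noteq> 0} \<and> X \<noteq> {}"

text \<open>By regularity six times the sum of all values is at most the cost in absolute value. A
  cost of at most 4 forces the sum 0, hence equally many values 1 and -1.\<close>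

lemma bad_even:
  assumes "bad X s"
  shows "even (card X)"
proof -
  have s: "tern s" "cost E l r neg s \<le> 4" and X: "X = {w \<in> V. s w \<noteq> 0}" using assms by (auto simp: bad_def)
  have "6 * (\<Sum>w\<in>V. s w) = (\<Sum>w\<in>V. deg E l r w * s w)"
    by (simp add: sum_distrib_left deg6)
  also have "\<dots> = (\<Sum>e\<in>E. s (l e) + s (r e))" by (rule sum_deg[OF finE finV ends])
  finally have "\<bar>6 * (\<Sum>w\<in>V. s w)\<bar> \<le> (\<Sum>e\<in>E. \<bar>s (l e) + s (r e)\<bar>)" by (simp add: sum_abs)
  also have "\<dots> = cost E l r neg s" by (simp add: cost_def ecost_def)
  finally have z: "(\<Sum>w\<in>V. s w) = 0" using s(2) by simp
  have "int (card X) = (\<Sum>w\<in>V. of_bool (s w \<noteq> 0))"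
    using finV by (simp add: X Int_def)
  then have "int (card X) = (\<Sum>w\<in>V. of_bool (s w \<noteq> 0) - s w)" using z by (simp add: sum_subtractf)
  moreover have "even (\<Sum>w\<in>V. of_bool (s w \<noteq> 0) - s w)"
  proof (rule dvd_sum)
    fix w show "even (of_bool (s w \<noteq> 0) - s w)" using s(1) by (auto simp: tern_def dest: spec[of _ w])
  qed
  ultimately show ?thesis by (metis even_of_nat)
qed

end

section \<open>Violating sets when every cut has at least four edges\<close>

locale six_regular_cut4 = six_regular +
  assumes cut4: "K \<subseteq> V \<Longrightarrow> K \<noteq> {} \<Longrightarrow> K \<noteq> V \<Longrightarrow> 4 \<le> dcut E l r K"
begin

text \<open>\<open>X\<close> is even and the order odd, so \<open>X\<close> is a proper subset with
  a cut of at least 4. The cut is at most the cost, edge by edge, and the cost is at most 4; so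
  equality holds at every edge, and edges inside \<open>X\<close> cost nothing.\<close>

lemma bad_tight:
  assumes "bad X s"
  shows "X \<subset> V" "dcut E l r X = 4" "cost E l r neg s = 4" "e \<in> E \<Longrightarrow> ecost l r neg s e = crosses l r X e"
proof -
  have s: "tern s" "cost E l r neg s \<le> 4" and X: "X = {w \<in> V. s w \<noteq> 0}" "X \<noteq> {}" using assms by (auto simp: bad_def)
  show XV: "X \<subset> V" using bad_even[OF assms] odd_order X by auto
  have le: "crosses l r X e \<le> ecost l r neg s e" if "e \<in> E" for e
    using ends[OF that] by (auto simp: crosses_def ecost_def X)
  have "dcut E l r X \<le> cost E l r neg s" unfolding dcut_def cost_def by (rule sum_mono[OF le])
  moreover have "4 \<le> dcut E l r X" using cut4[of X] XV X(2) by auto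
  ultimately show "dcut E l r X = 4" "cost E l r neg s = 4" using s(2) by auto
  then have "(\<Sum>e\<in>E. crosses l r X e) = (\<Sum>e\<in>E. ecost l r neg s e)" by (simp add: dcut_def cost_def)
  from sum_mono_inv[OF this le _ finE] show "e \<in> E \<Longrightarrow> ecost l r neg s e = crosses l r X e" by simp
qed

text \<open>Agreement at \<open>w\<close> makes both supports nonempty, so neither cost is below 4,
  while their sum is at most 8.\<close>

lemma bad_meet_join:
  assumes "tern s" "tern t" "cost E l r neg s \<le> 4" "cost E l r neg t \<le> 4" "w \<in> V" "s w = t w" "s w \<noteq> 0"
  shows "bad {w \<in> V. meet s t w \<noteq> 0} (meet s t)" "bad {w \<in> V. join s t w \<noteq> 0} (join s t)"
proof -
  have mj: "cost E l r neg (meet s t) + cost E l r neg (join s t) \<le> 8"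
    using cost_meet_join[OF assms(1,2), of E neg l r] assms(3,4) by simp
  have tr: "tern (meet s t)" "tern (join s t)" by (simp_all add: assms tern_meet tern_join)
  have nz: "meet s t w \<noteq> 0" "join s t w \<noteq> 0" using assms(6,7) by (auto simp: meet_def join_def sgn_if)
  have four: "4 \<le> cost E l r neg q" if "tern q" "q w \<noteq> 0" for q
  proof (rule ccontr)
    assume "\<not> 4 \<le> cost E l r neg q"
    then have "bad {w \<in> V. q w \<noteq> 0} q" using that assms(5) by (auto simp: bad_def)
    from bad_tight(3)[OF this] \<open>\<not> 4 \<le> cost E l r neg q\<close> show False by simp
  qed
  show "bad {w \<in> V. meet s t w \<noteq> 0} (meet s t)" "bad {w \<in> V. join s t w \<noteq> 0} (join s t)"
    using mj four[OF tr(1) nz(1)] four[OF tr(2) nz(2)] tr nz assms(5) by (auto simp: bad_def)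
qed

text \<open>Without conflicts the join has support \<open>X \<union> Y\<close>. Otherwise the set
  \<open>A\<close> of agreement and the set \<open>C\<close> of conflict are both supports of bad
  maps, and no edge joins them, since edges inside \<open>X\<close> or inside \<open>Y\<close> cost
  nothing. So the intersection has a cut of 8, which leaves 0 for the union; then the union is
  \<open>V\<close>, and counting makes the order even.\<close>

lemma bad_Un:
  assumes "bad X s" "bad Y t0" "X \<inter> Y \<noteq> {}"
  shows "\<exists>q. bad (X \<union> Y) q"
proof -
  have s: "tern s" "cost E l r neg s \<le> 4" and X: "X = {w \<in> V. s w \<noteq> 0}" using assms by (auto simp: bad_def)
  obtain w where w: "w \<in> X" "w \<in> Y" using assms(3) by auto
  \<comment> \<open>Negation keeps the cost, so the second map may be assumed to agree with
    \<open>s\<close> at a common vertex.\<close>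
  define t where "t = (if t0 w = s w then t0 else (\<lambda>w. - t0 w))"
  have t0: "tern t0" "cost E l r neg t0 \<le> 4" "Y = {w \<in> V. t0 w \<noteq> 0}" using assms(2) by (auto simp: bad_def)
  have trs: "s x = - 1 \<or> s x = 0 \<or> s x = 1" "t0 x = - 1 \<or> t0 x = 0 \<or> t0 x = 1" for x
    using s(1) t0(1) by (auto simp: tern_def)
  have t: "tern t" "cost E l r neg t \<le> 4" and Y: "Y = {w \<in> V. t w \<noteq> 0}" and tw: "s w = t w"
    using t0 w trs[of w] X by (auto simp: t_def cost_uminus tern_def)
  have bt: "bad Y t" using t Y assms(2) by (auto simp: bad_def)
  have trt: "t x = - 1 \<or> t x = 0 \<or> t x = 1" for x using t(1) by (auto simp: tern_def)
  define A where "A = {w \<in> V. s w \<noteq> 0 \<and> t w = s w}"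
  define C where "C = {w \<in> V. s w \<noteq> 0 \<and> t w = - s w}"
  have wV: "w \<in> V" "s w \<noteq> 0" using w X by auto
  note st = bad_meet_join[OF s(1) t(1) s(2) t(2) wV(1) tw wV(2)]
  have mnz: "meet f g x \<noteq> 0 \<longleftrightarrow> f x \<noteq> 0 \<and> g x = f x" for f g :: "'a \<Rightarrow> int" and x
    unfolding meet_def by metis
  have mA: "{w \<in> V. meet s t w \<noteq> 0} = A" unfolding A_def mnz ..
  have jC: "{w \<in> V. join s t w \<noteq> 0} = X \<union> Y - C"
    unfolding X Y C_def join_def sgn_0_0 add_eq_0_iff by auto
  show ?thesis
  proof (cases "C = {}")
    case True
    then show ?thesis using st(2) jC by auto
  next
    case False
    then obtain c where c: "c \<in> V" "s c \<noteq> 0" "t c = - s c" by (auto simp: C_def)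
    have "{w \<in> V. meet s (\<lambda>w. - t w) w \<noteq> 0} = C" unfolding C_def mnz by (auto simp: minus_equation_iff)
    then have bC: "\<exists>q. bad C q"
      using bad_meet_join(1)[of s "\<lambda>w. - t w" c] s t c by (auto simp: cost_uminus tern_def)
    have bA: "\<exists>q. bad A q" using st(1) mA by auto
    have A4: "dcut E l r A = 4" "even (card A)" and C4: "dcut E l r C = 4" "even (card C)"
      using bA bC bad_tight(2) bad_even by blast+
    have AC: "A \<inter> C = {}" "A \<union> C = X \<inter> Y"
    proof -
      have "s x \<noteq> 0 \<and> t x = s x \<or> s x \<noteq> 0 \<and> t x = - s x \<longleftrightarrow> s x \<noteq> 0 \<and> t x \<noteq> 0" for x
        using trs(1)[of x] trt[of x] by (elim disjE) simp_all
      then show "A \<union> C = X \<inter> Y" unfolding A_def C_def X Y by blast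
      have "\<not> (s x \<noteq> 0 \<and> t x = s x \<and> t x = - s x)" for x by linarith
      then show "A \<inter> C = {}" unfolding A_def C_def by blast
    qed
    have "dcut E l r A + dcut E l r C = dcut E l r (X \<inter> Y)"
      unfolding dcut_def sum.distrib[symmetric]
    proof (rule sum.cong[OF refl])
      fix e assume e: "e \<in> E"
      have "\<not> (l e \<in> A \<and> r e \<in> C \<or> l e \<in> C \<and> r e \<in> A)"
      proof
        assume a: "l e \<in> A \<and> r e \<in> C \<or> l e \<in> C \<and> r e \<in> A"
        then have "l e \<in> X \<inter> Y" "r e \<in> X \<inter> Y" using AC(2) by auto
        then have "ecost l r neg s e = 0" "ecost l r neg t e = 0"
          using bad_tight(4)[OF assms(1) e] bad_tight(4)[OF bt e] by (auto simp: crosses_def)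
        with a show False by (auto simp: ecost_def A_def C_def)
      qed
      then show "crosses l r A e + crosses l r C e = crosses l r (X \<inter> Y) e"
        using AC by (auto simp: crosses_def AC(2)[symmetric])
    qed
    then have "dcut E l r (X \<union> Y) = 0"
      using dcut_Int_Un[of E l r X Y] bad_tight(2)[OF assms(1)] bad_tight(2)[OF bt] A4 C4
        dcut_nonneg[of E l r "X \<union> Y"] by simp
    then have XYV: "X \<union> Y = V" using cut4[of "X \<union> Y"] w X Y by auto
    have fin: "finite X" "finite Y" "finite A" "finite C" using finV by (auto simp: X Y A_def C_def)
    have "card V + card (X \<inter> Y) = card X + card Y" using card_Un_Int[OF fin(1,2)] XYV by simp
    moreover have "card (X \<inter> Y) = card A + card C" using card_Un_disjoint[OF fin(3,4) AC(1)] AC(2) by simp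
    moreover have "even (card X)" "even (card Y)" using bad_even assms(1) bt by blast+
    ultimately have "even (card V)" using A4(2) C4(2) by presburger
    with odd_order show ?thesis by simp
  qed
qed

lemma ex_good_vertex: "\<exists>v\<in>V. \<forall>X s. bad X s \<longrightarrow> v \<notin> X"
proof (rule ccontr)
  assume n: "\<not> ?thesis"
  define \<M> where "\<M> = {X. (\<exists>s. bad X s) \<and> (\<forall>Y t. bad Y t \<longrightarrow> X \<subseteq> Y \<longrightarrow> X = Y)}"
  have sub: "X \<subseteq> V" if "bad X s" for X s using that by (auto simp: bad_def)
  have cov: "\<Union>\<M> = V"
  proof
    show "\<Union>\<M> \<subseteq> V" using sub by (auto simp: \<M>_def)
    show "V \<subseteq> \<Union>\<M>"
    proof
      fix v assume "v \<in> V"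
      then obtain X s where X: "bad X s" "v \<in> X" using n by blast
      have "finite {Y. \<exists>t. bad Y t}" by (rule finite_subset[of _ "Pow V"]) (use sub finV in auto)
      then obtain Y where Y: "Y \<in> {Y. \<exists>t. bad Y t}" "X \<subseteq> Y" "\<forall>Z\<in>{Y. \<exists>t. bad Y t}. Y \<subseteq> Z \<longrightarrow> Y = Z"
        using finite_has_maximal2[of "{Y. \<exists>t. bad Y t}" X] X(1) by blast
      then have "Y \<in> \<M>" by (auto simp: \<M>_def)
      with X(2) Y(2) show "v \<in> \<Union>\<M>" by blast
    qed
  qed
  have "2 dvd card (\<Union>\<M>)"
  proof (rule dvd_partition)
    show "finite (\<Union>\<M>)" using cov finV by simp
    show "\<forall>c\<in>\<M>. 2 dvd card c" using bad_even by (auto simp: \<M>_def)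
    show "\<forall>c1\<in>\<M>. \<forall>c2\<in>\<M>. c1 \<noteq> c2 \<longrightarrow> c1 \<inter> c2 = {}"
    proof (intro ballI impI)
      fix X Y assume XY: "X \<in> \<M>" "Y \<in> \<M>" "X \<noteq> Y"
      show "X \<inter> Y = {}"
      proof (rule ccontr)
        assume "X \<inter> Y \<noteq> {}"
        then obtain q where "bad (X \<union> Y) q" using XY bad_Un unfolding \<M>_def by blast
        then have "X = X \<union> Y" "Y = X \<union> Y" using XY by (auto simp: \<M>_def)
        with XY(3) show False by simp
      qed
    qed
  qed
  with cov odd_order show False by simp
qed

lemma rooted3_cut4: "\<exists>v\<in>V. rooted3 E l r neg v"
proof -
  obtain v where v: "v \<in> V" "\<And>X s. bad X s \<Longrightarrow> v \<notin> X" using ex_good_vertex by blast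
  have "rooted_graph V E l r neg v"
  proof unfold_locales
    show "4 \<le> dcut E l r K" if "K \<subseteq> V - {v}" "K \<noteq> {}" for K using cut4[of K] that v(1) by auto
    show "6 \<le> cost E l r neg s" if s: "tern s" "s v = 1" for s
    proof -
      have "\<not> cost E l r neg s \<le> 4"
      proof
        assume "cost E l r neg s \<le> 4"
        then have "bad {w \<in> V. s w \<noteq> 0} s" using s v(1) by (auto simp: bad_def)
        from v(2)[OF this] s v(1) show False by simp
      qed
      moreover have "even (cost E l r neg s)" by (rule cost_even[OF finE deg_even]) simp
      ultimately show ?thesis by presburger
    qed
    show "prod neg E = - 1" using odd_edges by simp
  qed (use finV finE ends deg_even deg6 v in auto)
  from rooted_graph_rooted3[OF this] v(1) show ?thesis by (rule bexI)
qed

end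

text \<open>The side \<open>X\<close> of even order of a cut with two edges \<open>b\<close>, \<open>b'\<close> is replaced by a single edge, for
  which \<open>b\<close> is reused. The edges that this edge stands for are odd in number.\<close>

lemma (in six_regular) two_cut:
  assumes X: "X \<subseteq> V" "X \<noteq> {}" "X \<noteq> V" "even (card X)" "dcut E l r X = 2"
    and IH: "\<And>V' E' l' r'. six_regular V' (E' :: 'e set) l' r' \<Longrightarrow> V' \<subset> V \<Longrightarrow> \<exists>v\<in>V'. rooted3 E' l' r' neg v"
  shows "\<exists>v\<in>V. rooted3 E l r neg v"
proof -
  have "dcut E l r X = int (card {e \<in> E. (l e \<in> X) \<noteq> (r e \<in> X)})"
    using finE by (simp add: dcut_def crosses_def Int_def)
  then have "card {e \<in> E. (l e \<in> X) \<noteq> (r e \<in> X)} = 2" using X(5) by simp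
  then obtain b b' where bb: "{e \<in> E. (l e \<in> X) \<noteq> (r e \<in> X)} = {b, b'}" "b \<noteq> b'"
    by (meson card_2_iff)
  have bE: "b \<in> E" "b' \<in> E" using bb(1) by auto
  have ex: "\<exists>x k. joins l r e x k \<and> x \<in> X \<and> k \<in> V - X" if "e \<in> {b, b'}" for e
  proof -
    have e: "e \<in> E" "(l e \<in> X) \<noteq> (r e \<in> X)" using that bb(1) by auto
    with ends[OF e(1)] show ?thesis by (auto simp: joins_def)
  qed
  obtain x k where xk: "joins l r b x k" "x \<in> X" "k \<in> V - X" using ex[of b] by auto
  obtain x' k' where xk': "joins l r b' x' k'" "x' \<in> X" "k' \<in> V - X" using ex[of b'] by auto
  define Q where "Q = {e \<in> E. l e \<notin> X \<and> r e \<notin> X}"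
  define H where "H = E - Q"
  define E' where "E' = insert b Q"
  define l' where "l' = l(b := k)"
  define r' where "r' = r(b := k')"
  have QE: "Q \<subseteq> E" and HE: "H \<subseteq> E" by (auto simp: Q_def H_def)
  have finQ: "finite Q" and finH: "finite H" using QE HE finE finite_subset by blast+
  have bQ: "b \<notin> Q" "b' \<notin> Q" using xk xk' by (auto simp: Q_def joins_def)
  have bH: "b \<in> H" "b' \<in> H" using bQ bE by (auto simp: H_def)
  have inner: "l e \<in> X \<and> r e \<in> X" if "e \<in> H" "e \<noteq> b" "e \<noteq> b'" for e
    using that bb(1) by (auto simp: H_def Q_def)
  have same: "l' e = l e" "r' e = r e" if "e \<in> Q" for e using that bQ by (auto simp: l'_def r'_def)
  have b': "l' b = k" "r' b = k'" by (auto simp: l'_def r'_def)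
  have sumH: "sum h H = h b + h b' + sum h (H - {b, b'})" for h :: "'e \<Rightarrow> int"
  proof -
    have "sum h H = sum h (H - {b, b'}) + sum h {b, b'}"
      by (rule sum.subset_diff) (use bH finH in auto)
    then show ?thesis using bb(2) by simp
  qed
  have sumE: "sum h E = sum h Q + sum h H" for h :: "'e \<Rightarrow> int"
    unfolding H_def using sum.subset_diff[OF QE finE, of h] by simp
  have dgH: "deg H l r w = of_bool (k = w) + of_bool (k' = w)" if "w \<notin> X" for w
  proof -
    have "(\<Sum>e\<in>H - {b, b'}. of_bool (l e = w) + of_bool (r e = w)) = (0::int)"
      by (rule sum.neutral) (use inner that in auto)
    moreover have "of_bool (l b = w) + of_bool (r b = w) = (of_bool (k = w) :: int)"
      "of_bool (l b' = w) + of_bool (r b' = w) = (of_bool (k' = w) :: int)"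
      using xk xk' that by (auto simp: joins_def)
    ultimately show ?thesis unfolding deg_def sumH by simp
  qed
  have dgE': "deg A l' r' w = of_bool (k = w) + of_bool (k' = w) + deg (A - {b}) l r w"
    if "b \<in> A" "A \<subseteq> E'" for A w
  proof -
    have "finite A" using that(2) finQ finite_subset by (auto simp: E'_def)
    have "deg (A - {b}) l' r' w = deg (A - {b}) l r w"
      by (rule deg_cong) (auto simp: l'_def r'_def)
    then show ?thesis using deg_remove[OF \<open>finite A\<close> that(1), of l' r' w] b' by simp
  qed
  have E'b: "E' - {b} = Q" using bQ by (auto simp: E'_def)
  \<comment> \<open>Counting edge ends in \<open>X\<close> gives 6 |X| = 2 (|H| - 2) + 2, so |H| = 3
    |X| + 1, which is odd because |X| is even. Hence one edge of sign -1 represents \<open>H\<close>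
    correctly.\<close>
  have cardH: "odd (card H)"
  proof -
    have "6 * int (card X) = (\<Sum>e\<in>Q. of_bool (l e \<in> X) + of_bool (r e \<in> X)) + (\<Sum>e\<in>H. of_bool (l e \<in> X) + of_bool (r e \<in> X))"
      unfolding card_darts[OF X(1)] by (rule sumE)
    also have "(\<Sum>e\<in>Q. of_bool (l e \<in> X) + of_bool (r e \<in> X)) = (0 :: int)"
      by (rule sum.neutral) (auto simp: Q_def)
    also have "(\<Sum>e\<in>H. of_bool (l e \<in> X) + of_bool (r e \<in> X)) = (1 + 1 + (\<Sum>e\<in>H - {b, b'}. 2) :: int)"
    proof -
      have "of_bool (l b \<in> X) + of_bool (r b \<in> X) = (1 :: int)" "of_bool (l b' \<in> X) + of_bool (r b' \<in> X) = (1 :: int)"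
        using xk xk' by (auto simp: joins_def)
      moreover have "(\<Sum>e\<in>H - {b, b'}. of_bool (l e \<in> X) + of_bool (r e \<in> X)) = (\<Sum>e\<in>H - {b, b'}. 2 :: int)"
        by (rule sum.cong) (use inner in auto)
      ultimately show ?thesis unfolding sumH by simp
    qed
    finally have "card (H - {b, b'}) + 1 = 3 * card X" by simp
    moreover have "card H = card (H - {b, b'}) + 2"
      using bH bb(2) finH card_mono[of H "{b, b'}"] by (simp add: card_Diff_subset)
    ultimately show ?thesis using X(4) by presburger
  qed
  have "six_regular (V - X) E' l' r'"
  proof
    show "finite (V - X)" "finite E'" using finV finQ by (auto simp: E'_def)
    show "l' e \<in> V - X \<and> r' e \<in> V - X" if "e \<in> E'" for e
      using that same b' xk(3) xk'(3) ends by (auto simp: E'_def Q_def)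
    show "deg E' l' r' w = 6" if "w \<in> V - X" for w
    proof -
      have "deg E l r w = deg Q l r w + deg H l r w" unfolding deg_def by (rule sumE)
      then show ?thesis using dgE'[of E' w] dgH[of w] deg6[of w] that E'b by (simp add: E'_def)
    qed
    show "odd (card (V - X))" using card_Diff_subset[OF _ X(1)] card_mono[OF finV X(1)] X finV odd_order finite_subset
      by fastforce
    show "0 < dcut E' l' r' K" if K: "K \<subseteq> V - X" "K \<noteq> {}" "K \<noteq> V - X" for K
    proof -
      have dE': "dcut E' l' r' K = of_bool ((k \<in> K) \<noteq> (k' \<in> K)) + dcut Q l r K"
      proof -
        have "sum (crosses l' r' K) Q = sum (crosses l r K) Q"
          by (rule sum.cong) (auto simp: crosses_def same)
        then show ?thesis using bQ finQ b' by (simp add: dcut_def E'_def crosses_def)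
      qed
      \<comment> \<open>A set \<open>K\<close> of the reduced graph can be lifted with or without
        \<open>X\<close>. When \<open>k\<close> and \<open>k'\<close> lie on the same side, placing
        \<open>X\<close> there too makes the two cuts equal.\<close>
      have dE: "dcut E l r M = of_bool ((x \<in> M) \<noteq> (k \<in> M)) + of_bool ((x' \<in> M) \<noteq> (k' \<in> M)) + dcut Q l r K"
        if M: "M = K \<or> M = K \<union> X" for M
      proof -
        have "dcut E l r M = dcut Q l r M + dcut H l r M" unfolding dcut_def by (rule sumE)
        moreover have "dcut Q l r M = dcut Q l r K" unfolding dcut_def
          by (rule sum.cong) (use M in \<open>auto simp: crosses_def Q_def\<close>)
        moreover have "dcut H l r M = of_bool ((x \<in> M) \<noteq> (k \<in> M)) + of_bool ((x' \<in> M) \<noteq> (k' \<in> M)) + (\<Sum>e\<in>H - {b, b'}. crosses l r M e)"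
          unfolding dcut_def sumH crosses_joins[OF xk(1)] crosses_joins[OF xk'(1)] by simp
        moreover have "(\<Sum>e\<in>H - {b, b'}. crosses l r M e) = 0"
        proof (rule sum.neutral, rule ballI)
          fix e assume "e \<in> H - {b, b'}"
          then have "l e \<in> X" "r e \<in> X" using inner by auto
          then show "crosses l r M e = 0" using M K(1) by (auto simp: crosses_def)
        qed
        ultimately show ?thesis by simp
      qed
      have xK: "x \<notin> K" "x' \<notin> K" using K(1) xk(2) xk'(2) by auto
      show ?thesis
      proof (cases "k \<in> K"; cases "k' \<in> K")
        assume kk: "k \<in> K" "k' \<in> K"
        have "0 < dcut E l r (K \<union> X)" by (rule cut_pos) (use K X in auto)
        then show ?thesis using dE[of "K \<union> X"] dE' kk xk(2) xk'(2) by simp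
      next
        assume kk: "k \<notin> K" "k' \<notin> K"
        have "0 < dcut E l r K" by (rule cut_pos) (use K X in auto)
        then show ?thesis using dE[of K] dE' kk xK by simp
      qed (use dE' dcut_nonneg[of Q l r K] in auto)
    qed
  qed
  then obtain v where v: "v \<in> V - X" "rooted3 E' l' r' neg v" using IH[of "V - X" E' l' r'] X by auto
  then obtain F where F: "(\<Union>i<(3::nat). F i) = E'" "disjoint_family_on F {..<3}"
    "\<And>i. i < 3 \<Longrightarrow> odd_part (F i) l' r' neg v"
    unfolding rooted3_def by blast
  have "b \<in> (\<Union>i<(3::nat). F i)" using F(1) by (simp add: E'_def)
  then obtain i where i: "i < 3" "b \<in> F i" by auto
  have FE': "F j \<subseteq> E'" if "j < 3" for j using F(1) that by blast
  have finF: "finite (F j)" if "j < 3" for j using FE'[OF that] finQ finite_subset by (auto simp: E'_def)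
  have nb: "b \<notin> F j" if "j < 3" "j \<noteq> i" for j using F(2) i that by (auto simp: disjoint_family_on_def)
  have FiQ: "F i - {b} \<subseteq> Q" using FE'[OF i(1)] by (auto simp: E'_def)
  have dis: "(F i - {b}) \<inter> H = {}" using FiQ by (auto simp: H_def)
  have finFi: "finite (F i - {b})" using finF[OF i(1)] by simp
  \<comment> \<open>The vertices of \<open>X\<close> not reached from \<open>x\<close> could be left
    only through \<open>b'\<close>, but every cut here is even and positive.\<close>
  have reachX: "(x, w) \<in> (adj H l r)\<^sup>*" if "w \<in> X" for w
  proof (rule ccontr)
    assume w: "(x, w) \<notin> (adj H l r)\<^sup>*"
    define M where "M = {w \<in> X. (x, w) \<notin> (adj H l r)\<^sup>*}"
    have "crosses l r M e \<le> of_bool (e = b')" if e: "e \<in> E" for e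
    proof (cases "e \<in> H")
      case False
      then have "l e \<notin> X" "r e \<notin> X" using e by (auto simp: H_def Q_def)
      then show ?thesis by (auto simp: crosses_def M_def)
    next
      case True
      show ?thesis
      proof (cases "e = b")
        case True
        have "x \<notin> M" "k \<notin> M" using xk by (auto simp: M_def)
        then show ?thesis using crosses_joins[OF xk(1), of M] True by simp
      next
        case False
        show ?thesis
        proof (cases "e = b'")
          case False
          have lr: "l e \<in> X" "r e \<in> X" using inner[OF True \<open>e \<noteq> b\<close> False] by auto
          have "(l e, r e) \<in> adj H l r" "(r e, l e) \<in> adj H l r"
            using True by (auto simp: adj_def joins_def)
          then have "(x, l e) \<in> (adj H l r)\<^sup>* \<longleftrightarrow> (x, r e) \<in> (adj H l r)\<^sup>*"
            by (meson rtrancl.rtrancl_into_rtrancl)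
          then show ?thesis using lr by (simp add: crosses_def M_def)
        qed (auto simp: crosses_def)
      qed
    qed
    then have "dcut E l r M \<le> (\<Sum>e\<in>E. of_bool (e = b'))" unfolding dcut_def by (rule sum_mono)
    also have "\<dots> \<le> 1" using finE by (simp add: of_bool_def)
    finally have "dcut E l r M \<le> 1" .
    moreover have "0 < dcut E l r M" by (rule cut_pos) (use w that X xk in \<open>auto simp: M_def\<close>)
    moreover have "dcut E l r M \<noteq> 1" using dcut_ev[of M] by auto
    ultimately show False by linarith
  qed
  \<comment> \<open>The part that contains the substitute edge receives all of \<open>H\<close> in
    its place. Outside \<open>X\<close> the degrees of \<open>H\<close> are those of that edge, and
    inside \<open>X\<close> they are the full degrees.\<close>
  define D where "D = (F i - {b}) \<union> H"
  have opD: "odd_part D l r neg v"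
    unfolding odd_part_def
  proof (intro conjI allI)
    have op: "odd_part (F i) l' r' neg v" by (rule F(3)[OF i(1)])
    have dgD: "deg D l r w = deg (F i - {b}) l r w + deg H l r w" for w
      unfolding D_def by (rule deg_Un[OF finFi finH dis])
    show "even (deg D l r w)" for w
    proof (cases "w \<in> X")
      case True
      have "deg A l r w = 0" if "A \<subseteq> Q" for A unfolding deg_def
        by (rule sum.neutral) (use True that in \<open>auto simp: Q_def\<close>)
      then have "deg (F i - {b}) l r w = 0" "deg Q l r w = 0" using FiQ by auto
      moreover have "deg E l r w = deg Q l r w + deg H l r w" unfolding deg_def by (rule sumE)
      ultimately show ?thesis using dgD[of w] deg_even[of w] by simp
    next
      case False
      then have "deg D l r w = deg (F i) l' r' w"
        using dgD[of w] dgH[OF False] dgE'[OF i(2) FE'[OF i(1)], of w] by linarith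
      moreover have "even (deg (F i) l' r' w)" using op unfolding odd_part_def by blast
      ultimately show ?thesis by simp
    qed
    have "card D = card (F i - {b}) + card H" unfolding D_def by (rule card_Un_disjoint[OF finFi finH dis])
    moreover have "card (F i - {b}) + 1 = card (F i)" using card.remove[OF finF[OF i(1)] i(2)] by simp
    moreover have "odd (card (F i))" using op prod_neg[of "F i"] unfolding odd_part_def by blast
    ultimately have "odd (card D)" using cardH by presburger
    then show "prod neg D = - 1" using prod_neg[of D] by blast
    let ?R = "\<lambda>w. (v, w) \<in> (adj D l r)\<^sup>*"
    have xw: "(x, w) \<in> (adj D l r)\<^sup>*" if "w \<in> X" for w
      using reachX[OF that] by (rule adj_rtrancl_mono) (auto simp: D_def)
    have kx: "(k, x) \<in> adj D l r" "(x', k') \<in> adj D l r"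
      using adj_edge[of b D l r k x] adj_edge[of b' D l r x' k'] xk(1) xk'(1) bH
      by (auto simp: D_def joins_def)
    have kw: "(k, w) \<in> (adj D l r)\<^sup>*" if "w \<in> X" for w
      using kx(1) xw[OF that] by simp
    have kk: "(k, k') \<in> (adj D l r)\<^sup>*" using kw[OF xk'(2)] kx(2) by simp
    have sub: "adj (F i) l' r' \<subseteq> (adj D l r)\<^sup>*"
    proof clarify
      fix p q assume "(p, q) \<in> adj (F i) l' r'"
      then obtain e where e: "e \<in> F i" "joins l' r' e p q" by (auto simp: adj_def)
      show "(p, q) \<in> (adj D l r)\<^sup>*"
      proof (cases "e = b")
        case True
        then have "p = k \<and> q = k' \<or> p = k' \<and> q = k" using e(2) b' by (auto simp: joins_def)
        then show ?thesis using kk adj_rtrancl_sym[OF kk] by auto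
      next
        case False
        then have "joins l r e p q" using e(2) by (auto simp: joins_def l'_def r'_def)
        then have "(p, q) \<in> adj D l r" using e(1) False by (intro adj_edge[of e]) (auto simp: D_def)
        then show ?thesis by simp
      qed
    qed
    have reach: "?R w" if "(v, w) \<in> (adj (F i) l' r')\<^sup>*" for w
      using rtrancl_subset_rtrancl[OF sub] that by blast
    have cn: "conn (F i) l' r' v" using op by (simp add: odd_part_def)
    have "(v, k) \<in> (adj (F i) l' r')\<^sup>*"
      using conn_ends[OF cn i(2) joins_lr] b'(1) by simp
    then have Rk: "?R k" by (rule reach)
    have RX: "?R w" if "w \<in> X" for w using Rk kw[OF that] by simp
    show "conn D l r v" unfolding conn_def
    proof
      fix e assume "e \<in> D"
      then consider "e \<in> F i" "e \<noteq> b" | "e \<in> H" by (auto simp: D_def)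
      then show "?R (l e)"
      proof cases
        case 1
        then have "(v, l' e) \<in> (adj (F i) l' r')\<^sup>*" using cn by (auto simp: conn_def)
        then show ?thesis using reach 1 by (simp add: l'_def)
      next
        case 2
        consider "e = b" | "e = b'" | "l e \<in> X" using inner[OF 2] by blast
        then show ?thesis
        proof cases
          case 1
          then show ?thesis using xk RX Rk by (auto simp: joins_def)
        next
          case 2
          have "?R k'" using Rk kk by simp
          then show ?thesis using 2 xk' RX by (auto simp: joins_def)
        qed (rule RX)
      qed
    qed
  qed
  have "rooted3 E l r neg v"
    unfolding rooted3_def
  proof (intro exI[of _ "F(i := D)"] conjI allI impI)
    let ?F = "F(i := D)"
    have FQ: "F j \<subseteq> Q" if "j < 3" "j \<noteq> i" for j using FE'[OF that(1)] nb[OF that] by (auto simp: E'_def)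
    show "odd_part (?F j) l r neg v" if j: "j < 3" for j
    proof (cases "j = i")
      case False
      have "odd_part (F j) l' r' neg v = odd_part (F j) l r neg v"
        by (rule odd_part_cong) (use nb[OF j False] in \<open>auto simp: l'_def r'_def\<close>)
      then show ?thesis using F(3)[OF j] False by simp
    qed (simp add: opD)
    show "disjoint_family_on ?F {..<3}"
      unfolding disjoint_family_on_def
    proof (intro ballI impI)
      have DF: "D \<inter> F j = {}" if "j < 3" "j \<noteq> i" for j
        using FQ[OF that] F(2) i(1) that by (auto simp: D_def H_def disjoint_family_on_def)
      fix m n :: nat assume mn: "m \<in> {..<3}" "n \<in> {..<3}" "m \<noteq> n"
      then show "?F m \<inter> ?F n = {}"
        using DF[of m] DF[of n] F(2) by (auto simp: disjoint_family_on_def)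
    qed
    show "(\<Union>j<(3::nat). ?F j) = E"
    proof
      show "(\<Union>j<(3::nat). ?F j) \<subseteq> E"
      proof
        fix e assume "e \<in> (\<Union>j<(3::nat). ?F j)"
        then obtain j where "j < 3" "e \<in> ?F j" by blast
        then show "e \<in> E" using FQ[of j] FiQ QE HE by (cases "j = i") (auto simp: D_def)
      qed
      show "E \<subseteq> (\<Union>j<(3::nat). ?F j)"
      proof
        fix e assume e: "e \<in> E"
        show "e \<in> (\<Union>j<(3::nat). ?F j)"
        proof (cases "e \<in> H")
          case True
          then have "e \<in> ?F i" by (simp add: D_def)
          then show ?thesis using i(1) by blast
        next
          case False
          then have "e \<in> Q" "e \<noteq> b" using e bH by (auto simp: H_def)
          then obtain j where j: "j < 3" "e \<in> F j" using F(1) by (auto simp: E'_def)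
          then have "e \<in> ?F j" using \<open>e \<noteq> b\<close> by (auto simp: D_def)
          then show ?thesis using j(1) by blast
        qed
      qed
    qed
  qed
  then show ?thesis using v(1) by blast
qed

lemma six_regular_rooted3:
  assumes "six_regular V E l r"
  shows "\<exists>v\<in>V. rooted3 E l r neg v"
  using assms
proof (induction "card V" arbitrary: V E l r rule: less_induct)
  case less
  interpret six_regular V E l r by (rule less.prems)
  show ?case
  proof (cases "\<exists>K\<subseteq>V. K \<noteq> {} \<and> K \<noteq> V \<and> dcut E l r K < 4")
    case False
    then interpret six_regular_cut4 V E l r by unfold_locales (auto simp: not_less)
    show ?thesis by (rule rooted3_cut4)
  next
    case True
    then obtain K where K: "K \<subseteq> V" "K \<noteq> {}" "K \<noteq> V" "dcut E l r K < 4" by blast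
    with cut_pos[OF K(1-3)] dcut_ev[of K] have d2: "dcut E l r K = 2" by presburger
    have dcomp: "dcut E l r (V - K) = dcut E l r K" unfolding dcut_def
      by (rule sum.cong) (use ends in \<open>auto simp: crosses_def\<close>)
    define X where "X = (if even (card K) then K else V - K)"
    have "card (V - K) = card V - card K" "card K \<le> card V"
      using K(1) finV card_Diff_subset[of K V] card_mono[of V K] finite_subset[of K V] by auto
    then have ev: "even (card X)" using odd_order by (simp add: X_def)
    have "X \<subseteq> V" "X \<noteq> {}" "X \<noteq> V" "dcut E l r X = 2" using K d2 dcomp by (auto simp: X_def)
    then show ?thesis
    proof (rule two_cut[OF _ _ _ ev])
      fix V' E' l' r' assume *: "six_regular V' (E' :: 'b set) l' r'" "V' \<subset> V"
      show "\<exists>v\<in>V'. rooted3 E' l' r' neg v"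
        by (rule less.hyps[OF psubset_card_mono[OF finV *(2)] *(1)])
    qed
  qed
qed

section \<open>Translation to multigraphs\<close>

lemma mdegree_deg:
  assumes "finite (medges H)" "\<And>e. e \<in> medges H \<Longrightarrow> mends H e = {l e, r e}"
  shows "int (mdegree H w) = deg (medges H) l r w"
proof -
  have "int (card {e \<in> medges H. w \<in> mends H e}) = (\<Sum>e\<in>medges H. of_bool (w \<in> mends H e))"
    using assms(1) by (simp add: Int_def)
  moreover have "int (card {e \<in> medges H. mends H e = {w}}) = (\<Sum>e\<in>medges H. of_bool (mends H e = {w}))"
    using assms(1) by (simp add: Int_def)
  ultimately have "int (mdegree H w) = (\<Sum>e\<in>medges H. of_bool (w \<in> mends H e) + of_bool (mends H e = {w}))"
    by (simp only: mdegree_def of_nat_add sum.distrib)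
  also have "\<dots> = deg (medges H) l r w" unfolding deg_def
    by (rule sum.cong) (auto simp: assms(2))
  finally show ?thesis .
qed

lemma madjacency_adj:
  assumes "\<And>e. e \<in> medges H \<Longrightarrow> mends H e = {l e, r e}"
  shows "madjacency H = adj (medges H) l r"
  unfolding madjacency_def adj_def joins_def using assms by (auto simp: doubleton_eq_iff)

theorem theorem2:
  fixes G :: "('v, 'e) multigraph"
  assumes "finite_multigraph G"
    and "mconnected G"
    and "mregular 6 G"
    and "odd (card (mverts G))"
  shows "\<exists>D. odd_decomposition 3 G D \<and> rooted G D"
proof -
  interpret finite_multigraph G by (rule assms(1))
  \<comment> \<open>The ends of an edge are put in an arbitrary order; a loop takes its single end
    twice, which gives it the contribution 2 in \<open>deg\<close>.\<close>
  have "\<exists>p. mends G e = {fst p, snd p}" if "e \<in> medges G" for e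
  proof -
    from card_mends[OF that] consider "card (mends G e) = 1" | "card (mends G e) = 2" by auto
    then show ?thesis
    proof cases
      case 1
      then obtain x where "mends G e = {x}" by (auto simp: card_1_singleton_iff)
      then show ?thesis by (intro exI[of _ "(x, x)"]) simp
    next
      case 2
      then obtain x y where "mends G e = {x, y}" by (auto simp: card_2_iff)
      then show ?thesis by (intro exI[of _ "(x, y)"]) simp
    qed
  qed
  then obtain p where p: "mends G e = {fst (p e), snd (p e)}" if "e \<in> medges G" for e by metis
  define l where "l e = fst (p e)" for e
  define r where "r e = snd (p e)" for e
  have lr: "mends G e = {l e, r e}" if "e \<in> medges G" for e using p[OF that] by (simp add: l_def r_def)
  let ?V = "mverts G" and ?E = "medges G"
  have lrV: "l e \<in> ?V \<and> r e \<in> ?V" if "e \<in> ?E" for e using mends_subset[OF that] lr[OF that] by auto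
  have "six_regular ?V ?E l r"
  proof
    show "deg ?E l r w = 6" if "w \<in> ?V" for w
      using mdegree_deg[OF finite_medges lr, of w] assms(3) that by (simp add: mregular_def)
    show "0 < dcut ?E l r K" if K: "K \<subseteq> ?V" "K \<noteq> {}" "K \<noteq> ?V" for K
    proof (rule ccontr)
      assume "\<not> 0 < dcut ?E l r K"
      then have "(\<Sum>e\<in>?E. crosses l r K e) = 0" using dcut_nonneg[of ?E l r K] by (simp add: dcut_def)
      then have cr: "crosses l r K e = 0" if "e \<in> ?E" for e
        using that finite_medges by (subst (asm) sum_nonneg_eq_0_iff) (auto simp: crosses_def)
      obtain u w where u: "u \<in> K" "w \<in> ?V" "w \<notin> K" using K by auto
      have "(u, w) \<in> (adj ?E l r)\<^sup>*"
        using assms(2) u K(1) madjacency_adj[OF lr] by (auto simp: mconnected_def)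
      then have "w \<in> K"
      proof (induction rule: rtrancl_induct)
        case (step y z)
        from step.hyps(2) obtain e where e: "e \<in> ?E" "joins l r e y z" by (auto simp: adj_def)
        then show ?case using cr[OF e(1)] crosses_joins[OF e(2), of K] step.IH by (auto split: if_splits)
      qed (rule u)
      with u show False by simp
    qed
  qed (use finite_mverts finite_medges lrV assms(4) in auto)
  then obtain v where v: "v \<in> ?V" "rooted3 ?E l r neg v" using six_regular_rooted3 by blast
  then obtain F where F: "(\<Union>i<(3::nat). F i) = ?E" "disjoint_family_on F {..<3}"
    "\<And>i. i < 3 \<Longrightarrow> odd_part (F i) l r neg v"
    unfolding rooted3_def by blast
  define S where "S i = \<lparr>mverts = insert v (l ` F i \<union> r ` F i), medges = F i, mends = mends G\<rparr>" for i
  have S: "mverts (S i) = insert v (l ` F i \<union> r ` F i)" "medges (S i) = F i" "mends (S i) = mends G" for i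
    by (simp_all add: S_def)
  have FE: "F i \<subseteq> ?E" if "i < 3" for i using F(1) that by blast
  have finF: "finite (F i)" if "i < 3" for i using FE[OF that] finite_medges finite_subset by blast
  have oddF: "odd (card (F i))" if "i < 3" for i using F(3)[OF that] prod_neg[of "F i"] unfolding odd_part_def by blast
  then have F0: "F i \<noteq> {}" if "i < 3" for i using that by fastforce
  have lrS: "mends (S i) e = {l e, r e}" if "i < 3" "e \<in> medges (S i)" for i e
    using lr FE that by (auto simp: S)
  have sub: "msubgraph (S i) G" if i: "i < 3" for i
    unfolding msubgraph_def
  proof (intro conjI)
    show "finite_multigraph (S i)"
    proof
      show "finite (mverts (S i))" "finite (medges (S i))" using finF[OF i] by (simp_all add: S)
      show "mends (S i) e \<subseteq> mverts (S i)" if "e \<in> medges (S i)" for e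
        using lrS[OF i that] that by (auto simp: S)
      show "card (mends (S i) e) \<in> {1, 2}" if "e \<in> medges (S i)" for e
        using card_mends[of e] that FE[OF i] by (auto simp: S)
    qed
    show "mverts (S i) \<subseteq> ?V" using lrV FE[OF i] v(1) by (auto simp: S)
  qed (use FE[OF i] in \<open>auto simp: S\<close>)
  have eul: "eulerian (S i)" if i: "i < 3" for i
    unfolding eulerian_def mconnected_def
  proof (intro conjI ballI)
    show "mverts (S i) \<noteq> {}" by (simp add: S)
    have adj: "madjacency (S i) = adj (F i) l r"
      using madjacency_adj[of "S i" l r] lrS[OF i] by (simp add: S)
    have cn: "conn (F i) l r v" using F(3)[OF i] by (simp add: odd_part_def)
    have reach: "(v, w) \<in> (adj (F i) l r)\<^sup>*" if "w \<in> mverts (S i)" for w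
      using that conn_ends[OF cn _ joins_lr] conn_ends[OF cn _ joins_sym[OF joins_lr]] by (auto simp: S)
    show "(u, w) \<in> (madjacency (S i))\<^sup>*" if "u \<in> mverts (S i)" "w \<in> mverts (S i)" for u w
      unfolding adj using adj_rtrancl_sym[OF reach[OF that(1)]] reach[OF that(2)] by (rule rtrancl_trans)
    show "even (mdegree (S i) w)" for w
    proof -
      have "int (mdegree (S i) w) = deg (F i) l r w"
        using mdegree_deg[of "S i" l r w] lrS[OF i] finF[OF i] by (simp add: S)
      then show ?thesis using F(3)[OF i] unfolding odd_part_def by (metis even_of_nat)
    qed
  qed
  define D where "D = S ` {..<3}"
  \<comment> \<open>\<open>D\<close> is a set, so it has three members only because the parts are
    nonempty and disjoint, hence distinct.\<close>
  have injS: "inj_on S {..<3}"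
  proof (rule inj_onI)
    fix i j assume ij: "i \<in> {..<3::nat}" "j \<in> {..<3}" "S i = S j"
    then have "F i = F j" by (metis S(2))
    then show "i = j" using F(2) F0[of i] ij unfolding disjoint_family_on_def by fastforce
  qed
  have "disjoint_family_on medges D"
    unfolding disjoint_family_on_def D_def
  proof (intro ballI impI)
    fix A B assume "A \<in> S ` {..<3}" "B \<in> S ` {..<3}" "A \<noteq> B"
    then obtain i j where "A = S i" "B = S j" "i < 3" "j < 3" "i \<noteq> j" by blast
    then show "medges A \<inter> medges B = {}" using F(2) by (simp add: S disjoint_family_on_def)
  qed
  then have "decomposition G D"
    using sub F0 F(1) by (auto simp: decomposition_def D_def S)
  moreover have "card D = 3" unfolding D_def using card_image[OF injS] by simp
  ultimately have "odd_decomposition 3 G D"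
    using eul oddF by (auto simp: odd_decomposition_def D_def S)
  moreover have "rooted G D" using v(1) by (auto simp: rooted_def D_def S)
  ultimately show ?thesis by blast
qed

end
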